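(* Let $A$ be a convenient algebra with unit, let $M$ be a convenient $A$-bimodule and let $n\ge 1$. Let $d^n:A^n\to\Omega_n(A)$ be the $n$-linear map $d^n(a_1,\dots,a_n)=da_1\otimes_A\cdots\otimes_A da_n$. Then the mapping $$(d^n)^*:\operatorname{Hom}_A^A(\Omega_n(A),M)\to \bar Z^n(A,M),\qquad \Phi\mapsto \Phi\circ d^n,$$ is an isomorphism onto the space $\bar Z^n(A,M)$ of all normalized and bounded Hochschild $n$-cocycles of $A$ with values in $M$.
   Context: The ground field is $\mathbb R$. A convenient vector space is a Hausdorff locally convex space in which every Mackey-Cauchy sequence converges ($(x_n)$ is Mackey-Cauchy if $x_n-x_m$ is Mackey convergent to $0$, i.e. becomes bounded after multiplication by suitable scalars tending to $\infty$); it is always equipped with its bornological topology. A map is bounded if it maps bounded sets to bounded sets. $L(E,F)$ is the convenient space of bounded linear maps, whose bounded sets are those uniformly bounded on bounded subsets of $E$. Isomorphisms of convenient vector spaces are bounded linear bijections with bounded inverse. $E\tilde\otimes F$ is the convenient vector space with a universal bounded bilinear map from $E\times F$. A convenient algebra is a convenient vector space $A$ with a bounded bilinear associative multiplication and a unit $1$. A convenient $A$-bimodule is a convenient vector space with commuting unital left and right $A$-actions given by bounded bilinear maps. $\operatorname{Hom}_A^A(M,N)$ is the space of bounded $A$-bimodule homomorphisms, a closed subspace of $L(M,N)$. $M\tilde\otimes_A N$ is the convenient vector space with a universal bounded bilinear map $(m,n)\mapsto m\otimes_A n$ satisfying $ma\otimes_A n=m\otimes_A an$. $\Omega_0(A)=A$;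 $\Omega_1(A)=\ker(\mu:A\tilde\otimes A\to A)$, where $\mu$ is the multiplication and $A\tilde\otimes A$ has the bimodule structure $a(b\otimes c)a'=ab\otimes ca'$; $d:A\to\Omega_1(A)$ is $da=1\otimes a-a\otimes 1$; and $\Omega_n(A)=\Omega_1(A)\tilde\otimes_A\cdots\tilde\otimes_A\Omega_1(A)$ ($n$ factors), a convenient $A$-bimodule. A bounded Hochschild $n$-cochain with values in $M$ is a bounded $n$-linear map $c:A^n\to M$; it is normalized if it factors over $(A/\mathbb R)^n$, i.e. vanishes if one argument lies in $\mathbb R\cdot 1$. It is a cocycle if $\delta c=0$, where $$(\delta c)(a_1,\dots,a_{n+1})=a_1c(a_2,\dots,a_{n+1})+\sum_{i=1}^n(-1)^ic(a_1,\dots,a_ia_{i+1},\dots,a_{n+1})+(-1)^{n+1}c(a_1,\dots,a_n)a_{n+1}.$$ *)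

theory Defs
  imports "HOL-Analysis.Analysis" "HOL-Analysis.Finite_Function_Topology"
begin

section \<open>Convenient vector spaces\<close>

text \<open>
  A topological vector space is represented by a topology \<open>E :: 'a topology\<close> whose
  underlying set \<open>topspace E\<close> is a linear subspace of the real vector space \<open>'a\<close>.
\<close>

definition locally_convex_space :: "'a::real_vector topology \<Rightarrow> bool" where
  "locally_convex_space E \<longleftrightarrow>
     subspace (topspace E) \<and>
     continuous_map (prod_topology E E) E (\<lambda>(x, y). x + y) \<and>
     continuous_map (prod_topology euclideanreal E) E (\<lambda>(c, x). c *\<^sub>R x) \<and>
     (\<forall>U. openin E U \<and> 0 \<in> U \<longrightarrow> (\<exists>V. openin E V \<and> 0 \<in> V \<and> convex V \<and> V \<subseteq> U))"

definition absorbs :: "'a::real_vector set \<Rightarrow> 'a set \<Rightarrow> bool" where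
  "absorbs V B \<longleftrightarrow> (\<exists>r>0. \<forall>t. r \<le> \<bar>t\<bar> \<longrightarrow> B \<subseteq> (\<lambda>x. t *\<^sub>R x) ` V)"

definition bounded_in :: "'a::real_vector topology \<Rightarrow> 'a set \<Rightarrow> bool" where
  "bounded_in E B \<longleftrightarrow>
     B \<subseteq> topspace E \<and> (\<forall>U. openin E U \<and> 0 \<in> U \<longrightarrow> absorbs U B)"

definition absolutely_convex :: "'a::real_vector set \<Rightarrow> bool" where
  "absolutely_convex V \<longleftrightarrow> convex V \<and> (\<forall>x\<in>V. \<forall>c. \<bar>c\<bar> \<le> 1 \<longrightarrow> c *\<^sub>R x \<in> V)"

definition mackey_cauchy :: "'a::real_vector topology \<Rightarrow> (nat \<Rightarrow> 'a) \<Rightarrow> bool" where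
  "mackey_cauchy E x \<longleftrightarrow>
     range x \<subseteq> topspace E \<and>
     (\<exists>\<mu> :: nat \<times> nat \<Rightarrow> real.
        filterlim \<mu> at_top (sequentially \<times>\<^sub>F sequentially) \<and>
        bounded_in E (range (\<lambda>(n, m). \<mu> (n, m) *\<^sub>R (x n - x m))))"

text \<open>
  The finest locally convex topology on \<open>S\<close> in which all members of \<open>\<B>\<close> are bounded, given
  by its filter of absolutely convex neighbourhoods of zero.
\<close>

definition absorbing_nbhd :: "'a::real_vector set \<Rightarrow> 'a set set \<Rightarrow> 'a set \<Rightarrow> bool" where
  "absorbing_nbhd S \<B> V \<longleftrightarrow>
     V \<subseteq> S \<and> 0 \<in> V \<and> absolutely_convex V \<and> (\<forall>B\<in>\<B>. absorbs V B)"

definition bornology_topology :: "'a::real_vector set \<Rightarrow> 'a set set \<Rightarrow> 'a topology" where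
  "bornology_topology S \<B> =
     topology (\<lambda>U. U \<subseteq> S \<and> (\<forall>x\<in>U. \<exists>V. absorbing_nbhd S \<B> V \<and> (+) x ` V \<subseteq> U))"

definition bornologification :: "'a::real_vector topology \<Rightarrow> 'a topology" where
  "bornologification E = bornology_topology (topspace E) (Collect (bounded_in E))"

text \<open>
  The last clause expresses the convention that a convenient vector space carries its
  bornological topology.
\<close>

definition convenient_space :: "'a::real_vector topology \<Rightarrow> bool" where
  "convenient_space E \<longleftrightarrow>
     locally_convex_space E \<and> Hausdorff_space E \<and>
     (\<forall>x. mackey_cauchy E x \<longrightarrow> (\<exists>l. limitin E x l sequentially)) \<and>
     bornologification E = E"


section \<open>Bounded linear, bilinear and multilinear maps\<close>

definition bounded_linear_maps ::
  "'a::real_vector topology \<Rightarrow> 'b::real_vector topology \<Rightarrow> ('a \<Rightarrow> 'b) set" where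
  "bounded_linear_maps E F =
     {f \<in> topspace E \<rightarrow>\<^sub>E topspace F.
        (\<forall>x\<in>topspace E. \<forall>y\<in>topspace E. f (x + y) = f x + f y) \<and>
        (\<forall>c. \<forall>x\<in>topspace E. f (c *\<^sub>R x) = c *\<^sub>R f x) \<and>
        (\<forall>B. bounded_in E B \<longrightarrow> bounded_in F (f ` B))}"

definition bounded_bilinear_map ::
  "'a::real_vector topology \<Rightarrow> 'b::real_vector topology \<Rightarrow> 'c::real_vector topology \<Rightarrow>
     ('a \<Rightarrow> 'b \<Rightarrow> 'c) \<Rightarrow> bool" where
  "bounded_bilinear_map E F G f \<longleftrightarrow>
     (\<forall>x\<in>topspace E. \<forall>y\<in>topspace F. f x y \<in> topspace G) \<and>
     (\<forall>x\<in>topspace E. \<forall>x'\<in>topspace E. \<forall>y\<in>topspace F. f (x + x') y = f x y + f x' y) \<and>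
     (\<forall>x\<in>topspace E. \<forall>y\<in>topspace F. \<forall>y'\<in>topspace F. f x (y + y') = f x y + f x y') \<and>
     (\<forall>c. \<forall>x\<in>topspace E. \<forall>y\<in>topspace F.
        f (c *\<^sub>R x) y = c *\<^sub>R f x y \<and> f x (c *\<^sub>R y) = c *\<^sub>R f x y) \<and>
     (\<forall>B C. bounded_in E B \<and> bounded_in F C \<longrightarrow> bounded_in G ((\<lambda>(x, y). f x y) ` (B \<times> C)))"

text \<open>Elements of \<open>E\<^sup>n\<close> are lists of length \<open>n\<close>; the bornology is that of the product.\<close>

definition tuples :: "'a topology \<Rightarrow> nat \<Rightarrow> 'a list set" where
  "tuples E n = {xs. length xs = n \<and> set xs \<subseteq> topspace E}"

definition bounded_tuples :: "'a::real_vector topology \<Rightarrow> nat \<Rightarrow> 'a list set \<Rightarrow> bool" where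
  "bounded_tuples E n S \<longleftrightarrow>
     S \<subseteq> tuples E n \<and> (\<forall>i<n. bounded_in E ((\<lambda>xs. xs ! i) ` S))"

definition bounded_multilinear_maps ::
  "'a::real_vector topology \<Rightarrow> nat \<Rightarrow> 'b::real_vector topology \<Rightarrow> ('a list \<Rightarrow> 'b) set" where
  "bounded_multilinear_maps E n F =
     {c \<in> tuples E n \<rightarrow>\<^sub>E topspace F.
        (\<forall>xs\<in>tuples E n. \<forall>i<n. \<forall>x\<in>topspace E. \<forall>y\<in>topspace E.
           c (xs[i := x + y]) = c (xs[i := x]) + c (xs[i := y])) \<and>
        (\<forall>xs\<in>tuples E n. \<forall>i<n. \<forall>r. \<forall>x\<in>topspace E.
           c (xs[i := r *\<^sub>R x]) = r *\<^sub>R c (xs[i := x])) \<and>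
        (\<forall>S. bounded_tuples E n S \<longrightarrow> bounded_in F (c ` S))}"


section \<open>Convenient algebras and bimodules\<close>

record 'a algebra_data =
  alg_space :: "'a topology"
  alg_mult :: "'a \<Rightarrow> 'a \<Rightarrow> 'a"
  alg_one :: 'a

definition convenient_algebra :: "'a::real_vector algebra_data \<Rightarrow> bool" where
  "convenient_algebra A \<longleftrightarrow>
     convenient_space (alg_space A) \<and>
     bounded_bilinear_map (alg_space A) (alg_space A) (alg_space A) (alg_mult A) \<and>
     (\<forall>a\<in>topspace (alg_space A). \<forall>b\<in>topspace (alg_space A). \<forall>c\<in>topspace (alg_space A).
        alg_mult A (alg_mult A a b) c = alg_mult A a (alg_mult A b c)) \<and>
     alg_one A \<in> topspace (alg_space A) \<and>
     (\<forall>a\<in>topspace (alg_space A). alg_mult A (alg_one A) a = a \<and> alg_mult A a (alg_one A) = a)"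

record ('a, 'm) bimodule_data =
  mod_space :: "'m topology"
  lact :: "'a \<Rightarrow> 'm \<Rightarrow> 'm"
  ract :: "'m \<Rightarrow> 'a \<Rightarrow> 'm"

definition convenient_bimodule ::
  "'a::real_vector algebra_data \<Rightarrow> ('a, 'm::real_vector) bimodule_data \<Rightarrow> bool" where
  "convenient_bimodule A M \<longleftrightarrow>
     convenient_space (mod_space M) \<and>
     bounded_bilinear_map (alg_space A) (mod_space M) (mod_space M) (lact M) \<and>
     bounded_bilinear_map (mod_space M) (alg_space A) (mod_space M) (ract M) \<and>
     (\<forall>m\<in>topspace (mod_space M). lact M (alg_one A) m = m \<and> ract M m (alg_one A) = m) \<and>
     (\<forall>a\<in>topspace (alg_space A). \<forall>b\<in>topspace (alg_space A). \<forall>m\<in>topspace (mod_space M).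
        lact M (alg_mult A a b) m = lact M a (lact M b m) \<and>
        ract M m (alg_mult A a b) = ract M (ract M m a) b \<and>
        ract M (lact M a m) b = lact M a (ract M m b))"

definition bimodule_homs ::
  "'a::real_vector algebra_data \<Rightarrow> ('a, 'm::real_vector) bimodule_data \<Rightarrow>
     ('a, 'n::real_vector) bimodule_data \<Rightarrow> ('m \<Rightarrow> 'n) set" where
  "bimodule_homs A M N =
     {\<Phi> \<in> bounded_linear_maps (mod_space M) (mod_space N).
        \<forall>a\<in>topspace (alg_space A). \<forall>m\<in>topspace (mod_space M).
          \<Phi> (lact M a m) = lact N a (\<Phi> m) \<and> \<Phi> (ract M m a) = ract N (\<Phi> m) a}"

definition bounded_homs ::
  "'a::real_vector algebra_data \<Rightarrow> ('a, 'm::real_vector) bimodule_data \<Rightarrow>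
     ('a, 'n::real_vector) bimodule_data \<Rightarrow> ('m \<Rightarrow> 'n) set \<Rightarrow> bool" where
  "bounded_homs A M N H \<longleftrightarrow>
     H \<subseteq> bimodule_homs A M N \<and>
     (\<forall>B. bounded_in (mod_space M) B \<longrightarrow> bounded_in (mod_space N) (\<Union>\<Phi>\<in>H. \<Phi> ` B))"


section \<open>Tensor products\<close>

text \<open>
  Tensor products are characterised by their universal property, which asks for a unique
  factorisation through every convenient vector space \<open>G\<close>.  A formula cannot quantify over all
  types, so \<open>G\<close> ranges over the convenient vector spaces carried by subspaces of one large type:
  the real vector space with basis the terms that can be formed from elements of \<open>E \<times> F\<close> and of
  \<open>T\<close> by addition, scalar multiplication and limits of sequences.  It contains isomorphic copies
  of \<open>T\<close> and of every convenient vector space generated by the image of a bilinear map on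
  \<open>E \<times> F\<close>, so no generality is lost: theorem \<open>universal_bilinear_factorization\<close> below
  derives the universal property for convenient vector spaces \<open>G\<close> over arbitrary types.
\<close>

datatype 'x limit_term =
    Gen 'x
  | Plus "'x limit_term" "'x limit_term"
  | Scale real "'x limit_term"
  | Lim "nat \<Rightarrow> 'x limit_term"

type_synonym ('e, 'f, 't) test_vector = "(('e \<times> 'f + 't) limit_term, real) poly_mapping"

text \<open>
  \<open>universal_bilinear E F R T \<tau>\<close>: the bilinear map \<open>\<tau>\<close> into \<open>T\<close> is universal among the bounded
  bilinear maps on \<open>E \<times> F\<close> that identify the pairs related by \<open>R\<close>.
\<close>

definition universal_bilinear ::
  "'e::real_vector topology \<Rightarrow> 'f::real_vector topology \<Rightarrow> (('e \<times> 'f) \<times> ('e \<times> 'f)) set \<Rightarrow>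
     't::real_vector topology \<Rightarrow> ('e \<Rightarrow> 'f \<Rightarrow> 't) \<Rightarrow> bool" where
  "universal_bilinear E F R T \<tau> \<longleftrightarrow>
     convenient_space T \<and> bounded_bilinear_map E F T \<tau> \<and> (\<lambda>(x, y). \<tau> x y) respects R \<and>
     (\<forall>(G :: ('e, 'f, 't) test_vector topology) f.
        convenient_space G \<and> bounded_bilinear_map E F G f \<and> (\<lambda>(x, y). f x y) respects R \<longrightarrow>
        (\<exists>!h. h \<in> bounded_linear_maps T G \<and>
              (\<forall>x\<in>topspace E. \<forall>y\<in>topspace F. h (\<tau> x y) = f x y)))"

definition tensor_product ::
  "'e::real_vector topology \<Rightarrow> 'f::real_vector topology \<Rightarrow> 't::real_vector topology \<Rightarrow>
     ('e \<Rightarrow> 'f \<Rightarrow> 't) \<Rightarrow> bool" where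
  "tensor_product E F T \<tau> \<longleftrightarrow> universal_bilinear E F {} T \<tau>"

definition balanced_pairs ::
  "'a algebra_data \<Rightarrow> ('a, 'm) bimodule_data \<Rightarrow> ('a, 'n) bimodule_data \<Rightarrow>
     (('m \<times> 'n) \<times> ('m \<times> 'n)) set" where
  "balanced_pairs A M N =
     {((ract M m a, n), (m, lact N a n)) | m a n.
        m \<in> topspace (mod_space M) \<and> a \<in> topspace (alg_space A) \<and> n \<in> topspace (mod_space N)}"

definition tensor_product_over ::
  "'a::real_vector algebra_data \<Rightarrow> ('a, 'm::real_vector) bimodule_data \<Rightarrow>
     ('a, 'n::real_vector) bimodule_data \<Rightarrow> 't::real_vector topology \<Rightarrow> ('m \<Rightarrow> 'n \<Rightarrow> 't) \<Rightarrow> bool"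
where
  "tensor_product_over A M N T \<tau> \<longleftrightarrow>
     universal_bilinear (mod_space M) (mod_space N) (balanced_pairs A M N) T \<tau>"

text \<open>The bimodule structures \<open>a (b \<otimes> c) a' = a b \<otimes> c a'\<close>.\<close>

definition bimodule_tensor_square ::
  "'a::real_vector algebra_data \<Rightarrow> ('a, 't::real_vector) bimodule_data \<Rightarrow> ('a \<Rightarrow> 'a \<Rightarrow> 't) \<Rightarrow> bool"
where
  "bimodule_tensor_square A T \<tau> \<longleftrightarrow>
     tensor_product (alg_space A) (alg_space A) (mod_space T) \<tau> \<and>
     convenient_bimodule A T \<and>
     (\<forall>a\<in>topspace (alg_space A). \<forall>b\<in>topspace (alg_space A). \<forall>c\<in>topspace (alg_space A).
        lact T a (\<tau> b c) = \<tau> (alg_mult A a b) c \<and>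
        ract T (\<tau> b c) a = \<tau> b (alg_mult A c a))"

definition bimodule_tensor_over ::
  "'a::real_vector algebra_data \<Rightarrow> ('a, 'm::real_vector) bimodule_data \<Rightarrow>
     ('a, 'n::real_vector) bimodule_data \<Rightarrow> ('a, 't::real_vector) bimodule_data \<Rightarrow>
     ('m \<Rightarrow> 'n \<Rightarrow> 't) \<Rightarrow> bool" where
  "bimodule_tensor_over A M N T \<tau> \<longleftrightarrow>
     tensor_product_over A M N (mod_space T) \<tau> \<and>
     convenient_bimodule A T \<and>
     (\<forall>a\<in>topspace (alg_space A). \<forall>m\<in>topspace (mod_space M). \<forall>n\<in>topspace (mod_space N).
        lact T a (\<tau> m n) = \<tau> (lact M a m) n \<and>
        ract T (\<tau> m n) a = \<tau> m (ract N n a))"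


section \<open>Noncommutative differential forms\<close>

definition mult_on_tensor ::
  "'a::real_vector algebra_data \<Rightarrow> ('a, 't::real_vector) bimodule_data \<Rightarrow> ('a \<Rightarrow> 'a \<Rightarrow> 't) \<Rightarrow> 't \<Rightarrow> 'a"
where
  "mult_on_tensor A T \<tau> =
     (THE \<mu>. \<mu> \<in> bounded_linear_maps (mod_space T) (alg_space A) \<and>
        (\<forall>a\<in>topspace (alg_space A). \<forall>b\<in>topspace (alg_space A). \<mu> (\<tau> a b) = alg_mult A a b))"

definition one_forms ::
  "'a::real_vector algebra_data \<Rightarrow> ('a, 't::real_vector) bimodule_data \<Rightarrow> ('a \<Rightarrow> 'a \<Rightarrow> 't) \<Rightarrow>
     ('a, 't) bimodule_data" where
  "one_forms A T \<tau> =
     T\<lparr>mod_space := bornologification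
         (subtopology (mod_space T) {t. mult_on_tensor A T \<tau> t = 0})\<rparr>"

definition d_one :: "'a algebra_data \<Rightarrow> ('a \<Rightarrow> 'a \<Rightarrow> 't::real_vector) \<Rightarrow> 'a \<Rightarrow> 't" where
  "d_one A \<tau> a = \<tau> (alg_one A) a - \<tau> a (alg_one A)"

text \<open>
  For \<open>n \<ge> 1\<close>, \<open>\<Omega> n\<close> is the \<open>n\<close>-fold tensor product over \<open>A\<close> of the one-forms, bracketed to the
  left, with \<open>\<theta> n\<close> the universal map \<open>\<Omega> n \<times> \<Omega> 1 \<rightarrow> \<Omega> (n + 1)\<close>.  The tensor products are only
  determined up to isomorphism; \<open>T\<close>, \<open>\<tau>\<close>, \<open>\<Omega>\<close>, \<open>\<theta>\<close> range over all choices.  The value \<open>\<Omega> 0\<close> is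
  not used.
\<close>

definition differential_forms ::
  "'a::real_vector algebra_data \<Rightarrow> ('a, 'w::real_vector) bimodule_data \<Rightarrow> ('a \<Rightarrow> 'a \<Rightarrow> 'w) \<Rightarrow>
     (nat \<Rightarrow> ('a, 'w) bimodule_data) \<Rightarrow> (nat \<Rightarrow> 'w \<Rightarrow> 'w \<Rightarrow> 'w) \<Rightarrow> bool" where
  "differential_forms A T \<tau> \<Omega> \<theta> \<longleftrightarrow>
     bimodule_tensor_square A T \<tau> \<and>
     \<Omega> 1 = one_forms A T \<tau> \<and>
     (\<forall>n\<ge>1. bimodule_tensor_over A (\<Omega> n) (\<Omega> 1) (\<Omega> (Suc n)) (\<theta> n))"

text \<open>\<open>d_power A \<tau> \<theta> n [a\<^sub>1, \<dots>, a\<^sub>n] = da\<^sub>1 \<otimes>\<^sub>A \<cdots> \<otimes>\<^sub>A da\<^sub>n\<close> for \<open>n \<ge> 1\<close>; the value for \<open>n = 0\<close> is a dummy.\<close>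

fun d_power ::
  "'a algebra_data \<Rightarrow> ('a \<Rightarrow> 'a \<Rightarrow> 'w::real_vector) \<Rightarrow> (nat \<Rightarrow> 'w \<Rightarrow> 'w \<Rightarrow> 'w) \<Rightarrow> nat \<Rightarrow> 'a list \<Rightarrow> 'w"
where
  "d_power A \<tau> \<theta> 0 xs = 0"
| "d_power A \<tau> \<theta> (Suc 0) xs = d_one A \<tau> (hd xs)"
| "d_power A \<tau> \<theta> (Suc (Suc n)) xs =
     \<theta> (Suc n) (d_power A \<tau> \<theta> (Suc n) (butlast xs)) (d_one A \<tau> (last xs))"


section \<open>Normalized bounded Hochschild cocycles\<close>

text \<open>\<open>xs ! (i - 1)\<close> is \<open>a\<^sub>i\<close>, since lists are indexed from \<open>0\<close>.\<close>

definition hochschild_coboundary ::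
  "'a algebra_data \<Rightarrow> ('a, 'm::real_vector) bimodule_data \<Rightarrow> nat \<Rightarrow> ('a list \<Rightarrow> 'm) \<Rightarrow> 'a list \<Rightarrow> 'm"
where
  "hochschild_coboundary A M n c xs =
     lact M (hd xs) (c (tl xs)) +
     (\<Sum>i = 1..n. (-1) ^ i *\<^sub>R
        c (take (i - 1) xs @ [alg_mult A (xs ! (i - 1)) (xs ! i)] @ drop (i + 1) xs)) +
     (-1) ^ (n + 1) *\<^sub>R ract M (c (butlast xs)) (last xs)"

definition normalized_cochain ::
  "'a::real_vector algebra_data \<Rightarrow> nat \<Rightarrow> ('a list \<Rightarrow> 'm::zero) \<Rightarrow> bool" where
  "normalized_cochain A n c \<longleftrightarrow>
     (\<forall>xs\<in>tuples (alg_space A) n. (\<exists>i<n. \<exists>r. xs ! i = r *\<^sub>R alg_one A) \<longrightarrow> c xs = 0)"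

definition normalized_cocycles ::
  "'a::real_vector algebra_data \<Rightarrow> ('a, 'm::real_vector) bimodule_data \<Rightarrow> nat \<Rightarrow> ('a list \<Rightarrow> 'm) set"
where
  "normalized_cocycles A M n =
     {c \<in> bounded_multilinear_maps (alg_space A) n (mod_space M).
        normalized_cochain A n c \<and>
        (\<forall>xs\<in>tuples (alg_space A) (n + 1). hochschild_coboundary A M n c xs = 0)}"

definition bounded_cocycles ::
  "'a::real_vector algebra_data \<Rightarrow> ('a, 'm::real_vector) bimodule_data \<Rightarrow> nat \<Rightarrow>
     ('a list \<Rightarrow> 'm) set \<Rightarrow> bool" where
  "bounded_cocycles A M n C \<longleftrightarrow>
     C \<subseteq> normalized_cocycles A M n \<and>
     (\<forall>S. bounded_tuples (alg_space A) n S \<longrightarrow> bounded_in (mod_space M) (\<Union>c\<in>C. c ` S))"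


section \<open>Isomorphisms between spaces of maps\<close>

text \<open>
  \<open>H\<close> and \<open>Z\<close> are spaces of extensional maps on \<open>D\<close> and \<open>D'\<close> with pointwise vector space
  operations; \<open>bdH\<close> and \<open>bdZ\<close> are their systems of bounded sets.
\<close>

definition bornological_isomorphism ::
  "'x set \<Rightarrow> ('x \<Rightarrow> 'm::real_vector) set \<Rightarrow> (('x \<Rightarrow> 'm) set \<Rightarrow> bool) \<Rightarrow>
   'y set \<Rightarrow> ('y \<Rightarrow> 'n::real_vector) set \<Rightarrow> (('y \<Rightarrow> 'n) set \<Rightarrow> bool) \<Rightarrow>
     (('x \<Rightarrow> 'm) \<Rightarrow> ('y \<Rightarrow> 'n)) \<Rightarrow> bool" where
  "bornological_isomorphism D H bdH D' Z bdZ f \<longleftrightarrow>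
     bij_betw f H Z \<and>
     (\<forall>\<Phi>\<in>H. \<forall>\<Psi>\<in>H. f (\<lambda>x\<in>D. \<Phi> x + \<Psi> x) = (\<lambda>y\<in>D'. f \<Phi> y + f \<Psi> y)) \<and>
     (\<forall>r. \<forall>\<Phi>\<in>H. f (\<lambda>x\<in>D. r *\<^sub>R \<Phi> x) = (\<lambda>y\<in>D'. r *\<^sub>R f \<Phi> y)) \<and>
     (\<forall>C\<subseteq>H. bdH C \<longrightarrow> bdZ (f ` C)) \<and>
     (\<forall>C\<subseteq>Z. bdZ C \<longrightarrow> bdH (inv_into H f ` C))"


section \<open>The universal property over arbitrary types\<close>

text \<open>
  The rest of this theory proves that \<open>universal_bilinear\<close> entails the universal property with
  respect to convenient vector spaces over arbitrary types.  Nothing above depends on it.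
\<close>

definition linear_on_set :: "'a::real_vector set \<Rightarrow> ('a \<Rightarrow> 'b::real_vector) \<Rightarrow> bool" where
  "linear_on_set S f \<longleftrightarrow>
     (\<forall>x\<in>S. \<forall>y\<in>S. f (x + y) = f x + f y) \<and> (\<forall>c. \<forall>x\<in>S. f (c *\<^sub>R x) = c *\<^sub>R f x)"

lemma linear_on_set_diff:
  assumes "linear_on_set S f" "subspace S" "x \<in> S" "y \<in> S"
  shows "f (x - y) = f x - f y"
proof -
  have "f (x + (-1) *\<^sub>R y) = f x + f ((-1) *\<^sub>R y)"
    using assms subspace_scale[of S y "-1"] unfolding linear_on_set_def by blast
  also have "f ((-1) *\<^sub>R y) = (-1) *\<^sub>R f y"
    using assms unfolding linear_on_set_def by blast
  finally show ?thesis by simp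
qed

lemma linear_on_set_zero:
  assumes "linear_on_set S f" "subspace S"
  shows "f 0 = 0"
  using linear_on_set_diff[OF assms subspace_0 subspace_0] assms(2) by simp

lemma lcs_add:
  assumes "locally_convex_space G" "limitin G x l F" "limitin G y k F"
  shows "limitin G (\<lambda>i. x i + y i) (l + k) F"
proof -
  have "limitin (prod_topology G G) (\<lambda>i. (x i, y i)) (l, k) F"
    using assms by (simp add: limitin_pairwise o_def)
  from continuous_map_limit[OF _ this, of G "\<lambda>(x, y). x + y"] assms(1)
  show ?thesis by (simp add: locally_convex_space_def o_def)
qed

lemma lcs_scale_cont:
  assumes "locally_convex_space G"
  shows "continuous_map G G (\<lambda>x. c *\<^sub>R x)"
proof -
  have "continuous_map G (prod_topology euclideanreal G) (\<lambda>x. (c, x))"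
    by (intro continuous_map_pairedI) auto
  from continuous_map_compose[OF this, of G "\<lambda>(c, x). c *\<^sub>R x"] assms
  show ?thesis by (simp add: locally_convex_space_def o_def)
qed

lemma lcs_add_cont:
  assumes "locally_convex_space G" "a \<in> topspace G"
  shows "continuous_map G G (\<lambda>x. a + x)"
proof -
  have "continuous_map G (prod_topology G G) (\<lambda>x. (a, x))"
    using assms by (intro continuous_map_pairedI) auto
  from continuous_map_compose[OF this, of G "\<lambda>(x, y). x + y"] assms
  show ?thesis by (simp add: locally_convex_space_def o_def)
qed

lemma lcs_scale:
  assumes "locally_convex_space G" "limitin G x l F"
  shows "limitin G (\<lambda>i. c *\<^sub>R x i) (c *\<^sub>R l) F"
  using continuous_map_limit[OF lcs_scale_cont[OF assms(1), of c] assms(2)] by (simp add: o_def)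

lemma absolutely_convex_scale:
  assumes "absolutely_convex V" "\<bar>s\<bar> \<le> \<bar>t\<bar>"
  shows "(\<lambda>x. s *\<^sub>R x) ` V \<subseteq> (\<lambda>x. t *\<^sub>R x) ` V"
proof (cases "t = 0")
  case True
  then show ?thesis using assms by auto
next
  case False
  show ?thesis
  proof clarify
    fix x assume "x \<in> V"
    then have "(s / t) *\<^sub>R x \<in> V"
      using assms False by (auto simp: absolutely_convex_def field_simps)
    moreover have "s *\<^sub>R x = t *\<^sub>R ((s / t) *\<^sub>R x)" using False by simp
    ultimately show "s *\<^sub>R x \<in> (\<lambda>x. t *\<^sub>R x) ` V" by blast
  qed
qed

lemma absorbs_absolutely_convex:
  assumes "absolutely_convex V" "B \<subseteq> (\<lambda>x. t *\<^sub>R x) ` V"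
  shows "absorbs V B"
  unfolding absorbs_def
proof (intro exI[of _ "max 1 \<bar>t\<bar>"] conjI allI impI)
  fix s assume "max 1 \<bar>t\<bar> \<le> \<bar>s\<bar>"
  then have "\<bar>t\<bar> \<le> \<bar>s\<bar>" by simp
  then show "B \<subseteq> (\<lambda>x. s *\<^sub>R x) ` V"
    using absolutely_convex_scale[OF assms(1)] assms(2) by blast
qed auto

lemma absorbs_scaled:
  assumes "absorbs V B"
  shows "\<exists>t>0. B \<subseteq> (\<lambda>x. t *\<^sub>R x) ` V"
proof -
  obtain r where r: "r > 0" "\<And>t. r \<le> \<bar>t\<bar> \<Longrightarrow> B \<subseteq> (\<lambda>x. t *\<^sub>R x) ` V"
    using assms unfolding absorbs_def by blast
  then show ?thesis using r(2)[OF abs_ge_self] by blast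
qed

lemma absorbs_mono:
  assumes "absorbs V B" "V \<subseteq> W" "C \<subseteq> B"
  shows "absorbs W C"
  using assms unfolding absorbs_def by (meson image_mono order_trans)

lemma absorbs_image_scale:
  assumes "absorbs V B" "c > 0"
  shows "absorbs ((\<lambda>x. c *\<^sub>R x) ` V) B"
proof -
  obtain r where r: "r > 0" "\<And>t. r \<le> \<bar>t\<bar> \<Longrightarrow> B \<subseteq> (\<lambda>x. t *\<^sub>R x) ` V"
    using assms unfolding absorbs_def by blast
  show ?thesis
    unfolding absorbs_def
  proof (intro exI[of _ "r / c"] conjI allI impI)
    fix t assume "r / c \<le> \<bar>t\<bar>"
    then have "r \<le> \<bar>t * c\<bar>" using assms(2) by (simp add: abs_mult field_simps)
    from r(2)[OF this] show "B \<subseteq> (\<lambda>x. t *\<^sub>R x) ` (\<lambda>x. c *\<^sub>R x) ` V"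
      by (simp add: image_image)
  qed (use r assms in auto)
qed

lemma absorbs_Int:
  assumes V: "absolutely_convex V" "absorbs V B" and W: "absolutely_convex W" "absorbs W B"
  shows "absorbs (V \<inter> W) B"
proof -
  obtain r where r: "r > 0" "\<And>t. r \<le> \<bar>t\<bar> \<Longrightarrow> B \<subseteq> (\<lambda>x. t *\<^sub>R x) ` V"
    using V unfolding absorbs_def by blast
  obtain s where s: "s > 0" "\<And>t. s \<le> \<bar>t\<bar> \<Longrightarrow> B \<subseteq> (\<lambda>x. t *\<^sub>R x) ` W"
    using W unfolding absorbs_def by blast
  show ?thesis
    unfolding absorbs_def
  proof (intro exI[of _ "max r s"] conjI allI impI)
    fix t assume t: "max r s \<le> \<bar>t\<bar>"
    then have t0: "t \<noteq> 0" using r(1) by auto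
    have "B \<subseteq> (\<lambda>x. t *\<^sub>R x) ` V \<inter> (\<lambda>x. t *\<^sub>R x) ` W" using r(2) s(2) t by auto
    also have "\<dots> = (\<lambda>x. t *\<^sub>R x) ` (V \<inter> W)"
      using t0 by (subst image_Int) (auto simp: inj_on_def)
    finally show "B \<subseteq> (\<lambda>x. t *\<^sub>R x) ` (V \<inter> W)" .
  qed (use r in auto)
qed

lemma absolutely_convex_Int:
  "absolutely_convex V \<Longrightarrow> absolutely_convex W \<Longrightarrow> absolutely_convex (V \<inter> W)"
  by (auto simp: absolutely_convex_def convex_Int)

lemma lcs_absolutely_convex_nbhd:
  assumes G: "locally_convex_space G" and U: "openin G U" "0 \<in> U"
  obtains W where "openin G W" "0 \<in> W" "absolutely_convex W" "W \<subseteq> U"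
proof -
  obtain V where V: "openin G V" "0 \<in> V" "convex V" "V \<subseteq> U"
    using assms unfolding locally_convex_space_def by blast
  let ?V' = "{x \<in> topspace G. (-1) *\<^sub>R x \<in> V}"
  have sub: "subspace (topspace G)" using G by (simp add: locally_convex_space_def)
  have o: "openin G ?V'"
    using lcs_scale_cont[OF G, of "-1"] V(1) by (rule openin_continuous_map_preimage)
  have cV': "convex ?V'"
  proof (rule convexI)
    fix x y and u v :: real
    assume h: "x \<in> ?V'" "y \<in> ?V'" "0 \<le> u" "0 \<le> v" "u + v = 1"
    have "u *\<^sub>R ((-1) *\<^sub>R x) + v *\<^sub>R ((-1) *\<^sub>R y) \<in> V"
      using h V(3) unfolding convex_def by blast
    moreover have "u *\<^sub>R x + v *\<^sub>R y \<in> topspace G"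
      using h sub by (simp add: subspace_add subspace_scale)
    ultimately show "u *\<^sub>R x + v *\<^sub>R y \<in> ?V'"
      by (simp add: scaleR_add_right)
  qed
  let ?W = "V \<inter> ?V'"
  have cW: "convex ?W" using V(3) cV' by (simp add: convex_Int)
  have 0: "0 \<in> ?W" using V sub by (auto simp: subspace_0)
  have sym: "- x \<in> ?W" if "x \<in> ?W" for x
    using that openin_subset[OF V(1)] sub by (auto simp: subspace_neg)
  have "absolutely_convex ?W"
    unfolding absolutely_convex_def
  proof (intro conjI ballI allI impI cW)
    fix x and c :: real assume x: "x \<in> ?W" and c: "\<bar>c\<bar> \<le> 1"
    have *: "d *\<^sub>R y \<in> ?W" if "y \<in> ?W" "0 \<le> d" "d \<le> 1" for y and d :: real
    proof -
      have "d *\<^sub>R y + (1 - d) *\<^sub>R 0 \<in> ?W"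
        by (rule convexD[OF cW that(1) 0]) (use that in auto)
      then show ?thesis by simp
    qed
    show "c *\<^sub>R x \<in> ?W"
    proof (cases "c \<ge> 0")
      case True then show ?thesis using * x c by simp
    next
      case False
      then have "(-c) *\<^sub>R (- x) \<in> ?W" using *[OF sym[OF x], of "-c"] c by simp
      then show ?thesis by simp
    qed
  qed
  then show ?thesis using that[of ?W] V o 0 by (auto intro: openin_Int)
qed

lemma bounded_inI:
  assumes G: "locally_convex_space G" and B: "B \<subseteq> topspace G"
    and *: "\<And>W. openin G W \<Longrightarrow> 0 \<in> W \<Longrightarrow> absolutely_convex W \<Longrightarrow> \<exists>t. B \<subseteq> (\<lambda>x. t *\<^sub>R x) ` W"
  shows "bounded_in G B"
  unfolding bounded_in_def
proof (intro conjI allI impI B)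
  fix U assume U: "openin G U \<and> 0 \<in> U"
  obtain W where W: "openin G W" "0 \<in> W" "absolutely_convex W" "W \<subseteq> U"
    using U by (auto intro: lcs_absolutely_convex_nbhd[OF G, of U])
  obtain t where "B \<subseteq> (\<lambda>x. t *\<^sub>R x) ` W" using * W by blast
  then have "absorbs W B" using W absorbs_absolutely_convex by blast
  then show "absorbs U B" using W(4) absorbs_mono by blast
qed

lemma bounded_in_singleton:
  assumes G: "locally_convex_space G" and x: "x \<in> topspace G"
  shows "bounded_in G {x}"
proof (rule bounded_inI[OF G])
  fix W assume W: "openin G W" "0 \<in> W" "absolutely_convex W"
  have "limitin euclideanreal (\<lambda>n. inverse (real (Suc n))) 0 sequentially"
    using LIMSEQ_inverse_real_of_nat by simp
  then have "limitin (prod_topology euclideanreal G) (\<lambda>n. (inverse (real (Suc n)), x)) (0, x) sequentially"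
    using x by (simp add: limitin_pairwise o_def limitin_const_iff)
  from continuous_map_limit[OF _ this, of G "\<lambda>(c, x). c *\<^sub>R x"] G
  have "limitin G (\<lambda>n. inverse (real (Suc n)) *\<^sub>R x) 0 sequentially"
    by (simp add: locally_convex_space_def o_def)
  then have "eventually (\<lambda>n. inverse (real (Suc n)) *\<^sub>R x \<in> W) sequentially"
    using W by (simp add: limitin_def)
  then obtain n where n: "inverse (real (Suc n)) *\<^sub>R x \<in> W"
    by (auto simp: eventually_sequentially)
  have "x = real (Suc n) *\<^sub>R (inverse (real (Suc n)) *\<^sub>R x)" by simp
  then have "{x} \<subseteq> (\<lambda>x. real (Suc n) *\<^sub>R x) ` W" using n by blast
  then show "\<exists>t. {x} \<subseteq> (\<lambda>x. t *\<^sub>R x) ` W" by blast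
qed (use x in auto)

lemma absorbing_nbhd_scale:
  assumes S: "subspace S" and V: "absorbing_nbhd S \<B> V" and c: "c > 0"
  shows "absorbing_nbhd S \<B> ((\<lambda>x. c *\<^sub>R x) ` V)"
  unfolding absorbing_nbhd_def
proof (intro conjI ballI)
  show "(\<lambda>x. c *\<^sub>R x) ` V \<subseteq> S"
    using V S by (auto simp: absorbing_nbhd_def subspace_scale subset_iff)
  show "0 \<in> (\<lambda>x. c *\<^sub>R x) ` V"
    using V by (force simp: absorbing_nbhd_def)
  show "absolutely_convex ((\<lambda>x. c *\<^sub>R x) ` V)"
    unfolding absolutely_convex_def
  proof (intro conjI ballI allI impI)
    show "convex ((\<lambda>x. c *\<^sub>R x) ` V)"
      using V by (simp add: absorbing_nbhd_def absolutely_convex_def convex_scaling)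
    fix y and d :: real assume "y \<in> (\<lambda>x. c *\<^sub>R x) ` V" "\<bar>d\<bar> \<le> 1"
    then obtain x where "x \<in> V" "y = c *\<^sub>R x" "d *\<^sub>R x \<in> V"
      using V by (auto simp: absorbing_nbhd_def absolutely_convex_def)
    moreover from this have "d *\<^sub>R y = c *\<^sub>R (d *\<^sub>R x)" by simp
    ultimately show "d *\<^sub>R y \<in> (\<lambda>x. c *\<^sub>R x) ` V" by blast
  qed
  fix B assume "B \<in> \<B>"
  then show "absorbs ((\<lambda>x. c *\<^sub>R x) ` V) B"
    using V by (intro absorbs_image_scale c) (simp add: absorbing_nbhd_def)
qed

lemma absorbing_nbhd_Int:
  assumes "absorbing_nbhd S \<B> V" "absorbing_nbhd S \<B> W"
  shows "absorbing_nbhd S \<B> (V \<inter> W)"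
  using assms by (auto simp: absorbing_nbhd_def absolutely_convex_Int absorbs_Int)

lemma openin_bornology_topology:
  "openin (bornology_topology S \<B>) U \<longleftrightarrow>
     U \<subseteq> S \<and> (\<forall>x\<in>U. \<exists>V. absorbing_nbhd S \<B> V \<and> (+) x ` V \<subseteq> U)"
proof -
  let ?P = "\<lambda>U. U \<subseteq> S \<and> (\<forall>x\<in>U. \<exists>V. absorbing_nbhd S \<B> V \<and> (+) x ` V \<subseteq> U)"
  have "istopology ?P"
    unfolding istopology_def
  proof (intro conjI allI impI)
    fix U W assume U: "?P U" and W: "?P W"
    show "U \<inter> W \<subseteq> S" using U by auto
    show "\<forall>x\<in>U \<inter> W. \<exists>V. absorbing_nbhd S \<B> V \<and> (+) x ` V \<subseteq> U \<inter> W"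
    proof
      fix x assume "x \<in> U \<inter> W"
      then obtain V1 V2 where "absorbing_nbhd S \<B> V1" "(+) x ` V1 \<subseteq> U"
        "absorbing_nbhd S \<B> V2" "(+) x ` V2 \<subseteq> W"
        using U W by blast
      then show "\<exists>V. absorbing_nbhd S \<B> V \<and> (+) x ` V \<subseteq> U \<inter> W"
        by (intro exI[of _ "V1 \<inter> V2"]) (auto intro: absorbing_nbhd_Int)
    qed
  next
    fix \<K> assume K: "\<forall>K\<in>\<K>. ?P K"
    show "\<Union>\<K> \<subseteq> S" using K by blast
    show "\<forall>x\<in>\<Union>\<K>. \<exists>V. absorbing_nbhd S \<B> V \<and> (+) x ` V \<subseteq> \<Union>\<K>"
    proof
      fix x assume "x \<in> \<Union>\<K>"
      then obtain K where "K \<in> \<K>" "x \<in> K" by blast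
      then show "\<exists>V. absorbing_nbhd S \<B> V \<and> (+) x ` V \<subseteq> \<Union>\<K>"
        using K by (meson Union_upper order_trans)
    qed
  qed
  then show ?thesis unfolding bornology_topology_def by (simp add: topology_inverse')
qed

lemma topspace_bornology_topology:
  assumes S: "subspace S" and B: "\<And>B. B \<in> \<B> \<Longrightarrow> B \<subseteq> S"
  shows "topspace (bornology_topology S \<B>) = S"
proof -
  have "absorbing_nbhd S \<B> S"
    unfolding absorbing_nbhd_def absolutely_convex_def
  proof (intro conjI ballI allI impI)
    show "0 \<in> S" "convex S" using S by (auto simp: subspace_0 subspace_imp_convex)
    show "c *\<^sub>R x \<in> S" if "x \<in> S" for c x using S that by (simp add: subspace_scale)
    fix B' assume "B' \<in> \<B>"
    then have "B' \<subseteq> (\<lambda>x. t *\<^sub>R x) ` S" if "t \<noteq> 0" for t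
    proof -
      have "x = t *\<^sub>R (inverse t *\<^sub>R x)" for x :: 'a using that by simp
      moreover have "inverse t *\<^sub>R x \<in> S" if "x \<in> B'" for x
        using S B \<open>B' \<in> \<B>\<close> that by (simp add: subset_iff subspace_scale)
      ultimately show ?thesis by blast
    qed
    then show "absorbs S B'" unfolding absorbs_def by (intro exI[of _ 1]) auto
  qed auto
  then have "openin (bornology_topology S \<B>) S"
    unfolding openin_bornology_topology using S by (auto simp: subspace_add absorbing_nbhd_def intro!: exI[of _ S])
  then show ?thesis
    by (metis openin_bornology_topology openin_subset openin_topspace subset_antisym)
qed

lemma bornology_topology_continuous:
  assumes S: "subspace S" and B: "\<And>B. B \<in> \<B> \<Longrightarrow> B \<subseteq> S"
    and F: "locally_convex_space F" and f: "linear_on_set S f" "f ` S \<subseteq> topspace F"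
    and bd: "\<And>B. B \<in> \<B> \<Longrightarrow> bounded_in F (f ` B)"
  shows "continuous_map (bornology_topology S \<B>) F f"
proof -
  have top: "topspace (bornology_topology S \<B>) = S"
    by (rule topspace_bornology_topology[OF S B])
  show ?thesis
    unfolding continuous_map_def top
  proof (intro conjI allI impI)
    show "f \<in> S \<rightarrow> topspace F" using f by auto
    fix U assume U: "openin F U"
    show "openin (bornology_topology S \<B>) {x \<in> S. f x \<in> U}"
      unfolding openin_bornology_topology
    proof (intro conjI ballI)
      fix x assume "x \<in> {x \<in> S. f x \<in> U}"
      then have x: "x \<in> S" "f x \<in> U" by auto
      have xF: "f x \<in> topspace F" using x f by auto
      let ?U = "{y \<in> topspace F. f x + y \<in> U}"
      have "openin F ?U" using lcs_add_cont[OF F xF] U by (rule openin_continuous_map_preimage)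
      moreover have "0 \<in> ?U" using x F by (auto simp: locally_convex_space_def subspace_0)
      ultimately obtain W where W: "openin F W" "0 \<in> W" "absolutely_convex W" "W \<subseteq> ?U"
        by (rule lcs_absolutely_convex_nbhd[OF F])
      have f0: "f 0 = 0" using f(1) S by (rule linear_on_set_zero)
      let ?V = "{y \<in> S. f y \<in> W}"
      have "absorbing_nbhd S \<B> ?V"
        unfolding absorbing_nbhd_def
      proof (intro conjI ballI)
        show "0 \<in> ?V" using S W f0 by (simp add: subspace_0)
        show "absolutely_convex ?V"
          unfolding absolutely_convex_def
        proof (intro conjI ballI allI impI convexI)
          fix y z and u v :: real assume "y \<in> ?V" "z \<in> ?V" "0 \<le> u" "0 \<le> v" "u + v = 1"
          moreover from this have "f (u *\<^sub>R y + v *\<^sub>R z) = u *\<^sub>R f y + v *\<^sub>R f z"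
            using f(1) S by (simp add: linear_on_set_def subspace_scale)
          ultimately show "u *\<^sub>R y + v *\<^sub>R z \<in> ?V"
            using S W(3) by (simp add: subspace_add subspace_scale absolutely_convex_def convex_def)
        next
          fix y and c :: real assume "y \<in> ?V" "\<bar>c\<bar> \<le> 1"
          then show "c *\<^sub>R y \<in> ?V"
            using f(1) S W(3) by (simp add: subspace_scale absolutely_convex_def linear_on_set_def)
        qed
        fix B' assume B': "B' \<in> \<B>"
        then have "absorbs W (f ` B')" using bd W by (simp add: bounded_in_def)
        then obtain r where r: "r > 0" "\<And>t. r \<le> \<bar>t\<bar> \<Longrightarrow> f ` B' \<subseteq> (\<lambda>x. t *\<^sub>R x) ` W"
          unfolding absorbs_def by blast
        show "absorbs ?V B'"
          unfolding absorbs_def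
        proof (intro exI[of _ r] conjI allI impI r(1) subsetI)
          fix t y assume t: "r \<le> \<bar>t\<bar>" and y: "y \<in> B'"
          then have t0: "t \<noteq> 0" using r(1) by auto
          obtain w where w: "w \<in> W" "f y = t *\<^sub>R w" using r(2)[OF t] y by blast
          have yS: "y \<in> S" using B B' y by blast
          then have "f (inverse t *\<^sub>R y) = w" using w f(1) t0 by (simp add: linear_on_set_def)
          then have "inverse t *\<^sub>R y \<in> ?V" using yS w S by (simp add: subspace_scale)
          moreover have "y = t *\<^sub>R (inverse t *\<^sub>R y)" using t0 by simp
          ultimately show "y \<in> (\<lambda>x. t *\<^sub>R x) ` ?V" by blast
        qed
      qed auto
      moreover have "(+) x ` ?V \<subseteq> {x \<in> S. f x \<in> U}"
        using x f(1) S W(4) by (auto simp: subspace_add linear_on_set_def)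
      ultimately show "\<exists>V. absorbing_nbhd S \<B> V \<and> (+) x ` V \<subseteq> {x \<in> S. f x \<in> U}" by blast
    qed auto
  qed
qed


lemma absorbing_nbhd_interior:
  assumes S: "subspace S" and V: "absorbing_nbhd S \<B> V"
  obtains W where "openin (bornology_topology S \<B>) W" "0 \<in> W" "convex W" "W \<subseteq> V"
proof -
  have aV: "absolutely_convex V" "0 \<in> V" "V \<subseteq> S" using V by (auto simp: absorbing_nbhd_def)
  let ?W = "\<Union>c\<in>{0..<1::real}. (\<lambda>x. c *\<^sub>R x) ` V"
  have mem: "c *\<^sub>R x \<in> ?W" if "x \<in> V" "0 \<le> c" "c < 1" for c x
    using that by auto
  have sub: "?W \<subseteq> V"
    using aV(1) by (auto simp: absolutely_convex_def)
  have "openin (bornology_topology S \<B>) ?W"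
    unfolding openin_bornology_topology
  proof (intro conjI ballI)
    show "?W \<subseteq> S" using sub aV by blast
    fix y assume "y \<in> ?W"
    then obtain c x where c: "0 \<le> c" "c < 1" and x: "x \<in> V" "y = c *\<^sub>R x" by auto
    define e where "e = (1 - c) / 2"
    have e: "e > 0" "c + e < 1" using c by (auto simp: e_def field_simps)
    have "(+) y ` (\<lambda>x. e *\<^sub>R x) ` V \<subseteq> ?W"
    proof clarify
      fix z assume z: "z \<in> V"
      let ?u = "(c / (c + e)) *\<^sub>R x + (e / (c + e)) *\<^sub>R z"
      have "?u \<in> V"
      proof (rule convexD)
        show "convex V" using aV(1) by (simp add: absolutely_convex_def)
        show "c / (c + e) + e / (c + e) = 1" using c e by (simp add: add_divide_distrib[symmetric])
      qed (use x z c e in auto)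
      then have "(c + e) *\<^sub>R ?u \<in> ?W" by (rule mem) (use c e in auto)
      moreover have "(c + e) *\<^sub>R ?u = y + e *\<^sub>R z"
        using c e x by (simp add: scaleR_add_right)
      ultimately show "y + e *\<^sub>R z \<in> ?W" by simp
    qed
    then show "\<exists>V. absorbing_nbhd S \<B> V \<and> (+) y ` V \<subseteq> ?W"
      using absorbing_nbhd_scale[OF S V e(1)] by blast
  qed
  moreover have "0 \<in> ?W" using mem[OF aV(2), of 0] by simp
  moreover have "convex ?W"
  proof (rule convexI)
    fix x y and u v :: real
    assume h: "x \<in> ?W" "y \<in> ?W" "0 \<le> u" "0 \<le> v" "u + v = 1"
    obtain c a where a: "0 \<le> c" "c < 1" "a \<in> V" "x = c *\<^sub>R a" using h by auto
    obtain d b where b: "0 \<le> d" "d < 1" "b \<in> V" "y = d *\<^sub>R b" using h by auto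
    define m where "m = max c d"
    have m: "0 \<le> m" "m < 1" "c \<le> m" "d \<le> m" using a b by (auto simp: m_def)
    obtain a' where a': "a' \<in> V" "x = m *\<^sub>R a'"
      using absolutely_convex_scale[OF aV(1), of c m] a m by fastforce
    obtain b' where b': "b' \<in> V" "y = m *\<^sub>R b'"
      using absolutely_convex_scale[OF aV(1), of d m] b m by fastforce
    have "u *\<^sub>R a' + v *\<^sub>R b' \<in> V"
      using aV(1) a' b' h unfolding absolutely_convex_def convex_def by blast
    then have "m *\<^sub>R (u *\<^sub>R a' + v *\<^sub>R b') \<in> ?W" by (rule mem) (use m in auto)
    moreover have "m *\<^sub>R (u *\<^sub>R a' + v *\<^sub>R b') = u *\<^sub>R x + v *\<^sub>R y"
      using a' b' by (simp add: scaleR_add_right mult.commute)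
    ultimately show "u *\<^sub>R x + v *\<^sub>R y \<in> ?W" by simp
  qed
  ultimately show ?thesis using that sub by blast
qed

lemma locally_convex_bornology_topology:
  assumes S: "subspace S" and B: "\<And>B. B \<in> \<B> \<Longrightarrow> B \<subseteq> S" and sing: "\<And>x. x \<in> S \<Longrightarrow> {x} \<in> \<B>"
  shows "locally_convex_space (bornology_topology S \<B>)"
proof -
  let ?E = "bornology_topology S \<B>"
  have nb: "\<exists>W. openin ?E W \<and> x \<in> W \<and> W \<subseteq> (+) x ` V" if V: "absorbing_nbhd S \<B> V" and x: "x \<in> S" for x V
  proof -
    obtain W where W: "openin ?E W" "0 \<in> W" "convex W" "W \<subseteq> V"
      by (rule absorbing_nbhd_interior[OF S V])
    have "openin ?E ((+) x ` W)"
      unfolding openin_bornology_topology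
    proof (intro conjI ballI)
      have "W \<subseteq> S" using W(1) by (simp add: openin_bornology_topology)
      then show "(+) x ` W \<subseteq> S" using x S by (auto simp: subspace_add subset_iff)
      fix y assume "y \<in> (+) x ` W"
      then obtain w where w: "w \<in> W" "y = x + w" by blast
      then obtain V' where "absorbing_nbhd S \<B> V'" "(+) w ` V' \<subseteq> W"
        using W(1) unfolding openin_bornology_topology by blast
      then show "\<exists>V. absorbing_nbhd S \<B> V \<and> (+) y ` V \<subseteq> (+) x ` W"
        using w by (intro exI[of _ V']) (auto simp: add.assoc)
    qed
    moreover have "x \<in> (+) x ` W" using W(2) by (metis add.right_neutral image_eqI)
    ultimately show ?thesis using W(4) by blast
  qed
  have add: "continuous_map (prod_topology ?E ?E) ?E (\<lambda>(x, y). x + y)"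
    unfolding continuous_map_def
  proof (intro conjI allI impI)
    show "(\<lambda>(x, y). x + y) \<in> topspace (prod_topology ?E ?E) \<rightarrow> topspace ?E"
      using S by (auto simp: topspace_bornology_topology[OF S B] subspace_add)
    fix U assume U: "openin ?E U"
    show "openin (prod_topology ?E ?E) {p \<in> topspace (prod_topology ?E ?E). (case p of (x, y) \<Rightarrow> x + y) \<in> U}"
      unfolding openin_prod_topology_alt
    proof (intro allI impI)
      fix x y assume "(x, y) \<in> {p \<in> topspace (prod_topology ?E ?E). (case p of (x, y) \<Rightarrow> x + y) \<in> U}"
      then have xy: "x \<in> S" "y \<in> S" "x + y \<in> U" by (auto simp: topspace_bornology_topology[OF S B])
      obtain V where V: "absorbing_nbhd S \<B> V" "(+) (x + y) ` V \<subseteq> U"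
        using U xy unfolding openin_bornology_topology by blast
      let ?V = "(\<lambda>x. (1/2) *\<^sub>R x) ` V"
      have V2: "absorbing_nbhd S \<B> ?V" by (rule absorbing_nbhd_scale[OF S V(1)]) simp
      obtain W1 where W1: "openin ?E W1" "x \<in> W1" "W1 \<subseteq> (+) x ` ?V" using nb[OF V2 xy(1)] by blast
      obtain W2 where W2: "openin ?E W2" "y \<in> W2" "W2 \<subseteq> (+) y ` ?V" using nb[OF V2 xy(2)] by blast
      have "a + b \<in> U" if ab: "a \<in> W1" "b \<in> W2" for a b
      proof -
        obtain v w where v: "v \<in> V" "a = x + (1/2) *\<^sub>R v" and w: "w \<in> V" "b = y + (1/2) *\<^sub>R w"
          using ab W1(3) W2(3) by blast
        have "convex V" using V by (simp add: absorbing_nbhd_def absolutely_convex_def)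
        then have "(1/2) *\<^sub>R v + (1/2) *\<^sub>R w \<in> V" using v w by (auto simp: convex_def)
        then have "(x + y) + ((1/2) *\<^sub>R v + (1/2) *\<^sub>R w) \<in> U" using V(2) by blast
        then show ?thesis using v w by (simp add: algebra_simps)
      qed
      moreover have "W1 \<subseteq> S" "W2 \<subseteq> S" using W1 W2 by (auto simp: openin_bornology_topology)
      ultimately show "\<exists>U' V'. openin ?E U' \<and> openin ?E V' \<and> x \<in> U' \<and> y \<in> V' \<and> U' \<times> V' \<subseteq>
          {p \<in> topspace (prod_topology ?E ?E). (case p of (x, y) \<Rightarrow> x + y) \<in> U}"
        using W1 W2 by (intro exI[of _ W1] exI[of _ W2]) (auto simp: topspace_bornology_topology[OF S B])
    qed
  qed
  have scale: "continuous_map (prod_topology euclideanreal ?E) ?E (\<lambda>(c, x). c *\<^sub>R x)"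
    unfolding continuous_map_def
  proof (intro conjI allI impI)
    show "(\<lambda>(c, x). c *\<^sub>R x) \<in> topspace (prod_topology euclideanreal ?E) \<rightarrow> topspace ?E"
      using S by (auto simp: topspace_bornology_topology[OF S B] subspace_scale)
    fix U assume U: "openin ?E U"
    show "openin (prod_topology euclideanreal ?E)
        {p \<in> topspace (prod_topology euclideanreal ?E). (case p of (c, x) \<Rightarrow> c *\<^sub>R x) \<in> U}"
      unfolding openin_prod_topology_alt
    proof (intro allI impI)
      fix c x assume "(c, x) \<in> {p \<in> topspace (prod_topology euclideanreal ?E). (case p of (c, x) \<Rightarrow> c *\<^sub>R x) \<in> U}"
      then have cx: "x \<in> S" "c *\<^sub>R x \<in> U" by (auto simp: topspace_bornology_topology[OF S B])
      obtain V where V: "absorbing_nbhd S \<B> V" "(+) (c *\<^sub>R x) ` V \<subseteq> U"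
        using U cx unfolding openin_bornology_topology by blast
      have aV: "absolutely_convex V" using V by (simp add: absorbing_nbhd_def)
      have "absorbs V {x}" using V sing[OF cx(1)] by (simp add: absorbing_nbhd_def)
      then obtain r where r: "r > 0" "\<And>t. r \<le> \<bar>t\<bar> \<Longrightarrow> {x} \<subseteq> (\<lambda>x. t *\<^sub>R x) ` V"
        unfolding absorbs_def by blast
      then obtain z where z: "z \<in> V" "x = r *\<^sub>R z" by force
      define d where "d = min 1 (1 / (2 * r))"
      have d: "0 < d" "d \<le> 1" "d * r \<le> 1/2" using r(1) by (auto simp: d_def min_def field_simps)
      define k where "k = 1 / (2 * (\<bar>c\<bar> + 1))"
      have k: "k > 0" by (simp add: k_def add_nonneg_pos)
      obtain W where W: "openin ?E W" "x \<in> W" "W \<subseteq> (+) x ` (\<lambda>x. k *\<^sub>R x) ` V"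
        using nb[OF absorbing_nbhd_scale[OF S V(1) k] cx(1)] by blast
      have "b *\<^sub>R y \<in> U" if b: "b \<in> ball c d" and y: "y \<in> W" for b y
      proof -
        have bc: "\<bar>b - c\<bar> < d" using b by (simp add: dist_real_def abs_minus_commute)
        obtain v where v: "v \<in> V" "y = x + k *\<^sub>R v" using y W by blast
        have "\<bar>b\<bar> \<le> \<bar>c\<bar> + 1" using bc d by linarith
        then have "\<bar>2 * b * k\<bar> \<le> 1" by (simp add: k_def abs_mult field_simps)
        then have 1: "(2 * b * k) *\<^sub>R v \<in> V" using aV v by (simp add: absolutely_convex_def)
        have "\<bar>b - c\<bar> * r \<le> d * r" using bc r(1) by (intro mult_right_mono) auto
        moreover have "\<bar>2 * (b - c) * r\<bar> = 2 * (\<bar>b - c\<bar> * r)" using r(1) by (simp only: abs_mult)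
        ultimately have "\<bar>2 * (b - c) * r\<bar> \<le> 1" using d(3) by linarith
        then have 2: "(2 * (b - c) * r) *\<^sub>R z \<in> V" using aV z by (simp add: absolutely_convex_def)
        have "(1/2) *\<^sub>R ((2 * b * k) *\<^sub>R v) + (1/2) *\<^sub>R ((2 * (b - c) * r) *\<^sub>R z) \<in> V"
          using aV 1 2 by (intro convexD) (auto simp: absolutely_convex_def simp del: scaleR_scaleR)
        moreover have eq: "(1/2) *\<^sub>R ((2 * b * k) *\<^sub>R v) + (1/2) *\<^sub>R ((2 * (b - c) * r) *\<^sub>R z) =
            (b * k) *\<^sub>R v + ((b - c) * r) *\<^sub>R z"
          by (simp add: mult.assoc)
        ultimately have "(b * k) *\<^sub>R v + ((b - c) * r) *\<^sub>R z \<in> V" by (simp only: eq)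
        then have "c *\<^sub>R x + ((b * k) *\<^sub>R v + ((b - c) * r) *\<^sub>R z) \<in> U" using V(2) by blast
        then show ?thesis using v z by (simp add: algebra_simps)
      qed
      moreover have "W \<subseteq> S" using W by (auto simp: openin_bornology_topology)
      ultimately show "\<exists>U' V'. openin euclideanreal U' \<and> openin ?E V' \<and> c \<in> U' \<and> x \<in> V' \<and> U' \<times> V' \<subseteq>
          {p \<in> topspace (prod_topology euclideanreal ?E). (case p of (c, x) \<Rightarrow> c *\<^sub>R x) \<in> U}"
        using W d by (intro exI[of _ "ball c d"] exI[of _ W]) (auto simp: topspace_bornology_topology[OF S B])
    qed
  qed
  show ?thesis
    unfolding locally_convex_space_def
  proof (intro conjI allI impI add scale)
    show "subspace (topspace ?E)" using S by (simp add: topspace_bornology_topology[OF S B])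
    fix U assume U: "openin ?E U \<and> 0 \<in> U"
    then obtain V where V: "absorbing_nbhd S \<B> V" "(+) 0 ` V \<subseteq> U"
      unfolding openin_bornology_topology by blast
    obtain W where "openin ?E W" "0 \<in> W" "convex W" "W \<subseteq> V"
      by (rule absorbing_nbhd_interior[OF S V(1)])
    then show "\<exists>V. openin ?E V \<and> 0 \<in> V \<and> convex V \<and> V \<subseteq> U" using V(2) by auto
  qed
qed

lemma linear_image_scale_subset:
  assumes "linear_on_set S h" "V \<subseteq> S" "B \<subseteq> (\<lambda>x. t *\<^sub>R x) ` V"
  shows "h ` B \<subseteq> (\<lambda>x. t *\<^sub>R x) ` h ` V"
proof clarify
  fix x assume "x \<in> B"
  then obtain v where "v \<in> V" "x = t *\<^sub>R v" using assms by blast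
  moreover from this have "h x = t *\<^sub>R h v" using assms by (auto simp: linear_on_set_def)
  ultimately show "h x \<in> (\<lambda>x. t *\<^sub>R x) ` h ` V" by blast
qed

theorem convenient_bornology_topology:
  fixes S :: "'a::real_vector set" and G :: "'g::real_vector topology" and h :: "'a \<Rightarrow> 'g"
  defines "\<B> \<equiv> {B. B \<subseteq> S \<and> bounded_in G (h ` B)}"
  defines "E \<equiv> bornology_topology S \<B>"
  assumes S: "subspace S" and h: "linear_on_set S h" "inj_on h S" "h ` S \<subseteq> topspace G"
    and G: "convenient_space G"
    and closed: "\<And>y l. range y \<subseteq> h ` S \<Longrightarrow> limitin G y l sequentially \<Longrightarrow> l \<in> h ` S"
  shows "convenient_space E" and "topspace E = S"
    and "\<And>B. bounded_in E B \<longleftrightarrow> B \<subseteq> S \<and> bounded_in G (h ` B)"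
    and "continuous_map E G h"
proof -
  have lG: "locally_convex_space G" using G by (simp add: convenient_space_def)
  have B: "\<And>B. B \<in> \<B> \<Longrightarrow> B \<subseteq> S" by (simp add: \<B>_def)
  have sing: "{x} \<in> \<B>" if "x \<in> S" for x
    using that h bounded_in_singleton[OF lG, of "h x"] by (auto simp: \<B>_def)
  show top: "topspace E = S" unfolding E_def by (rule topspace_bornology_topology[OF S B])
  have lE: "locally_convex_space E"
    unfolding E_def by (rule locally_convex_bornology_topology[OF S B sing])
  show cont: "continuous_map E G h"
    unfolding E_def
    by (rule bornology_topology_continuous[OF S B lG h(1,3)]) (auto simp: \<B>_def)
  show bdd: "bounded_in E B \<longleftrightarrow> B \<subseteq> S \<and> bounded_in G (h ` B)" for B
  proof
    assume bE: "bounded_in E B"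
    then have BS: "B \<subseteq> S" by (simp add: bounded_in_def top)
    moreover have "bounded_in G (h ` B)"
    proof (rule bounded_inI[OF lG])
      show "h ` B \<subseteq> topspace G" using BS h by blast
      fix W assume W: "openin G W" "0 \<in> W" "absolutely_convex W"
      let ?V = "{x \<in> S. h x \<in> W}"
      have "openin E ?V" using openin_continuous_map_preimage[OF cont W(1)] by (simp add: top)
      moreover have "h 0 = 0" using h(1) S by (rule linear_on_set_zero)
      then have "0 \<in> ?V" using W S by (simp add: subspace_0)
      ultimately have "absorbs ?V B" using bE by (simp add: bounded_in_def)
      then obtain t where "B \<subseteq> (\<lambda>x. t *\<^sub>R x) ` ?V"
        using absorbs_scaled by blast
      from linear_image_scale_subset[OF h(1) _ this]
      have "h ` B \<subseteq> (\<lambda>x. t *\<^sub>R x) ` h ` ?V" by blast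
      then show "\<exists>t. h ` B \<subseteq> (\<lambda>x. t *\<^sub>R x) ` W" by blast
    qed
    ultimately show "B \<subseteq> S \<and> bounded_in G (h ` B)" by blast
  next
    assume bG: "B \<subseteq> S \<and> bounded_in G (h ` B)"
    show "bounded_in E B"
      unfolding bounded_in_def
    proof (intro conjI allI impI)
      show "B \<subseteq> topspace E" using bG top by simp
      fix U assume "openin E U \<and> 0 \<in> U"
      then obtain V where "absorbing_nbhd S \<B> V" "(+) 0 ` V \<subseteq> U"
        unfolding E_def openin_bornology_topology by blast
      then show "absorbs U B" using bG absorbs_mono[of V B U B]
        by (auto simp: absorbing_nbhd_def \<B>_def)
    qed
  qed
  have "Collect (bounded_in E) = \<B>" by (auto simp: bdd \<B>_def)
  then have born: "bornologification E = E" by (simp add: bornologification_def top) (simp add: E_def)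
  have haus: "Hausdorff_space E"
    using G h(2) cont by (intro Hausdorff_space_injective_preimage[of G E h]) (auto simp: convenient_space_def top)
  have "\<exists>l. limitin E x l sequentially" if mc: "mackey_cauchy E x" for x
  proof -
    have xS: "x n \<in> S" for n using mc by (auto simp: mackey_cauchy_def top)
    obtain \<mu> where \<mu>: "filterlim \<mu> at_top (sequentially \<times>\<^sub>F sequentially)"
      "bounded_in E (range (\<lambda>(n, m). \<mu> (n, m) *\<^sub>R (x n - x m)))"
      using mc unfolding mackey_cauchy_def by blast
    define D where "D = range (\<lambda>(n, m). \<mu> (n, m) *\<^sub>R (h (x n) - h (x m)))"
    have "h ` range (\<lambda>(n, m). \<mu> (n, m) *\<^sub>R (x n - x m)) = D"
      unfolding D_def image_image
      using h(1) xS S by (intro image_cong)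
        (auto simp: linear_on_set_diff[OF h(1) S] linear_on_set_def subspace_diff)
    moreover have "bounded_in G (h ` range (\<lambda>(n, m). \<mu> (n, m) *\<^sub>R (x n - x m)))"
      using \<mu>(2) bdd by blast
    ultimately have bD: "bounded_in G D" by (simp only:)
    have "mackey_cauchy G (h \<circ> x)"
      unfolding mackey_cauchy_def using \<mu>(1) bD xS h(3) by (auto simp: D_def)
    then obtain l where l: "limitin G (h \<circ> x) l sequentially"
      using G unfolding convenient_space_def by blast
    then have "l \<in> h ` S" using closed[of "h \<circ> x"] xS by auto
    then obtain z where z: "z \<in> S" "l = h z" by blast
    have "\<exists>N. \<forall>n\<ge>N. \<forall>m\<ge>N. real k \<le> \<mu> (n, m)" for k
      using \<mu>(1) unfolding filterlim_at_top eventually_prod_sequentially by blast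
    then obtain N where N: "\<And>k n m. n \<ge> N k \<Longrightarrow> m \<ge> N k \<Longrightarrow> real k \<le> \<mu> (n, m)" by metis
    define Q where "Q = {real k *\<^sub>R (x n - z) | k n. k \<ge> 1 \<and> n \<ge> N k}"
    have QS: "Q \<subseteq> S" using xS z S by (auto simp: Q_def subspace_diff subspace_scale)
    have lG': "l \<in> topspace G" using z h by auto
    have "bounded_in G (h ` Q)"
    proof (rule bounded_inI[OF lG])
      show "h ` Q \<subseteq> topspace G" using QS h by blast
      fix W assume W: "openin G W" "0 \<in> W" "absolutely_convex W"
      have "absorbs W D" using bD W by (simp add: bounded_in_def)
      then obtain r where r: "r > 0" "D \<subseteq> (\<lambda>x. r *\<^sub>R x) ` W"
        using absorbs_scaled by blast
      have "h ` Q \<subseteq> (\<lambda>x. (r + 1) *\<^sub>R x) ` W"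
      proof clarify
        fix q assume "q \<in> Q"
        then obtain k n where k: "k \<ge> 1" "n \<ge> N k" "q = real k *\<^sub>R (x n - z)" by (auto simp: Q_def)
        have hq: "h q = real k *\<^sub>R (h (x n) - l)"
          using k z h(1) xS S by (simp add: linear_on_set_def subspace_diff linear_on_set_diff[OF h(1) S])
        have "limitin G (\<lambda>m. (-1) *\<^sub>R l) ((-1) *\<^sub>R l) sequentially"
          using lG' lG by (auto simp: limitin_const_iff locally_convex_space_def subspace_neg)
        from lcs_scale[OF lG lcs_add[OF lG l this], of "real k"]
        have "limitin G (\<lambda>m. real k *\<^sub>R (h (x m) - l)) 0 sequentially" by (simp add: o_def)
        then have "eventually (\<lambda>m. real k *\<^sub>R (h (x m) - l) \<in> W) sequentially"
          using W by (simp add: limitin_def)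
        then have "eventually (\<lambda>m. real k *\<^sub>R (h (x m) - l) \<in> W \<and> m \<ge> N k) sequentially"
          using eventually_ge_at_top by (rule eventually_conj)
        then obtain m where m: "real k *\<^sub>R (h (x m) - l) \<in> W" "m \<ge> N k"
          by (auto simp: eventually_sequentially)
        have mu: "real k \<le> \<mu> (n, m)" "\<mu> (n, m) > 0"
          using N[OF k(2) m(2)] k(1) by auto
        have "\<mu> (n, m) *\<^sub>R (h (x n) - h (x m)) \<in> D" unfolding D_def by force
        then obtain w where w: "w \<in> W" "\<mu> (n, m) *\<^sub>R (h (x n) - h (x m)) = r *\<^sub>R w" using r by blast
        define w' where "w' = (real k / \<mu> (n, m)) *\<^sub>R w"
        have w': "w' \<in> W" using W(3) w mu by (simp add: w'_def absolutely_convex_def)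
        have "r *\<^sub>R w' = (real k / \<mu> (n, m)) *\<^sub>R (r *\<^sub>R w)" by (simp add: w'_def mult.commute)
        also have "\<dots> = real k *\<^sub>R (h (x n) - h (x m))" using mu by (simp add: w(2)[symmetric])
        finally have e: "real k *\<^sub>R (h (x n) - h (x m)) = r *\<^sub>R w'" ..
        let ?v = "(r / (r + 1)) *\<^sub>R w' + (1 / (r + 1)) *\<^sub>R (real k *\<^sub>R (h (x m) - l))"
        have "r / (r + 1) + 1 / (r + 1) = 1" using r(1) by (simp add: field_simps)
        moreover have "0 \<le> r / (r + 1)" "0 \<le> 1 / (r + 1)" using r(1) by auto
        ultimately have "?v \<in> W"
          using W(3) w' m(1) unfolding absolutely_convex_def convex_def by blast
        moreover have "(r + 1) *\<^sub>R ?v = r *\<^sub>R w' + real k *\<^sub>R (h (x m) - l)"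
          using r(1) by (simp only: scaleR_add_right scaleR_scaleR) simp
        then have "h q = (r + 1) *\<^sub>R ?v"
          unfolding hq e[symmetric] by (simp add: algebra_simps)
        ultimately show "h q \<in> (\<lambda>x. (r + 1) *\<^sub>R x) ` W" by blast
      qed
      then show "\<exists>t. h ` Q \<subseteq> (\<lambda>x. t *\<^sub>R x) ` W" by blast
    qed
    then have QB: "Q \<in> \<B>" using QS by (simp add: \<B>_def)
    have "limitin E x z sequentially"
      unfolding limitin_def
    proof (intro conjI allI impI)
      show "z \<in> topspace E" using z top by simp
      fix U assume "openin E U \<and> z \<in> U"
      then obtain V where V: "absorbing_nbhd S \<B> V" "(+) z ` V \<subseteq> U"
        unfolding E_def openin_bornology_topology by blast
      then have "absorbs V Q" using QB by (simp add: absorbing_nbhd_def)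
      then obtain r where r: "r > 0" "\<And>t. r \<le> \<bar>t\<bar> \<Longrightarrow> Q \<subseteq> (\<lambda>x. t *\<^sub>R x) ` V"
        unfolding absorbs_def by blast
      obtain k :: nat where k: "r \<le> real k" using real_arch_simple by blast
      then have k1: "k \<ge> 1" using r(1) by (cases k) auto
      have "x n \<in> U" if "n \<ge> N k" for n
      proof -
        have "real k *\<^sub>R (x n - z) \<in> Q" using that k1 by (auto simp: Q_def)
        then obtain v where "v \<in> V" "real k *\<^sub>R (x n - z) = real k *\<^sub>R v" using r(2)[of "real k"] k by auto
        then have "x n - z \<in> V" using k1 by simp
        then have "z + (x n - z) \<in> U" using V(2) by blast
        then show ?thesis by simp
      qed
      then show "\<forall>\<^sub>F n in sequentially. x n \<in> U" by (auto simp: eventually_sequentially)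
    qed
    then show ?thesis ..
  qed
  then show "convenient_space E" using lE haus born by (simp add: convenient_space_def)
qed


lemma lookup_scaleR_poly_mapping:
  fixes x :: "('k, 'v::real_vector) poly_mapping"
  shows "Poly_Mapping.lookup (c *\<^sub>R x) i = c *\<^sub>R Poly_Mapping.lookup x i"
proof -
  have "finite {i. c *\<^sub>R Poly_Mapping.lookup x i \<noteq> 0}"
    by (rule finite_subset[OF _ finite_lookup[of x]]) auto
  then show ?thesis
    by (simp add: scaleR_poly_mapping_def Abs_poly_mapping_inverse)
qed

lemma independent_single:
  fixes K :: "'k set"
  shows "independent ((\<lambda>k. Poly_Mapping.single k (1::real)) ` K)"
proof
  assume "dependent ((\<lambda>k. Poly_Mapping.single k (1::real)) ` K)"
  then obtain t u v where t: "finite t" "t \<subseteq> (\<lambda>k. Poly_Mapping.single k (1::real)) ` K"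
    and s: "(\<Sum>v\<in>t. u v *\<^sub>R v) = 0" and v: "v \<in> t" "u v \<noteq> 0"
    unfolding dependent_explicit by blast
  obtain k where "v = Poly_Mapping.single k 1" using t(2) v(1) by blast
  then have k: "Poly_Mapping.single k 1 \<in> t" "u (Poly_Mapping.single k 1) \<noteq> 0" using v by auto
  have "0 = Poly_Mapping.lookup (\<Sum>v\<in>t. u v *\<^sub>R v) k" using s by simp
  also have "\<dots> = (\<Sum>v\<in>t. u v * Poly_Mapping.lookup v k)"
    by (simp add: lookup_sum lookup_scaleR_poly_mapping)
  also have "\<dots> = (\<Sum>v\<in>t. if v = Poly_Mapping.single k 1 then u v else 0)"
  proof (intro sum.cong refl)
    fix v assume "v \<in> t"
    then obtain k' where "v = Poly_Mapping.single k' 1" using t by blast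
    then show "u v * Poly_Mapping.lookup v k = (if v = Poly_Mapping.single k 1 then u v else 0)"
      by (cases "k' = k") (auto simp: lookup_single_not_eq dest: arg_cong[where f = "\<lambda>v. Poly_Mapping.lookup v k"])
  qed
  also have "\<dots> = u (Poly_Mapping.single k 1)" using t k by simp
  finally show False using k by simp
qed

lemma linear_embedding_into_poly_mapping:
  fixes e :: "'k \<Rightarrow> 'g::real_vector"
  assumes "subspace (range e)"
  obtains \<phi> :: "'g \<Rightarrow> ('k, real) poly_mapping" where "linear \<phi>" "inj_on \<phi> (range e)"
proof -
  obtain B where B: "B \<subseteq> range e" "independent B" "range e \<subseteq> span B"
    using maximal_independent_subset[of "range e"] by metis
  then have sp: "span B = range e" using assms by (simp add: span_minimal subset_antisym)
  obtain \<phi> :: "'g \<Rightarrow> ('k, real) poly_mapping"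
    where \<phi>: "linear \<phi>" "\<And>b. b \<in> B \<Longrightarrow> \<phi> b = Poly_Mapping.single (inv e b) 1"
    using linear_independent_extend[OF B(2), of "\<lambda>b. Poly_Mapping.single (inv e b) 1"] by blast
  have "\<phi> ` B = (\<lambda>k. Poly_Mapping.single k 1) ` (inv e ` B)"
    using \<phi>(2) by (auto simp: image_image)
  then have "independent (\<phi> ` B)" using independent_single by metis
  moreover have "inj_on \<phi> B"
  proof (rule inj_onI)
    fix a b assume ab: "a \<in> B" "b \<in> B" "\<phi> a = \<phi> b"
    then have "Poly_Mapping.lookup (Poly_Mapping.single (inv e a) (1::real)) (inv e a) =
        Poly_Mapping.lookup (Poly_Mapping.single (inv e b) 1) (inv e a)" using \<phi>(2) by simp
    then have "inv e a = inv e b" by (auto simp: lookup_single when_def split: if_splits)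
    then show "a = b" using ab B(1) by (metis f_inv_into_f subsetD)
  qed
  ultimately have "inj_on \<phi> (span B)" using \<phi>(1) linear_inj_on_span_independent_image by blast
  then show ?thesis using that \<phi>(1) sp by simp
qed

lemma convenient_copy:
  fixes G :: "'g::real_vector topology" and e :: "'k \<Rightarrow> 'g"
  assumes G: "convenient_space G" and C: "subspace (range e)" "range e \<subseteq> topspace G"
    and closed: "\<forall>y l. range y \<subseteq> range e \<and> limitin G y l sequentially \<longrightarrow> l \<in> range e"
  obtains G' :: "('k, real) poly_mapping topology" and \<phi> \<psi> where
    "convenient_space G'" "topspace G' = \<phi> ` range e" "linear \<phi>" "linear_on_set (topspace G') \<psi>"
    "\<forall>c\<in>range e. \<psi> (\<phi> c) = c"
    "\<forall>B. bounded_in G' B \<longleftrightarrow> B \<subseteq> topspace G' \<and> bounded_in G (\<psi> ` B)"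
proof -
  obtain \<phi> :: "'g \<Rightarrow> ('k, real) poly_mapping" where \<phi>: "linear \<phi>" "inj_on \<phi> (range e)"
    by (rule linear_embedding_into_poly_mapping[OF C(1)])
  let ?S = "\<phi> ` range e"
  define \<psi> where "\<psi> = inv_into (range e) \<phi>"
  have inv: "\<psi> (\<phi> c) = c" if "c \<in> range e" for c
    using that \<phi>(2) by (simp add: \<psi>_def)
  have S: "subspace ?S" using \<phi>(1) C(1) by (rule linear_subspace_image)
  have lin: "linear_on_set ?S \<psi>"
    unfolding linear_on_set_def
  proof (intro conjI ballI allI)
    fix x y assume "x \<in> ?S" "y \<in> ?S"
    then obtain a b where ab: "x = \<phi> a" "y = \<phi> b" "a \<in> range e" "b \<in> range e" by blast
    have "\<psi> (x + y) = \<psi> (\<phi> (a + b))" using ab \<phi>(1) by (simp add: linear_add)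
    also have "\<dots> = a + b" using ab C(1) by (intro inv) (simp add: subspace_add)
    finally show "\<psi> (x + y) = \<psi> x + \<psi> y" using ab inv by simp
  next
    fix c and x assume "x \<in> ?S"
    then obtain a where a: "x = \<phi> a" "a \<in> range e" by blast
    have "\<psi> (c *\<^sub>R x) = \<psi> (\<phi> (c *\<^sub>R a))" using a \<phi>(1) by (simp add: linear_scale)
    also have "\<dots> = c *\<^sub>R a" using a C(1) by (intro inv) (simp add: subspace_scale)
    finally show "\<psi> (c *\<^sub>R x) = c *\<^sub>R \<psi> x" using a inv by simp
  qed
  have im: "\<psi> ` ?S = range e"
    using inv by (auto simp: image_image intro!: image_eqI)
  have inj: "inj_on \<psi> ?S" using inv by (auto simp: inj_on_def)
  let ?G = "bornology_topology ?S {B. B \<subseteq> ?S \<and> bounded_in G (\<psi> ` B)}"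
  have sub: "\<psi> ` ?S \<subseteq> topspace G" using im C(2) by simp
  have cl: "l \<in> \<psi> ` ?S" if "range y \<subseteq> \<psi> ` ?S" "limitin G y l sequentially" for y l
    using closed that unfolding im by blast
  note 1 = convenient_bornology_topology[OF S lin inj sub G cl]
  show ?thesis
    by (rule that[of ?G \<phi> \<psi>]) (use 1 \<phi>(1) lin inv in simp_all)
qed

primrec term_value :: "'g::real_vector topology \<Rightarrow> ('x \<Rightarrow> 'g) \<Rightarrow> 'x limit_term \<Rightarrow> 'g" where
  "term_value G g (Gen x) = g x"
| "term_value G g (Plus s t) = term_value G g s + term_value G g t"
| "term_value G g (Scale c t) = c *\<^sub>R term_value G g t"
| "term_value G g (Lim s) =
     (if \<exists>l. limitin G (\<lambda>i. term_value G g (s i)) l sequentially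
      then SOME l. limitin G (\<lambda>i. term_value G g (s i)) l sequentially else 0)"

lemma term_value_Lim:
  assumes "Hausdorff_space G" "limitin G (\<lambda>i. term_value G g (s i)) l sequentially"
  shows "term_value G g (Lim s) = l"
proof -
  let ?P = "\<lambda>l. limitin G (\<lambda>i. term_value G g (s i)) l sequentially"
  have "?P (SOME l. ?P l)" using assms(2) by (rule someI)
  then have "(SOME l. ?P l) = l"
    using limitin_Hausdorff_unique[OF _ assms(2) _ assms(1)] by simp
  then show ?thesis using assms(2) by auto
qed

lemma term_value_range:
  assumes G: "convenient_space G" and g: "\<And>x. g x \<in> topspace G"
  shows "subspace (range (term_value G g))" and "range (term_value G g) \<subseteq> topspace G"
    and "\<forall>y l. range y \<subseteq> range (term_value G g) \<and> limitin G y l sequentially \<longrightarrow>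
           l \<in> range (term_value G g)"
proof -
  have sub: "subspace (topspace G)" using G by (simp add: convenient_space_def locally_convex_space_def)
  show "subspace (range (term_value G g))"
    unfolding subspace_def
  proof (intro conjI ballI allI)
    have "term_value G g (Scale 0 t) = 0" for t by simp
    then show "0 \<in> range (term_value G g)" by (metis rangeI)
  next
    fix x y assume "x \<in> range (term_value G g)" "y \<in> range (term_value G g)"
    then obtain s t where "x + y = term_value G g (Plus s t)" by auto
    then show "x + y \<in> range (term_value G g)" by (metis rangeI)
  next
    fix c x assume "x \<in> range (term_value G g)"
    then obtain s where "c *\<^sub>R x = term_value G g (Scale c s)" by auto
    then show "c *\<^sub>R x \<in> range (term_value G g)" by (metis rangeI)
  qed
  have "term_value G g t \<in> topspace G" for t
  proof (induction t)
    case (Lim s)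
    show ?case
    proof (cases "\<exists>l. limitin G (\<lambda>i. term_value G g (s i)) l sequentially")
      case True
      then obtain l where l: "limitin G (\<lambda>i. term_value G g (s i)) l sequentially" ..
      moreover have "Hausdorff_space G" using G by (simp add: convenient_space_def)
      ultimately have "term_value G g (Lim s) = l" by (simp only: term_value_Lim)
      then show ?thesis using l by (simp add: limitin_topspace)
    qed (use sub in \<open>simp add: subspace_0\<close>)
  qed (use g sub in \<open>simp_all add: subspace_add subspace_scale\<close>)
  then show "range (term_value G g) \<subseteq> topspace G" by blast
  show "\<forall>y l. range y \<subseteq> range (term_value G g) \<and> limitin G y l sequentially \<longrightarrow>
      l \<in> range (term_value G g)"
  proof (intro allI impI)
    fix y l assume yl: "range y \<subseteq> range (term_value G g) \<and> limitin G y l sequentially"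
    then have y: "range y \<subseteq> range (term_value G g)" and l: "limitin G y l sequentially" by auto
    have "\<exists>t. y i = term_value G g t" for i using y by blast
    then obtain s where s: "\<And>i. y i = term_value G g (s i)" by metis
    have "term_value G g (Lim s) = l"
      using G l by (intro term_value_Lim) (simp_all add: s[symmetric] convenient_space_def)
    then show "l \<in> range (term_value G g)" by (metis rangeI)
    qed
qed

lemma bounded_linear_maps_linear: "h \<in> bounded_linear_maps T G \<Longrightarrow> linear_on_set (topspace T) h"
  by (simp add: bounded_linear_maps_def linear_on_set_def)

lemma bounded_linear_maps_continuous:
  assumes T: "convenient_space T" and G: "convenient_space G" and h: "h \<in> bounded_linear_maps T G"
  shows "continuous_map T G h"
proof -
  have "continuous_map (bornology_topology (topspace T) (Collect (bounded_in T))) G h"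
    by (rule bornology_topology_continuous[OF _ _ _ bounded_linear_maps_linear[OF h]])
      (use T G h in \<open>auto simp: convenient_space_def locally_convex_space_def bounded_in_def
          bounded_linear_maps_def\<close>)
  then show ?thesis using T by (simp add: convenient_space_def bornologification_def)
qed

lemma bounded_in_topspace: "bounded_in E B \<Longrightarrow> B \<subseteq> topspace E"
  by (simp add: bounded_in_def)

lemma universal_bilinear_generated_factorization:
  fixes E :: "'e::real_vector topology" and F :: "'f::real_vector topology"
    and T :: "'t::real_vector topology" and G :: "'g::real_vector topology"
  assumes U: "universal_bilinear E F R T \<tau>"
    and G: "convenient_space G" and f: "bounded_bilinear_map E F G f" "(\<lambda>(x, y). f x y) respects R"
  defines "g \<equiv> (\<lambda>p :: 'e \<times> 'f + 't. case p of
      Inl (x, y) \<Rightarrow> if x \<in> topspace E \<and> y \<in> topspace F then f x y else 0 | Inr _ \<Rightarrow> 0)"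
  shows "\<exists>h\<in>bounded_linear_maps T G. (\<forall>x\<in>topspace E. \<forall>y\<in>topspace F. h (\<tau> x y) = f x y) \<and>
           h ` topspace T \<subseteq> range (term_value G g)"
proof -
  let ?e = "term_value G g"
  have g: "g p \<in> topspace G" for p
    using G f(1) by (auto simp: g_def bounded_bilinear_map_def convenient_space_def
        locally_convex_space_def subspace_0 split: sum.split)
  note C = term_value_range[where g = g, OF G g]
  obtain G' :: "('e, 'f, 't) test_vector topology" and \<phi> \<psi> where G':
    "convenient_space G'" "topspace G' = \<phi> ` range ?e" "linear \<phi>" "linear_on_set (topspace G') \<psi>"
    and G5: "\<forall>c\<in>range ?e. \<psi> (\<phi> c) = c"
    and G6: "\<forall>B. bounded_in G' B \<longleftrightarrow> B \<subseteq> topspace G' \<and> bounded_in G (\<psi> ` B)"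
    by (rule convenient_copy[where e = ?e, OF G C])
  have fC: "f x y \<in> range ?e" if "x \<in> topspace E" "y \<in> topspace F" for x y
  proof -
    have "f x y = ?e (Gen (Inl (x, y)))" using that by (simp add: g_def)
    then show ?thesis by (metis rangeI)
  qed
  have inv: "\<psi> (\<phi> (f x y)) = f x y" if "x \<in> topspace E" "y \<in> topspace F" for x y
    using fC[OF that] by (rule G5[rule_format])
  have fT: "\<phi> (f x y) \<in> topspace G'" if "x \<in> topspace E" "y \<in> topspace F" for x y
    unfolding G'(2) using fC[OF that] by (rule imageI)
  have "bounded_bilinear_map E F G' (\<lambda>x y. \<phi> (f x y))"
    unfolding bounded_bilinear_map_def
  proof (intro conjI ballI allI impI)
    fix B C assume BC: "bounded_in E B \<and> bounded_in F C"
    let ?B = "(\<lambda>(x, y). \<phi> (f x y)) ` (B \<times> C)"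
    have sub: "B \<subseteq> topspace E" "C \<subseteq> topspace F" using BC by (auto simp: bounded_in_topspace)
    have "\<psi> ` ?B = (\<lambda>(x, y). f x y) ` (B \<times> C)"
      unfolding image_image using sub inv by (intro image_cong) auto
    moreover have "?B \<subseteq> topspace G'" using sub fT by auto
    ultimately show "bounded_in G' ?B" using f(1) BC G6[rule_format] by (simp add: bounded_bilinear_map_def)
  qed (use f(1) fT G'(3) in \<open>auto simp: bounded_bilinear_map_def linear_add linear_scale\<close>)
  moreover have "(\<lambda>(x, y). \<phi> (f x y)) respects R"
    using f(2) by (fastforce simp: congruent_def)
  ultimately obtain h where h: "h \<in> bounded_linear_maps T G'"
    "\<And>x y. x \<in> topspace E \<Longrightarrow> y \<in> topspace F \<Longrightarrow> h (\<tau> x y) = \<phi> (f x y)"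
    using U G'(1) unfolding universal_bilinear_def by blast
  define k where "k = restrict (\<psi> \<circ> h) (topspace T)"
  have sT: "subspace (topspace T)"
    using U by (simp add: universal_bilinear_def convenient_space_def locally_convex_space_def)
  have hT: "h x \<in> topspace G'" if "x \<in> topspace T" for x
    using h(1) that by (auto simp: bounded_linear_maps_def)
  have kC: "k x \<in> range ?e" if "x \<in> topspace T" for x
    using hT[OF that] G'(2) G5[rule_format] that by (auto simp: k_def)
  have "k \<in> bounded_linear_maps T G"
    unfolding bounded_linear_maps_def
  proof (intro CollectI conjI ballI allI impI)
    have "k x \<in> topspace G" if "x \<in> topspace T" for x using kC[OF that] C(2) by blast
    then show "k \<in> topspace T \<rightarrow>\<^sub>E topspace G" by (simp add: k_def PiE_iff)
  next
    fix x y assume "x \<in> topspace T" "y \<in> topspace T"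
    then show "k (x + y) = k x + k y"
      using h(1) sT hT G'(4) by (simp add: k_def subspace_add bounded_linear_maps_def linear_on_set_def)
  next
    fix c x assume "x \<in> topspace T"
    then show "k (c *\<^sub>R x) = c *\<^sub>R k x"
      using h(1) sT hT G'(4) by (simp add: k_def subspace_scale bounded_linear_maps_def linear_on_set_def)
  next
    fix B assume B: "bounded_in T B"
    then have "bounded_in G' (h ` B)" using h(1) by (simp add: bounded_linear_maps_def)
    then have "bounded_in G (\<psi> ` h ` B)" using G6[rule_format] by blast
    moreover have "k ` B = \<psi> ` h ` B"
      unfolding image_image using bounded_in_topspace[OF B] by (intro image_cong) (auto simp: k_def)
    ultimately show "bounded_in G (k ` B)" by simp
  qed
  moreover have "k (\<tau> x y) = f x y" if "x \<in> topspace E" "y \<in> topspace F" for x y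
    using that h(2) U inv by (simp add: k_def universal_bilinear_def bounded_bilinear_map_def)
  ultimately show ?thesis using kC by blast
qed

theorem universal_bilinear_factorization:
  fixes E :: "'e::real_vector topology" and F :: "'f::real_vector topology"
    and T :: "'t::real_vector topology" and G :: "'g::real_vector topology"
  assumes U: "universal_bilinear E F R T \<tau>"
    and G: "convenient_space G" and f: "bounded_bilinear_map E F G f" "(\<lambda>(x, y). f x y) respects R"
  shows "\<exists>!h. h \<in> bounded_linear_maps T G \<and>
           (\<forall>x\<in>topspace E. \<forall>y\<in>topspace F. h (\<tau> x y) = f x y)"
proof -
  have T: "convenient_space T" and \<tau>: "bounded_bilinear_map E F T \<tau>" "(\<lambda>(x, y). \<tau> x y) respects R"
    using U by (auto simp: universal_bilinear_def)
  have sT: "subspace (topspace T)"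
    using T by (simp add: convenient_space_def locally_convex_space_def)
  define g where "g = (\<lambda>p :: 'e \<times> 'f + 't. case p of
      Inl (x, y) \<Rightarrow> if x \<in> topspace E \<and> y \<in> topspace F then \<tau> x y else 0 | Inr _ \<Rightarrow> 0)"
  obtain r where r: "r \<in> bounded_linear_maps T T"
    "\<And>x y. x \<in> topspace E \<Longrightarrow> y \<in> topspace F \<Longrightarrow> r (\<tau> x y) = \<tau> x y"
    "r ` topspace T \<subseteq> range (term_value T g)"
    using universal_bilinear_generated_factorization[OF U T \<tau>, folded g_def] by blast

  define g' where "g' = (\<lambda>p :: 'e \<times> 'f + 't. case p of Inl _ \<Rightarrow> 0 | Inr t \<Rightarrow> if t \<in> topspace T then t else 0)"
  have g': "g' p \<in> topspace T" for p using sT by (auto simp: g'_def subspace_0 split: sum.split)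
  note C = term_value_range[where g = g', OF T g']
  have full: "range (term_value T g') = topspace T"
  proof
    have "t = term_value T g' (Gen (Inr t))" if "t \<in> topspace T" for t using that by (simp add: g'_def)
    then show "topspace T \<subseteq> range (term_value T g')" by blast
  qed (rule C(2))
  obtain T' :: "('e, 'f, 't) test_vector topology" and \<phi> \<psi> where T':
    "convenient_space T'" "topspace T' = \<phi> ` topspace T" "linear \<phi>" "linear_on_set (topspace T') \<psi>"
    and T5: "\<forall>c\<in>topspace T. \<psi> (\<phi> c) = c"
    and T6: "\<forall>B. bounded_in T' B \<longleftrightarrow> B \<subseteq> topspace T' \<and> bounded_in T (\<psi> ` B)"
    by (rule convenient_copy[where e = "term_value T g'", OF T C, unfolded full])
  have comp: "restrict (\<phi> \<circ> k) (topspace T) \<in> bounded_linear_maps T T'" if k: "k \<in> bounded_linear_maps T T" for k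
    unfolding bounded_linear_maps_def
  proof (intro CollectI conjI ballI allI impI)
    have kT: "k x \<in> topspace T" if "x \<in> topspace T" for x using k that by (auto simp: bounded_linear_maps_def)
    then show "restrict (\<phi> \<circ> k) (topspace T) \<in> topspace T \<rightarrow>\<^sub>E topspace T'" using T'(2) by auto
    fix B assume B: "bounded_in T B"
    have BT: "B \<subseteq> topspace T" using B by (rule bounded_in_topspace)
    have "\<psi> ` restrict (\<phi> \<circ> k) (topspace T) ` B = k ` B"
      unfolding image_image using BT kT T5[rule_format] by (intro image_cong) auto
    moreover have "bounded_in T (k ` B)" using k B by (simp add: bounded_linear_maps_def)
    moreover have "restrict (\<phi> \<circ> k) (topspace T) ` B \<subseteq> topspace T'" using BT kT T'(2) by auto
    ultimately show "bounded_in T' (restrict (\<phi> \<circ> k) (topspace T) ` B)" using T6[rule_format] by simp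
  qed (use k T'(3) sT in \<open>auto simp: bounded_linear_maps_def subspace_add subspace_scale linear_add linear_scale\<close>)
  have idT: "restrict id (topspace T) \<in> bounded_linear_maps T T"
    unfolding bounded_linear_maps_def
  proof (intro CollectI conjI ballI allI impI)
    fix B assume B: "bounded_in T B"
    then have "restrict id (topspace T) ` B = B" using bounded_in_topspace[of T B] by force
    then show "bounded_in T (restrict id (topspace T) ` B)" using B by simp
  qed (use sT in \<open>auto simp: subspace_add subspace_scale\<close>)
  have \<tau>T: "\<tau> x y \<in> topspace T" if "x \<in> topspace E" "y \<in> topspace F" for x y
    using \<tau> that by (simp add: bounded_bilinear_map_def)
  have inv: "\<psi> (\<phi> (\<tau> x y)) = \<tau> x y" "\<phi> (\<tau> x y) \<in> topspace T'"
    if "x \<in> topspace E" "y \<in> topspace F" for x y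
    using T5 \<tau>T[OF that] unfolding T'(2) by blast+
  have bil: "bounded_bilinear_map E F T' (\<lambda>x y. \<phi> (\<tau> x y))"
    unfolding bounded_bilinear_map_def
  proof (intro conjI ballI allI impI)
    fix B C assume BC: "bounded_in E B \<and> bounded_in F C"
    let ?B = "(\<lambda>(x, y). \<phi> (\<tau> x y)) ` (B \<times> C)"
    have sub: "B \<subseteq> topspace E" "C \<subseteq> topspace F" using BC by (auto simp: bounded_in_topspace)
    have "\<psi> ` ?B = (\<lambda>(x, y). \<tau> x y) ` (B \<times> C)"
      unfolding image_image using sub inv by (intro image_cong) auto
    moreover have "?B \<subseteq> topspace T'" using sub by (auto intro!: inv(2))
    ultimately show "bounded_in T' ?B" using \<tau>(1) BC T6[rule_format] by (simp add: bounded_bilinear_map_def)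
  qed (use \<tau>(1) inv T'(3) in \<open>auto simp: bounded_bilinear_map_def linear_add linear_scale\<close>)
  have resp: "(\<lambda>(x, y). \<phi> (\<tau> x y)) respects R"
    using \<tau>(2) by (fastforce simp: congruent_def)
  have "\<exists>!h. h \<in> bounded_linear_maps T T' \<and>
      (\<forall>x\<in>topspace E. \<forall>y\<in>topspace F. h (\<tau> x y) = \<phi> (\<tau> x y))"
    using U T'(1) bil resp unfolding universal_bilinear_def by blast
  moreover have "\<forall>x\<in>topspace E. \<forall>y\<in>topspace F. restrict (\<phi> \<circ> r) (topspace T) (\<tau> x y) = \<phi> (\<tau> x y)"
    using r(2) \<tau>T by simp
  moreover have "\<forall>x\<in>topspace E. \<forall>y\<in>topspace F.
      restrict (\<phi> \<circ> restrict id (topspace T)) (topspace T) (\<tau> x y) = \<phi> (\<tau> x y)"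
    using \<tau>T by simp
  ultimately have eq: "restrict (\<phi> \<circ> r) (topspace T) = restrict (\<phi> \<circ> restrict id (topspace T)) (topspace T)"
    using comp[OF r(1)] comp[OF idT] by blast
  have "r t = t" if t: "t \<in> topspace T" for t
  proof -
    have "\<phi> (r t) = \<phi> t" using fun_cong[OF eq, of t] t by simp
    moreover have "r t \<in> topspace T" using r(1) t by (auto simp: bounded_linear_maps_def)
    ultimately show ?thesis using T5[rule_format] t by metis
  qed
  then have gen: "topspace T \<subseteq> range (term_value T g)" using r(3) by force

  have "h t = h' t" if h: "h \<in> bounded_linear_maps T G" "\<And>x y. x \<in> topspace E \<Longrightarrow> y \<in> topspace F \<Longrightarrow> h (\<tau> x y) = f x y"
    and h': "h' \<in> bounded_linear_maps T G" "\<And>x y. x \<in> topspace E \<Longrightarrow> y \<in> topspace F \<Longrightarrow> h' (\<tau> x y) = f x y"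
    and t: "t \<in> topspace T" for h h' t
  proof -
    have gT: "g p \<in> topspace T" for p using sT \<tau>T by (auto simp: g_def subspace_0 split: sum.split)
    have eT: "term_value T g s \<in> topspace T" for s using term_value_range(2)[where g = g, OF T gT] by blast
    note lin = bounded_linear_maps_linear[OF h(1)] bounded_linear_maps_linear[OF h'(1)]
    have zero: "h 0 = 0" "h' 0 = 0"
      using lin sT by (auto intro: linear_on_set_zero)
    have "h (term_value T g s) = h' (term_value T g s)" for s
    proof (induction s)
      case (Gen p)
      then show ?case using h(2) h'(2) zero by (auto simp: g_def split: sum.split)
    next
      case (Plus s1 s2)
      then show ?case using lin eT by (simp add: linear_on_set_def)
    next
      case (Scale c s)
      then show ?case using lin eT by (simp add: linear_on_set_def)
    next
      case (Lim s)
      show ?case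
      proof (cases "\<exists>l. limitin T (\<lambda>i. term_value T g (s i)) l sequentially")
        case True
        then obtain l where l: "limitin T (\<lambda>i. term_value T g (s i)) l sequentially" ..
        have "Hausdorff_space T" using T by (simp add: convenient_space_def)
        then have v: "term_value T g (Lim s) = l" using l by (simp only: term_value_Lim)
        have "limitin G (\<lambda>i. h (term_value T g (s i))) (h l) sequentially"
          using continuous_map_limit[OF bounded_linear_maps_continuous[OF T G h(1)] l] by (simp add: o_def)
        moreover have "limitin G (\<lambda>i. h (term_value T g (s i))) (h' l) sequentially"
          using continuous_map_limit[OF bounded_linear_maps_continuous[OF T G h'(1)] l] Lim by (simp add: o_def)
        moreover have "Hausdorff_space G" using G by (simp add: convenient_space_def)
        ultimately have "h l = h' l" 
          by (rule limitin_Hausdorff_unique[OF _ _ trivial_limit_sequentially])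
        then show ?thesis using v by simp
      qed (use zero in simp)
    qed
    then show ?thesis using gen t by blast
  qed
  note uniq = this
  obtain h where h: "h \<in> bounded_linear_maps T G"
    "\<And>x y. x \<in> topspace E \<Longrightarrow> y \<in> topspace F \<Longrightarrow> h (\<tau> x y) = f x y"
    using universal_bilinear_generated_factorization[OF U G f] by blast
  show ?thesis
  proof (rule ex1I[of _ h])
    fix k assume k: "k \<in> bounded_linear_maps T G \<and> (\<forall>x\<in>topspace E. \<forall>y\<in>topspace F. k (\<tau> x y) = f x y)"
    show "k = h"
    proof (rule extensionalityI[of _ "topspace T"])
      show "k \<in> extensional (topspace T)" "h \<in> extensional (topspace T)"
        using k h(1) by (auto simp: bounded_linear_maps_def PiE_def)
      show "k t = h t" if "t \<in> topspace T" for t using uniq[of k h t] k h that by blast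
    qed
  qed (use h in blast)
qed

end

theory Submission
  imports Defs "HOL-Library.Function_Algebras"
begin

text \<open>
  Left linear maps on \<open>\<Omega>\<^sub>n(A)\<close> are the same as normalized cochains: every normalized bounded
  \<open>n\<close>-cochain \<open>c\<close> is \<open>\<phi> \<circ> d\<^sup>n\<close> for exactly one bounded left linear \<open>\<phi>\<close>, given by
  \<open>\<phi>(a\<^sub>0 da\<^sub>1 \<otimes> \<cdots> \<otimes> da\<^sub>n) = a\<^sub>0 c(a\<^sub>1, \<dots>, a\<^sub>n)\<close>.  This goes by induction on \<open>n\<close>, using that \<open>\<Omega>\<^sub>1(A)\<close> is a
  retract of the tensor square via \<open>a \<otimes> b \<mapsto> a db\<close>, so that \<open>\<Omega>\<^sub>n(A)\<close> tensored with \<open>\<Omega>\<^sub>1(A)\<close> over \<open>A\<close> is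
  controlled by the elements \<open>\<omega>a \<otimes> db\<close>.  Since \<open>d\<^sup>n\<close> itself has coboundary zero, \<open>\<phi>\<close> is right linear if and only
  if \<open>c\<close> is a cocycle.  All steps must be uniform over families of maps, because one argument of the
  cochain becomes a parameter in the induction; uniformity comes from applying the universal property
  to maps into spaces of bounded functions.
\<close>

section \<open>Bounded sets\<close>

text \<open>Cocycles are unsuitable for the induction: freezing the last argument of a cocycle need
  not give a cocycle, but freezing the last argument of a normalized cochain gives a normalized
  cochain of one degree less. On the side of forms this means giving up right linearity; left
  linearity survives because the left action on \<open>\<Omega> (Suc n)\<close> acts on the first
  tensor factor. The induction step then has no choice: if \<open>g b\<close> belongs to the cochain
  with last argument b, the value on \<open>\<omega> \<otimes> a db\<close> must be
  \<open>g b (\<omega>a)\<close>, since a moves across the tensor product. Normalization enters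
  where \<open>db = 1 \<otimes> b - b \<otimes> 1\<close> is inserted: it kills the contribution of
  \<open>b \<otimes> 1\<close>.

  Uniqueness needs no density argument. There is a uniform bound depending only on the values on
  \<open>d\<^sup>n\<close>; applied to all multiples of a map vanishing there, it puts a whole line
  into a bounded set, which a Hausdorff space allows only for the zero line. The same bound yields
  boundedness of the inverse isomorphism. Equibounded families take the place of the spaces L(E,F)
  and their exponential law.\<close>

lemma convenient_spaceD:
  assumes "convenient_space E"
  shows "locally_convex_space E" "subspace (topspace E)" "Hausdorff_space E"
  using assms by (auto simp: convenient_space_def locally_convex_space_def)

lemma bounded_in_subset: "bounded_in E B \<Longrightarrow> C \<subseteq> B \<Longrightarrow> bounded_in E C"
  unfolding bounded_in_def by (meson absorbs_mono order_refl order_trans)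

lemma bounded_in_scaled_subset:
  assumes "bounded_in E B" "openin E W" "0 \<in> W"
  shows "\<exists>t>0. B \<subseteq> (\<lambda>x. t *\<^sub>R x) ` W"
  using assms by (auto simp: bounded_in_def intro: absorbs_scaled)

lemma bounded_in_add:
  assumes G: "locally_convex_space G" and B: "bounded_in G B" and C: "bounded_in G C"
  shows "bounded_in G ((\<lambda>(x, y). x + y) ` (B \<times> C))"
proof (rule bounded_inI[OF G])
  show "(\<lambda>(x, y). x + y) ` (B \<times> C) \<subseteq> topspace G"
    using G bounded_in_topspace[OF B] bounded_in_topspace[OF C]
    by (auto simp: locally_convex_space_def intro!: subspace_add)
  fix W assume W: "openin G W" "0 \<in> W" "absolutely_convex W"
  obtain s t where s: "s > 0" "B \<subseteq> (\<lambda>x. s *\<^sub>R x) ` W" and t: "t > 0" "C \<subseteq> (\<lambda>x. t *\<^sub>R x) ` W"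
    using bounded_in_scaled_subset W(1,2) B C by metis
  \<comment> \<open>A point of s W + t W is s + t times a convex combination of points of W.\<close>
  have "s *\<^sub>R v + t *\<^sub>R w \<in> (\<lambda>x. (s + t) *\<^sub>R x) ` W" if "v \<in> W" "w \<in> W" for v w
  proof -
    have "(s / (s + t)) *\<^sub>R v + (t / (s + t)) *\<^sub>R w \<in> W"
      using W(3) s(1) t(1) that unfolding absolutely_convex_def
      by (intro convexD) (auto simp: add_divide_distrib[symmetric])
    moreover have "s *\<^sub>R v + t *\<^sub>R w = (s + t) *\<^sub>R ((s / (s + t)) *\<^sub>R v + (t / (s + t)) *\<^sub>R w)"
      using s(1) t(1) by (simp add: scaleR_add_right)
    ultimately show ?thesis by blast
  qed
  then have "(\<lambda>(x, y). x + y) ` (B \<times> C) \<subseteq> (\<lambda>x. (s + t) *\<^sub>R x) ` W" using s(2) t(2) by fast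
  then show "\<exists>t. (\<lambda>(x, y). x + y) ` (B \<times> C) \<subseteq> (\<lambda>x. t *\<^sub>R x) ` W" by blast
qed

lemma bounded_in_scaleR:
  assumes G: "locally_convex_space G" and B: "bounded_in G B"
  shows "bounded_in G ((\<lambda>x. c *\<^sub>R x) ` B)"
proof (rule bounded_inI[OF G])
  show "(\<lambda>x. c *\<^sub>R x) ` B \<subseteq> topspace G"
    using G bounded_in_topspace[OF B] by (auto simp: locally_convex_space_def intro!: subspace_scale)
  fix W assume W: "openin G W" "0 \<in> W" "absolutely_convex W"
  obtain t where "t > 0" "B \<subseteq> (\<lambda>x. t *\<^sub>R x) ` W" using bounded_in_scaled_subset[OF B W(1,2)] by blast
  then have "(\<lambda>x. c *\<^sub>R x) ` B \<subseteq> (\<lambda>x. (c * t) *\<^sub>R x) ` W" by force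
  then show "\<exists>t. (\<lambda>x. c *\<^sub>R x) ` B \<subseteq> (\<lambda>x. t *\<^sub>R x) ` W" by blast
qed

lemma bounded_in_image_add:
  assumes "locally_convex_space G" "bounded_in G (f ` S)" "bounded_in G (g ` S)"
  shows "bounded_in G ((\<lambda>x. f x + g x) ` S)"
  by (rule bounded_in_subset[OF bounded_in_add[OF assms]]) auto

lemma bounded_in_image_scaleR:
  assumes "locally_convex_space G" "bounded_in G (f ` S)"
  shows "bounded_in G ((\<lambda>x. c *\<^sub>R f x) ` S)"
  using bounded_in_scaleR[OF assms, of c] by (simp add: image_image)

text \<open>If a neighbourhood U of zero misses x and the line lies in t U, then its point t x puts
  x into U. This turns uniform bounds into uniqueness statements.\<close>

lemma bounded_line_zero:
  assumes "Hausdorff_space G" "0 \<in> topspace G" "bounded_in G (range (\<lambda>r. r *\<^sub>R x))"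
  shows "x = 0"
proof (rule ccontr)
  assume "x \<noteq> 0"
  moreover have "1 *\<^sub>R x \<in> topspace G" using bounded_in_topspace[OF assms(3)] by blast
  ultimately obtain U where U: "openin G U" "0 \<in> U" "x \<notin> U"
    using assms(1,2) unfolding Hausdorff_space_def by (metis disjnt_iff scaleR_one)
  then obtain t where t: "t > 0" "range (\<lambda>r. r *\<^sub>R x) \<subseteq> (\<lambda>x. t *\<^sub>R x) ` U"
    using bounded_in_scaled_subset[OF assms(3)] by blast
  then have "t *\<^sub>R x \<in> (\<lambda>x. t *\<^sub>R x) ` U" by blast
  then show False using t(1) U(3) by auto
qed


section \<open>Bounded linear and bilinear maps\<close>

text \<open>Unlike the members of \<^const>\<open>bounded_linear_maps\<close>, these maps need not be extensional.\<close>

definition bounded_linear_on ::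
  "'a::real_vector topology \<Rightarrow> 'b::real_vector topology \<Rightarrow> ('a \<Rightarrow> 'b) \<Rightarrow> bool" where
  "bounded_linear_on E F f \<longleftrightarrow>
     (\<forall>x\<in>topspace E. f x \<in> topspace F) \<and> linear_on_set (topspace E) f \<and>
     (\<forall>B. bounded_in E B \<longrightarrow> bounded_in F (f ` B))"

text \<open>Boundedness as in L(E,F), but for any set of functions, so that families of composed
  maps qualify without being restricted to the carrier.\<close>

definition equibounded ::
  "'a::real_vector topology \<Rightarrow> 'b::real_vector topology \<Rightarrow> ('a \<Rightarrow> 'b) set \<Rightarrow> bool" where
  "equibounded E F H \<longleftrightarrow> (\<forall>B. bounded_in E B \<longrightarrow> bounded_in F (\<Union>h\<in>H. h ` B))"

lemma bounded_linear_maps_iff: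
  assumes "subspace (topspace E)"
  shows "f \<in> bounded_linear_maps E F \<longleftrightarrow> bounded_linear_on E F f \<and> f \<in> extensional (topspace E)"
  by (auto simp: bounded_linear_maps_def bounded_linear_on_def linear_on_set_def PiE_def)

lemma bounded_linear_on_cong:
  assumes "subspace (topspace E)" "\<And>x. x \<in> topspace E \<Longrightarrow> f x = g x"
  shows "bounded_linear_on E F f \<longleftrightarrow> bounded_linear_on E F g"
proof -
  have "bounded_in E B \<Longrightarrow> f ` B = g ` B" for B
    using assms(2) bounded_in_topspace by (intro image_cong) auto
  moreover have "linear_on_set (topspace E) f = linear_on_set (topspace E) g"
    using assms by (simp add: linear_on_set_def subspace_add subspace_scale)
  ultimately show ?thesis using assms(2) unfolding bounded_linear_on_def by auto
qed

lemma restrict_bounded_linear_maps: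
  assumes "subspace (topspace E)" "bounded_linear_on E F f"
  shows "restrict f (topspace E) \<in> bounded_linear_maps E F"
  unfolding bounded_linear_maps_iff[OF assms(1)]
  using assms bounded_linear_on_cong[OF assms(1), of "restrict f (topspace E)" f F] by simp

lemma bounded_linear_onD:
  assumes "bounded_linear_on E F f"
  shows "x \<in> topspace E \<Longrightarrow> f x \<in> topspace F"
    and "x \<in> topspace E \<Longrightarrow> y \<in> topspace E \<Longrightarrow> f (x + y) = f x + f y"
    and "x \<in> topspace E \<Longrightarrow> f (c *\<^sub>R x) = c *\<^sub>R f x"
    and "bounded_in E B \<Longrightarrow> bounded_in F (f ` B)"
  using assms by (auto simp: bounded_linear_on_def linear_on_set_def)

lemma bounded_linear_on_diff:
  assumes "bounded_linear_on E F f" "subspace (topspace E)" "x \<in> topspace E" "y \<in> topspace E"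
  shows "f (x - y) = f x - f y"
  using assms by (auto simp: bounded_linear_on_def intro: linear_on_set_diff)

lemma bounded_linear_on_zero:
  assumes "bounded_linear_on E F f" "subspace (topspace E)"
  shows "f 0 = 0"
  using assms by (auto simp: bounded_linear_on_def intro: linear_on_set_zero)

lemma bounded_linear_on_id: "bounded_linear_on E E (\<lambda>x. x)"
  by (simp add: bounded_linear_on_def linear_on_set_def)

lemma bounded_linear_on_comp:
  assumes "bounded_linear_on E F f" "bounded_linear_on F G g"
  shows "bounded_linear_on E G (\<lambda>x. g (f x))"
  using assms by (simp add: bounded_linear_on_def linear_on_set_def image_image[of g f, symmetric])

text \<open>The single form f + c g covers sums, differences and, as f + (c - 1) f,
  multiples.\<close>

lemma bounded_linear_on_lincomb:
  assumes F: "locally_convex_space F" and f: "bounded_linear_on E F f" and g: "bounded_linear_on E F g"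
  shows "bounded_linear_on E F (\<lambda>x. f x + c *\<^sub>R g x)"
proof -
  have "subspace (topspace F)" using F by (simp add: locally_convex_space_def)
  then show ?thesis
    unfolding bounded_linear_on_def linear_on_set_def
    by (intro conjI ballI allI impI bounded_in_image_add bounded_in_image_scaleR F bounded_linear_onD(4)[OF f]
          bounded_linear_onD(4)[OF g])
       (simp_all add: bounded_linear_onD(1-3)[OF f] bounded_linear_onD(1-3)[OF g] subspace_add subspace_scale
          scaleR_add_right mult.commute)
qed

lemma bounded_linear_on_diff_maps:
  assumes "locally_convex_space F" "bounded_linear_on E F f" "bounded_linear_on E F g"
  shows "bounded_linear_on E F (\<lambda>x. f x - g x)"
  using bounded_linear_on_lincomb[OF assms, of "-1"] by simp

lemma bounded_linear_on_scaleR: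
  assumes "locally_convex_space F" "bounded_linear_on E F f"
  shows "bounded_linear_on E F (\<lambda>x. c *\<^sub>R f x)"
  using bounded_linear_on_lincomb[OF assms assms(2), of "c - 1"] by (simp add: scaleR_diff_left)

lemma image_prod_setcompr: "(\<lambda>(x, y). f x y) ` (B \<times> C) = {f x y |x y. x \<in> B \<and> y \<in> C}"
  by auto

lemma bounded_bilinear_mapD:
  assumes "bounded_bilinear_map E F G f"
  shows "x \<in> topspace E \<Longrightarrow> y \<in> topspace F \<Longrightarrow> f x y \<in> topspace G"
    and "x \<in> topspace E \<Longrightarrow> x' \<in> topspace E \<Longrightarrow> y \<in> topspace F \<Longrightarrow> f (x + x') y = f x y + f x' y"
    and "x \<in> topspace E \<Longrightarrow> y \<in> topspace F \<Longrightarrow> y' \<in> topspace F \<Longrightarrow> f x (y + y') = f x y + f x y'"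
    and "x \<in> topspace E \<Longrightarrow> y \<in> topspace F \<Longrightarrow> f (c *\<^sub>R x) y = c *\<^sub>R f x y"
    and "x \<in> topspace E \<Longrightarrow> y \<in> topspace F \<Longrightarrow> f x (c *\<^sub>R y) = c *\<^sub>R f x y"
    and "bounded_in E B \<Longrightarrow> bounded_in F C \<Longrightarrow> bounded_in G {f x y |x y. x \<in> B \<and> y \<in> C}"
  using assms by (auto simp: bounded_bilinear_map_def image_prod_setcompr)

lemma bounded_bilinear_map_right:
  assumes E: "locally_convex_space E" and f: "bounded_bilinear_map E F G f" and x: "x \<in> topspace E"
  shows "bounded_linear_on F G (f x)"
  unfolding bounded_linear_on_def linear_on_set_def
proof (intro conjI ballI allI impI)
  fix B assume "bounded_in F B"
  from bounded_bilinear_mapD(6)[OF f bounded_in_singleton[OF E x] this]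
  show "bounded_in G (f x ` B)" by (rule bounded_in_subset) auto
qed (use bounded_bilinear_mapD[OF f] x in auto)

lemma bounded_bilinear_map_left:
  assumes F: "locally_convex_space F" and f: "bounded_bilinear_map E F G f" and y: "y \<in> topspace F"
  shows "bounded_linear_on E G (\<lambda>x. f x y)"
  unfolding bounded_linear_on_def linear_on_set_def
proof (intro conjI ballI allI impI)
  fix B assume "bounded_in E B"
  from bounded_bilinear_mapD(6)[OF f this bounded_in_singleton[OF F y]]
  show "bounded_in G ((\<lambda>x. f x y) ` B)" by (rule bounded_in_subset) auto
qed (use bounded_bilinear_mapD[OF f] y in auto)

lemma bounded_bilinear_map_comp:
  assumes f: "bounded_bilinear_map E F G f" and h: "bounded_linear_on G K h"
  shows "bounded_bilinear_map E F K (\<lambda>x y. h (f x y))"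
  unfolding bounded_bilinear_map_def
proof (intro conjI ballI allI impI)
  fix B C assume "bounded_in E B \<and> bounded_in F C"
  then have "bounded_in K (h ` {f x y |x y. x \<in> B \<and> y \<in> C})"
    by (intro bounded_linear_onD(4)[OF h] bounded_bilinear_mapD(6)[OF f]) auto
  then show "bounded_in K ((\<lambda>(x, y). h (f x y)) ` (B \<times> C))"
    by (rule bounded_in_subset) auto
qed (use bounded_bilinear_mapD[OF f] bounded_linear_onD[OF h] in auto)


section \<open>Bounded functions with values in a convenient vector space\<close>

instantiation "fun" :: (type, real_vector) real_vector
begin

definition scaleR_fun :: "real \<Rightarrow> ('a \<Rightarrow> 'b) \<Rightarrow> 'a \<Rightarrow> 'b" where
  "scaleR_fun c f = (\<lambda>x. c *\<^sub>R f x)"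

instance
  by standard (auto simp: scaleR_fun_def fun_eq_iff scaleR_add_right scaleR_add_left)

end

lemma scaleR_fun_apply [simp]: "(c *\<^sub>R f) x = c *\<^sub>R f x"
  by (simp add: scaleR_fun_def)

text \<open>A bounded linear map into this space is a family of linear maps into G, indexed by the
  whole type, that is equibounded. The topology is generated from the intended bornology because a
  convenient space has to carry its bornological topology.\<close>

definition bounded_function_space :: "'g::real_vector topology \<Rightarrow> ('i \<Rightarrow> 'g) topology" where
  "bounded_function_space G =
     bornology_topology {\<phi>. bounded_in G (range \<phi>)} {B. bounded_in G (\<Union>\<phi>\<in>B. range \<phi>)}"

context
  fixes G :: "'g::real_vector topology" and X :: "('i \<Rightarrow> 'g) set" and \<B> :: "('i \<Rightarrow> 'g) set set"
  assumes G: "convenient_space G"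
  defines "X \<equiv> {\<phi>. bounded_in G (range \<phi>)}" and "\<B> \<equiv> {B. bounded_in G (\<Union>\<phi>\<in>B. range \<phi>)}"
begin

private lemma lG: "locally_convex_space G"
  by (rule convenient_spaceD[OF G])

private lemma subspace_X: "subspace X"
  unfolding subspace_def
proof (intro conjI ballI allI)
  have "(0 :: 'i \<Rightarrow> 'g) = (\<lambda>_. 0)" by auto
  moreover have "0 \<in> topspace G" using convenient_spaceD(2)[OF G] by (rule subspace_0)
  ultimately show "0 \<in> X"
    using bounded_in_singleton[OF lG, of 0] bounded_in_subset[of G "{0}"] by (auto simp: X_def)
next
  fix \<phi> \<psi> assume "\<phi> \<in> X" "\<psi> \<in> X"
  then show "\<phi> + \<psi> \<in> X"
    using bounded_in_image_add[OF lG, of \<phi> UNIV \<psi>] by (simp add: X_def plus_fun_def)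
next
  fix c \<phi> assume "\<phi> \<in> X"
  then show "c *\<^sub>R \<phi> \<in> X"
    using bounded_in_image_scaleR[OF lG, of \<phi> UNIV c] by (simp add: X_def scaleR_fun_def)
qed

private lemma \<B>_subset: "B \<in> \<B> \<Longrightarrow> B \<subseteq> X"
  by (auto simp: \<B>_def X_def intro: bounded_in_subset)

lemma topspace_bounded_function_space: "topspace (bounded_function_space G) = X"
  unfolding bounded_function_space_def X_def[symmetric] \<B>_def[symmetric]
  by (rule topspace_bornology_topology[OF subspace_X \<B>_subset])

text \<open>The topology generated by a bornology may have more bounded sets than the bornology.
  Here it has not: the functions with values in an absolutely convex neighbourhood W form an
  absorbing neighbourhood, and being absorbed by it means that W absorbs all values at once.\<close>

lemma bounded_in_bounded_function_space: "bounded_in (bounded_function_space G) B \<longleftrightarrow> B \<in> \<B>"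
proof
  let ?E = "bornology_topology X \<B>"
  have E: "?E = bounded_function_space G" by (simp add: bounded_function_space_def X_def \<B>_def)
  assume B: "bounded_in (bounded_function_space G) B"
  have BX: "B \<subseteq> X" using bounded_in_topspace[OF B] by (simp add: topspace_bounded_function_space)
  have "bounded_in G (\<Union>\<phi>\<in>B. range \<phi>)"
  proof (rule bounded_inI[OF lG])
    show "(\<Union>\<phi>\<in>B. range \<phi>) \<subseteq> topspace G" using BX by (auto simp: X_def bounded_in_def)
    fix W assume W: "openin G W" "0 \<in> W" "absolutely_convex W"
    let ?V = "{\<phi> \<in> X. range \<phi> \<subseteq> W}"
    have "absorbing_nbhd X \<B> ?V"
      unfolding absorbing_nbhd_def
    proof (intro conjI ballI)
      show "0 \<in> ?V" using W(2) subspace_0[OF subspace_X] by auto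
      show "absolutely_convex ?V"
        unfolding absolutely_convex_def
      proof (intro conjI ballI allI impI convexI)
        fix \<phi> \<psi> and u v :: real assume "\<phi> \<in> ?V" "\<psi> \<in> ?V" "0 \<le> u" "0 \<le> v" "u + v = 1"
        then show "u *\<^sub>R \<phi> + v *\<^sub>R \<psi> \<in> ?V"
          using W(3) subspace_X unfolding absolutely_convex_def convex_def
          by (auto simp: subspace_add subspace_scale image_subset_iff)
      next
        fix \<phi> c assume "\<phi> \<in> ?V" "\<bar>c :: real\<bar> \<le> 1"
        then show "c *\<^sub>R \<phi> \<in> ?V"
          using W(3) subspace_X by (auto simp: absolutely_convex_def subspace_scale image_subset_iff)
      qed
      fix C assume C: "C \<in> \<B>"
      then have "absorbs W (\<Union>\<phi>\<in>C. range \<phi>)" using W by (simp add: \<B>_def bounded_in_def)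
      then obtain r where r: "r > 0" "\<And>t. r \<le> \<bar>t\<bar> \<Longrightarrow> (\<Union>\<phi>\<in>C. range \<phi>) \<subseteq> (\<lambda>x. t *\<^sub>R x) ` W"
        unfolding absorbs_def by blast
      show "absorbs ?V C"
        unfolding absorbs_def
      proof (intro exI[of _ r] conjI allI impI r(1) subsetI)
        fix t \<phi> assume t: "r \<le> \<bar>t\<bar>" and \<phi>: "\<phi> \<in> C"
        then have t0: "t \<noteq> 0" using r(1) by auto
        have "inverse t *\<^sub>R \<phi> i \<in> W" for i
        proof -
          obtain w where "w \<in> W" "\<phi> i = t *\<^sub>R w" using r(2)[OF t] \<phi> by blast
          then show ?thesis using t0 by simp
        qed
        then have "inverse t *\<^sub>R \<phi> \<in> ?V"
          using \<B>_subset[OF C] \<phi> subspace_X by (auto simp: subspace_scale)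
        moreover have "\<phi> = t *\<^sub>R (inverse t *\<^sub>R \<phi>)" using t0 by simp
        ultimately show "\<phi> \<in> (\<lambda>x. t *\<^sub>R x) ` ?V" by blast
      qed
    qed auto
    then obtain U where U: "openin ?E U" "0 \<in> U" "convex U" "U \<subseteq> ?V"
      by (rule absorbing_nbhd_interior[OF subspace_X])
    then obtain t where t: "B \<subseteq> (\<lambda>x. t *\<^sub>R x) ` U"
      using bounded_in_scaled_subset[OF B] unfolding E by blast
    have "\<phi> i \<in> (\<lambda>x. t *\<^sub>R x) ` W" if \<phi>: "\<phi> \<in> B" for \<phi> i
    proof -
      obtain \<psi> where "\<psi> \<in> U" "\<phi> = t *\<^sub>R \<psi>" using t \<phi> by blast
      moreover from this have "\<psi> i \<in> W" using U(4) by blast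
      ultimately show ?thesis by (simp add: imageI)
    qed
    then have "(\<Union>\<phi>\<in>B. range \<phi>) \<subseteq> (\<lambda>x. t *\<^sub>R x) ` W" by blast
    then show "\<exists>t. (\<Union>\<phi>\<in>B. range \<phi>) \<subseteq> (\<lambda>x. t *\<^sub>R x) ` W" by blast
  qed
  then show "B \<in> \<B>" by (simp add: \<B>_def)
next
  assume B: "B \<in> \<B>"
  show "bounded_in (bounded_function_space G) B"
    unfolding bounded_in_def topspace_bounded_function_space
  proof (intro conjI allI impI \<B>_subset[OF B])
    fix U assume "openin (bounded_function_space G) U \<and> (0 :: 'i \<Rightarrow> 'g) \<in> U"
    then obtain V where "absorbing_nbhd X \<B> V" "(+) 0 ` V \<subseteq> U"
      unfolding bounded_function_space_def X_def[symmetric] \<B>_def[symmetric] openin_bornology_topology by blast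
    then show "absorbs U B" using B absorbs_mono[of V B U B] by (auto simp: absorbing_nbhd_def)
  qed
qed

text \<open>Separation and candidates for limits come pointwise from G. Convergence in the finer
  topology holds because a Mackey-Cauchy sequence of functions has one rate and one bounded set for
  all indices.\<close>

lemma convenient_bounded_function_space:
  "convenient_space (bounded_function_space G :: ('i \<Rightarrow> 'g) topology)"
proof -
  define E where "E = (bounded_function_space G :: ('i \<Rightarrow> 'g) topology)"
  have E: "E = bornology_topology X \<B>" by (simp add: E_def bounded_function_space_def X_def \<B>_def)
  have top: "topspace E = X" by (simp add: E_def topspace_bounded_function_space)
  have bdd: "bounded_in E B \<longleftrightarrow> B \<in> \<B>" for B by (simp add: E_def bounded_in_bounded_function_space)
  have sing: "{\<phi>} \<in> \<B>" if "\<phi> \<in> X" for \<phi> using that by (simp add: X_def \<B>_def)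
  have lE: "locally_convex_space E"
    unfolding E by (rule locally_convex_bornology_topology[OF subspace_X \<B>_subset sing])
  have born: "bornologification E = E"
  proof -
    have "Collect (bounded_in E) = \<B>" by (auto simp: bdd)
    then show ?thesis by (simp add: bornologification_def top E[symmetric])
  qed
  have XG: "\<phi> i \<in> topspace G" if "\<phi> \<in> X" for \<phi> i using that by (auto simp: X_def bounded_in_def)
  \<comment> \<open>Evaluations are bounded, hence continuous for the topology generated by the
    bornology, and they separate points.\<close>
  have eval: "continuous_map E G (\<lambda>\<phi>. \<phi> i)" for i
    unfolding E
  proof (rule bornology_topology_continuous[OF subspace_X \<B>_subset lG])
    show "bounded_in G ((\<lambda>\<phi>. \<phi> i) ` B)" if "B \<in> \<B>" for B
      using that by (auto simp: \<B>_def intro: bounded_in_subset)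
  qed (use XG in \<open>auto simp: linear_on_set_def\<close>)
  have "Hausdorff_space E"
    unfolding Hausdorff_space_def top
  proof (intro allI impI)
    fix \<phi> \<psi> assume "\<phi> \<in> X \<and> \<psi> \<in> X \<and> \<phi> \<noteq> \<psi>"
    then obtain i where i: "\<phi> \<in> X" "\<psi> \<in> X" "\<phi> i \<noteq> \<psi> i" by (auto simp: fun_eq_iff)
    then obtain U V where UV: "openin G U" "openin G V" "\<phi> i \<in> U" "\<psi> i \<in> V" "disjnt U V"
      using convenient_spaceD(3)[OF G] XG unfolding Hausdorff_space_def by metis
    show "\<exists>U V. openin E U \<and> openin E V \<and> \<phi> \<in> U \<and> \<psi> \<in> V \<and> disjnt U V"
      using openin_continuous_map_preimage[OF eval[of i] UV(1)]
        openin_continuous_map_preimage[OF eval[of i] UV(2)] UV i unfolding top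
      by (intro exI[of _ "{\<phi> \<in> X. \<phi> i \<in> U}"] exI[of _ "{\<phi> \<in> X. \<phi> i \<in> V}"]) (auto simp: disjnt_iff)
  qed
  moreover have "\<exists>l. limitin E x l sequentially" if mc: "mackey_cauchy E x" for x
  proof -
    have xX: "x n \<in> X" for n using mc by (auto simp: mackey_cauchy_def top)
    obtain \<mu> where \<mu>: "filterlim \<mu> at_top (sequentially \<times>\<^sub>F sequentially)"
      "bounded_in E (range (\<lambda>(n, m). \<mu> (n, m) *\<^sub>R (x n - x m)))"
      using mc unfolding mackey_cauchy_def by blast
    \<comment> \<open>D contains the scaled differences at every index i, which makes all later
      estimates independent of i.\<close>
    define D where "D = (\<Union>\<phi>\<in>range (\<lambda>(n, m). \<mu> (n, m) *\<^sub>R (x n - x m)). range \<phi>)"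
    have D: "bounded_in G D" using \<mu>(2) unfolding bdd by (simp add: \<B>_def D_def)
    have memD: "\<mu> (n, m) *\<^sub>R (x n i - x m i) \<in> D" for n m i
    proof -
      have "\<mu> (n, m) *\<^sub>R (x n i - x m i) = (\<mu> (n, m) *\<^sub>R (x n - x m)) i" by simp
      then show ?thesis unfolding D_def by blast
    qed
    have "\<exists>l. limitin G (\<lambda>n. x n i) l sequentially" for i
    proof -
      have "bounded_in G (range (\<lambda>(n, m). \<mu> (n, m) *\<^sub>R (x n i - x m i)))"
        by (rule bounded_in_subset[OF D]) (use memD in auto)
      then have "mackey_cauchy G (\<lambda>n. x n i)"
        unfolding mackey_cauchy_def using \<mu>(1) XG[OF xX] by auto
      then show ?thesis using G unfolding convenient_space_def by blast
    qed
    then obtain z where z: "\<And>i. limitin G (\<lambda>n. x n i) (z i) sequentially" by metis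
    have zG: "z i \<in> topspace G" for i using z by (simp add: limitin_def)
    have "\<exists>N. \<forall>n\<ge>N. \<forall>m\<ge>N. real k \<le> \<mu> (n, m)" for k
      using \<mu>(1) unfolding filterlim_at_top eventually_prod_sequentially by blast
    then obtain N where N: "\<And>k n m. n \<ge> N k \<Longrightarrow> m \<ge> N k \<Longrightarrow> real k \<le> \<mu> (n, m)" by metis
    \<comment> \<open>Boundedness of Q is Mackey convergence of x to z in disguise: a neighbourhood
      absorbing Q contains the differences x n - z for all large n.\<close>
    define Q where "Q = {real k *\<^sub>R (x n - z) | k n. k \<ge> 1 \<and> n \<ge> N k}"
    have "bounded_in G (\<Union>\<phi>\<in>Q. range \<phi>)"
    proof (rule bounded_inI[OF lG])
      show "(\<Union>\<phi>\<in>Q. range \<phi>) \<subseteq> topspace G"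
        using convenient_spaceD(2)[OF G] XG[OF xX] zG
        by (auto simp: Q_def intro!: subspace_scale subspace_diff)
      fix W assume W: "openin G W" "0 \<in> W" "absolutely_convex W"
      obtain r where r: "r > 0" "D \<subseteq> (\<lambda>x. r *\<^sub>R x) ` W"
        using bounded_in_scaled_subset[OF D W(1,2)] by blast
      have "real k *\<^sub>R (x n i - z i) \<in> (\<lambda>x. (r + 1) *\<^sub>R x) ` W" if k: "k \<ge> 1" "n \<ge> N k" for k n i
      proof -
        have "limitin G (\<lambda>m. (-1) *\<^sub>R z i) ((-1) *\<^sub>R z i) sequentially"
          using zG convenient_spaceD(2)[OF G] by (simp add: subspace_neg)
        from lcs_scale[OF lG lcs_add[OF lG z[of i] this], of "real k"]
        have "limitin G (\<lambda>m. real k *\<^sub>R (x m i - z i)) 0 sequentially" by simp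
        then have "eventually (\<lambda>m. real k *\<^sub>R (x m i - z i) \<in> W) sequentially"
          using W by (simp add: limitin_def)
        then have "eventually (\<lambda>m. real k *\<^sub>R (x m i - z i) \<in> W \<and> m \<ge> N k) sequentially"
          using eventually_ge_at_top by (rule eventually_conj)
        \<comment> \<open>The auxiliary m may depend on i; the factor r + 1 obtained in the end does
          not.\<close>
        then obtain m where m: "real k *\<^sub>R (x m i - z i) \<in> W" "m \<ge> N k"
          by (auto simp: eventually_sequentially)
        have mu: "real k \<le> \<mu> (n, m)" "\<mu> (n, m) > 0" using N[OF k(2) m(2)] k(1) by auto
        obtain w where w: "w \<in> W" "\<mu> (n, m) *\<^sub>R (x n i - x m i) = r *\<^sub>R w" using r(2) memD by blast
        define w' where "w' = (real k / \<mu> (n, m)) *\<^sub>R w"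
        have w': "w' \<in> W" using W(3) w mu by (simp add: w'_def absolutely_convex_def)
        have "r *\<^sub>R w' = (real k / \<mu> (n, m)) *\<^sub>R (r *\<^sub>R w)" by (simp add: w'_def mult.commute)
        also have "\<dots> = real k *\<^sub>R (x n i - x m i)" using mu by (simp add: w(2)[symmetric])
        finally have e: "real k *\<^sub>R (x n i - x m i) = r *\<^sub>R w'" ..
        let ?v = "(r / (r + 1)) *\<^sub>R w' + (1 / (r + 1)) *\<^sub>R (real k *\<^sub>R (x m i - z i))"
        have "r / (r + 1) + 1 / (r + 1) = 1" using r(1) by (simp add: field_simps)
        moreover have "0 \<le> r / (r + 1)" "0 \<le> 1 / (r + 1)" using r(1) by auto
        ultimately have "?v \<in> W" using W(3) w' m(1) unfolding absolutely_convex_def convex_def by blast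
        moreover have "(r + 1) *\<^sub>R ?v = r *\<^sub>R w' + real k *\<^sub>R (x m i - z i)"
          using r(1) by (simp only: scaleR_add_right scaleR_scaleR) simp
        then have "real k *\<^sub>R (x n i - z i) = (r + 1) *\<^sub>R ?v" unfolding e[symmetric] by (simp add: algebra_simps)
        ultimately show ?thesis by blast
      qed
      then have "(\<Union>\<phi>\<in>Q. range \<phi>) \<subseteq> (\<lambda>x. (r + 1) *\<^sub>R x) ` W" by (auto simp: Q_def)
      then show "\<exists>t. (\<Union>\<phi>\<in>Q. range \<phi>) \<subseteq> (\<lambda>x. t *\<^sub>R x) ` W" by blast
    qed
    then have Q: "Q \<in> \<B>" by (simp add: \<B>_def)
    \<comment> \<open>A pointwise limit need not have bounded range a priori; z has, because it
      differs from the bounded function x (N 1) by an element of Q.\<close>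
    have "real 1 *\<^sub>R (x (N 1) - z) \<in> Q" unfolding Q_def by blast
    then have "x (N 1) - z \<in> X" using \<B>_subset[OF Q] by auto
    from subspace_diff[OF subspace_X xX[of "N 1"] this] have zX: "z \<in> X" by simp
    have "limitin E x z sequentially"
      unfolding limitin_def top
    proof (intro conjI allI impI zX)
      fix U assume "openin E U \<and> z \<in> U"
      then obtain V where V: "absorbing_nbhd X \<B> V" "(+) z ` V \<subseteq> U"
        unfolding E openin_bornology_topology by blast
      then have "absorbs V Q" using Q by (simp add: absorbing_nbhd_def)
      then obtain r where r: "r > 0" "\<And>t. r \<le> \<bar>t\<bar> \<Longrightarrow> Q \<subseteq> (\<lambda>x. t *\<^sub>R x) ` V"
        unfolding absorbs_def by blast
      obtain k :: nat where k: "r \<le> real k" using real_arch_simple by blast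
      then have k1: "k \<ge> 1" using r(1) by (cases k) auto
      have "x n \<in> U" if "n \<ge> N k" for n
      proof -
        have "real k *\<^sub>R (x n - z) \<in> Q" using that k1 by (auto simp: Q_def)
        then obtain v where "v \<in> V" "real k *\<^sub>R (x n - z) = real k *\<^sub>R v" using r(2)[of "real k"] k by auto
        then have "x n - z \<in> V" using k1 by simp
        then have "z + (x n - z) \<in> U" using V(2) by blast
        then show ?thesis by simp
      qed
      then show "\<forall>\<^sub>F n in sequentially. x n \<in> U" by (auto simp: eventually_sequentially)
    qed
    then show ?thesis by blast
  qed
  ultimately have "convenient_space E" using lE born by (simp add: convenient_space_def)
  then show ?thesis by (simp add: E_def)
qed

end

section \<open>Universal bilinear maps\<close>

lemma universal_bilinear_factor:
  assumes "universal_bilinear E F R T \<tau>" "convenient_space G"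
    "bounded_bilinear_map E F G f" "(\<lambda>(x, y). f x y) respects R"
  obtains h where "bounded_linear_on T G h"
    "\<And>x y. x \<in> topspace E \<Longrightarrow> y \<in> topspace F \<Longrightarrow> h (\<tau> x y) = f x y"
proof -
  have "subspace (topspace T)"
    using assms(1) by (simp add: universal_bilinear_def convenient_spaceD)
  then show thesis
    using universal_bilinear_factorization[OF assms] that by (auto simp: bounded_linear_maps_iff)
qed

text \<open>Both maps factor the bilinear map h \<circ> \<tau>, which inherits the relations R from
  \<tau>, so the uniqueness part of the universal property identifies them.\<close>

lemma universal_bilinear_ext:
  assumes U: "universal_bilinear E F R T \<tau>" and G: "convenient_space G"
    and h: "bounded_linear_on T G h" and k: "bounded_linear_on T G k"
    and eq: "\<And>x y. x \<in> topspace E \<Longrightarrow> y \<in> topspace F \<Longrightarrow> h (\<tau> x y) = k (\<tau> x y)"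
    and t: "t \<in> topspace T"
  shows "h t = k t"
proof -
  have T: "subspace (topspace T)" and \<tau>: "bounded_bilinear_map E F T \<tau>" "(\<lambda>(x, y). \<tau> x y) respects R"
    using U by (auto simp: universal_bilinear_def convenient_spaceD)
  have \<tau>T: "\<tau> x y \<in> topspace T" if "x \<in> topspace E" "y \<in> topspace F" for x y
    using bounded_bilinear_mapD(1)[OF \<tau>(1)] that .
  have "(\<lambda>(x, y). h (\<tau> x y)) respects R"
    using \<tau>(2) by (fastforce simp: congruent_def)
  from universal_bilinear_factorization[OF U G bounded_bilinear_map_comp[OF \<tau>(1) h] this]
  have "restrict h (topspace T) = restrict k (topspace T)"
    using restrict_bounded_linear_maps[OF T h] restrict_bounded_linear_maps[OF T k] eq \<tau>T
    by (smt (verit) restrict_apply')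
  then show ?thesis using t by (metis restrict_apply')
qed

text \<open>
  The maps in \<open>H\<close> are assembled into one map with values in the convenient vector space of
  bounded functions on \<open>H\<close>, to which the universal property applies.
\<close>

lemma universal_bilinear_equibounded:
  fixes T :: "'t::real_vector topology" and G :: "'g::real_vector topology"
  assumes U: "universal_bilinear E F R T \<tau>" and G: "convenient_space G"
    and H: "\<And>h. h \<in> H \<Longrightarrow> bounded_linear_on T G h"
    and bd: "\<And>B C. bounded_in E B \<Longrightarrow> bounded_in F C \<Longrightarrow>
      bounded_in G {h (\<tau> x y) |h x y. h \<in> H \<and> x \<in> B \<and> y \<in> C}"
    and E: "locally_convex_space E" and F: "locally_convex_space F"
  shows "equibounded T G H"
proof -
  have \<tau>: "bounded_bilinear_map E F T \<tau>" "(\<lambda>(x, y). \<tau> x y) respects R"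
    using U by (auto simp: universal_bilinear_def)
  note lG = convenient_spaceD[OF G]
  \<comment> \<open>The bounded functions live on the type of all maps, so \<open>ev\<close> takes
    the default value 0 outside H. Adding 0 to a bounded set accounts for these indices.\<close>
  have bd0: "bounded_in G (insert 0 B)" if B: "bounded_in G B" for B
  proof (rule bounded_inI[OF lG(1)])
    show "insert 0 B \<subseteq> topspace G" using bounded_in_topspace[OF B] lG(2) by (simp add: subspace_0)
    fix W assume W: "openin G W" "0 \<in> W" "absolutely_convex W"
    obtain t where "B \<subseteq> (\<lambda>x. t *\<^sub>R x) ` W" using bounded_in_scaled_subset[OF B W(1,2)] by blast
    moreover have "t *\<^sub>R 0 \<in> (\<lambda>x. t *\<^sub>R x) ` W" using W(2) by (rule imageI)
    ultimately show "\<exists>t. insert 0 B \<subseteq> (\<lambda>x. t *\<^sub>R x) ` W" by auto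
  qed
  define L where "L = (bounded_function_space G :: (('t \<Rightarrow> 'g) \<Rightarrow> 'g) topology)"
  have cL: "convenient_space L" unfolding L_def by (rule convenient_bounded_function_space[OF G])
  define ev where "ev = (\<lambda>t (h :: 't \<Rightarrow> 'g). if h \<in> H then h t else 0)"
  have bL: "bounded_in L B \<longleftrightarrow> bounded_in G (\<Union>\<phi>\<in>B. range \<phi>)" for B
    unfolding L_def bounded_in_bounded_function_space[OF G] by simp
  have bev: "bounded_in L ((\<lambda>(x, y). ev (\<tau> x y)) ` (B \<times> C))" if "bounded_in E B" "bounded_in F C" for B C
    unfolding bL by (rule bounded_in_subset[OF bd0[OF bd[OF that]]], auto simp: ev_def split: if_splits, metis)
  have bil: "bounded_bilinear_map E F L (\<lambda>x y. ev (\<tau> x y))"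
    unfolding bounded_bilinear_map_def
  proof (intro conjI ballI allI impI)
    fix x y assume x: "x \<in> topspace E" and y: "y \<in> topspace F"
    have "bounded_in L ((\<lambda>(x, y). ev (\<tau> x y)) ` ({x} \<times> {y}))"
      by (intro bev bounded_in_singleton x y E F)
    then show "ev (\<tau> x y) \<in> topspace L" using bounded_in_topspace by auto
  next
    fix B C assume "bounded_in E B \<and> bounded_in F C"
    then show "bounded_in L ((\<lambda>(x, y). ev (\<tau> x y)) ` (B \<times> C))" using bev by blast
  qed (use bounded_bilinear_mapD(1-5)[OF \<tau>(1)] in \<open>auto simp: ev_def fun_eq_iff bounded_linear_onD(2,3)[OF H]\<close>)
  have "(\<lambda>(x, y). ev (\<tau> x y)) respects R"
    using \<tau>(2) by (fastforce simp: congruent_def)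
  then obtain k where k: "bounded_linear_on T L k"
    "\<And>x y. x \<in> topspace E \<Longrightarrow> y \<in> topspace F \<Longrightarrow> k (\<tau> x y) = ev (\<tau> x y)"
    using universal_bilinear_factor[OF U cL bil] by blast
  have eval: "bounded_linear_on L G (\<lambda>\<phi>. \<phi> h)" for h
    unfolding bounded_linear_on_def linear_on_set_def
  proof (intro conjI ballI allI impI)
    fix \<phi> assume "\<phi> \<in> topspace L"
    then show "\<phi> h \<in> topspace G"
      by (auto simp: L_def topspace_bounded_function_space[OF G] bounded_in_def)
  next
    fix B assume "bounded_in L B"
    then show "bounded_in G ((\<lambda>\<phi>. \<phi> h) ` B)" unfolding bL by (rule bounded_in_subset) auto
  qed auto
  \<comment> \<open>The factorization k through \<tau> has the members of H as its components; a
    bound for k on B is thus a bound for all of them at once.\<close>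
  have kh: "k t h = h t" if h: "h \<in> H" and t: "t \<in> topspace T" for h t
    by (rule universal_bilinear_ext[OF U G bounded_linear_on_comp[OF k(1) eval] H[OF h] _ t])
      (simp add: k(2) ev_def h)
  show ?thesis
    unfolding equibounded_def
  proof (intro allI impI)
    fix B assume B: "bounded_in T B"
    have "bounded_in G (\<Union>\<phi>\<in>k ` B. range \<phi>)" using bounded_linear_onD(4)[OF k(1) B] by (simp add: bL)
    moreover have "(\<Union>h\<in>H. h ` B) \<subseteq> (\<Union>\<phi>\<in>k ` B. range \<phi>)"
    proof clarify
      fix h t assume "h \<in> H" "t \<in> B"
      moreover from this have "h t = k t h" using kh bounded_in_topspace[OF B] by auto
      ultimately show "h t \<in> (\<Union>\<phi>\<in>k ` B. range \<phi>)" by blast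
    qed
    ultimately show "bounded_in G (\<Union>h\<in>H. h ` B)" by (rule bounded_in_subset)
  qed
qed

section \<open>Closed subspaces\<close>

text \<open>Absorption by U passes to U \<inter> K because the point u with b = t u is a multiple of
  b and stays in the subspace.\<close>

lemma bounded_in_subtopology:
  assumes "subspace (topspace E \<inter> K)"
  shows "bounded_in (subtopology E K) B \<longleftrightarrow> bounded_in E B \<and> B \<subseteq> K"
proof (intro iffI conjI)
  assume B: "bounded_in (subtopology E K) B"
  show "B \<subseteq> K" using bounded_in_topspace[OF B] by simp
  have 0: "0 \<in> K" using subspace_0[OF assms] by simp
  show "bounded_in E B"
    unfolding bounded_in_def
  proof (intro conjI allI impI)
    show "B \<subseteq> topspace E" using bounded_in_topspace[OF B] by simp
    fix U assume "openin E U \<and> 0 \<in> U"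
    then have "openin (subtopology E K) (U \<inter> K) \<and> 0 \<in> U \<inter> K"
      using 0 by (auto simp: openin_subtopology)
    then have "absorbs (U \<inter> K) B" using B unfolding bounded_in_def by blast
    then show "absorbs U B" by (rule absorbs_mono) auto
  qed
next
  assume B: "bounded_in E B \<and> B \<subseteq> K"
  then have BK: "B \<subseteq> topspace E \<inter> K" using bounded_in_topspace by blast
  show "bounded_in (subtopology E K) B"
    unfolding bounded_in_def
  proof (intro conjI allI impI)
    show "B \<subseteq> topspace (subtopology E K)" using BK by simp
    fix V assume V: "openin (subtopology E K) V \<and> 0 \<in> V"
    then obtain U where U: "openin E U" "V = U \<inter> K" by (auto simp: openin_subtopology)
    then have "absorbs U B" using B V by (auto simp: bounded_in_def)
    then obtain r where r: "r > 0" "\<And>t. r \<le> \<bar>t\<bar> \<Longrightarrow> B \<subseteq> (\<lambda>x. t *\<^sub>R x) ` U"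
      unfolding absorbs_def by blast
    show "absorbs V B"
      unfolding absorbs_def
    proof (intro exI[of _ r] conjI allI impI r(1) subsetI)
      fix t b assume t: "r \<le> \<bar>t\<bar>" and b: "b \<in> B"
      then obtain u where u: "u \<in> U" "b = t *\<^sub>R u" using r(2)[OF t] by blast
      have "u = inverse t *\<^sub>R b" using u(2) t r(1) by auto
      then have "u \<in> K" using subspace_scale[OF assms, of b "inverse t"] b BK by auto
      then show "b \<in> (\<lambda>x. t *\<^sub>R x) ` V" using u U(2) by blast
    qed
  qed
qed

text \<open>The subspace topology need not be bornological, hence the bornologification. The claims
  are \<open>convenient_bornology_topology\<close> for the inclusion map.\<close>

lemma convenient_closed_subspace:
  assumes E: "convenient_space E" and K: "subspace (topspace E \<inter> K)"
    and closed: "\<And>y l. range y \<subseteq> topspace E \<inter> K \<Longrightarrow> limitin E y l sequentially \<Longrightarrow> l \<in> K"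
  shows "convenient_space (bornologification (subtopology E K))"
    and "topspace (bornologification (subtopology E K)) = topspace E \<inter> K"
    and "bounded_in (bornologification (subtopology E K)) B \<longleftrightarrow> bounded_in E B \<and> B \<subseteq> K"
proof -
  let ?\<B> = "{B. B \<subseteq> topspace E \<inter> K \<and> bounded_in E ((\<lambda>x. x) ` B)}"
  have "Collect (bounded_in (subtopology E K)) = ?\<B>"
    by (auto simp: bounded_in_subtopology[OF K] intro: subsetD[OF bounded_in_topspace])
  then have eq: "bornologification (subtopology E K) = bornology_topology (topspace E \<inter> K) ?\<B>"
    by (simp add: bornologification_def)
  have lin: "linear_on_set (topspace E \<inter> K) (\<lambda>x. x)" by (simp add: linear_on_set_def)
  have cl: "l \<in> (\<lambda>x. x) ` (topspace E \<inter> K)"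
    if "range y \<subseteq> (\<lambda>x. x) ` (topspace E \<inter> K)" "limitin E y l sequentially" for y l
    using closed[of y l] that by (auto simp: limitin_def)
  note * = convenient_bornology_topology[OF K lin _ _ E cl, folded eq]
  show "convenient_space (bornologification (subtopology E K))" by (rule *(1)) auto
  show "topspace (bornologification (subtopology E K)) = topspace E \<inter> K" by (rule *(2)) auto
  have "bounded_in (bornologification (subtopology E K)) B \<longleftrightarrow>
      B \<subseteq> topspace E \<inter> K \<and> bounded_in E ((\<lambda>x. x) ` B)" by (rule *(3)) auto
  then show "bounded_in (bornologification (subtopology E K)) B \<longleftrightarrow> bounded_in E B \<and> B \<subseteq> K"
    by (auto intro: subsetD[OF bounded_in_topspace])
qed


section \<open>Bimodules\<close>

lemma convenient_algebraD:
  assumes "convenient_algebra A"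
  shows "convenient_space (alg_space A)"
    and "bounded_bilinear_map (alg_space A) (alg_space A) (alg_space A) (alg_mult A)"
    and "alg_one A \<in> topspace (alg_space A)"
    and "a \<in> topspace (alg_space A) \<Longrightarrow> alg_mult A (alg_one A) a = a"
    and "a \<in> topspace (alg_space A) \<Longrightarrow> alg_mult A a (alg_one A) = a"
    and "a \<in> topspace (alg_space A) \<Longrightarrow> b \<in> topspace (alg_space A) \<Longrightarrow> c \<in> topspace (alg_space A) \<Longrightarrow>
      alg_mult A (alg_mult A a b) c = alg_mult A a (alg_mult A b c)"
  using assms by (auto simp: convenient_algebra_def)

lemma convenient_bimoduleD:
  assumes "convenient_bimodule A M"
  shows "convenient_space (mod_space M)"
    and "bounded_bilinear_map (alg_space A) (mod_space M) (mod_space M) (lact M)"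
    and "bounded_bilinear_map (mod_space M) (alg_space A) (mod_space M) (ract M)"
    and "m \<in> topspace (mod_space M) \<Longrightarrow> lact M (alg_one A) m = m"
    and "m \<in> topspace (mod_space M) \<Longrightarrow> ract M m (alg_one A) = m"
    and "a \<in> topspace (alg_space A) \<Longrightarrow> b \<in> topspace (alg_space A) \<Longrightarrow> m \<in> topspace (mod_space M) \<Longrightarrow>
      lact M (alg_mult A a b) m = lact M a (lact M b m)"
    and "a \<in> topspace (alg_space A) \<Longrightarrow> b \<in> topspace (alg_space A) \<Longrightarrow> m \<in> topspace (mod_space M) \<Longrightarrow>
      ract M m (alg_mult A a b) = ract M (ract M m a) b"
    and "a \<in> topspace (alg_space A) \<Longrightarrow> b \<in> topspace (alg_space A) \<Longrightarrow> m \<in> topspace (mod_space M) \<Longrightarrow>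
      ract M (lact M a m) b = lact M a (ract M m b)"
  using assms by (auto simp: convenient_bimodule_def)

lemma respects_balanced_pairs:
  "(\<lambda>(x, y). f x y) respects balanced_pairs A M N \<longleftrightarrow>
     (\<forall>m\<in>topspace (mod_space M). \<forall>a\<in>topspace (alg_space A). \<forall>n\<in>topspace (mod_space N).
        f (ract M m a) n = f m (lact N a n))"
  by (fastforce simp: congruent_def balanced_pairs_def)


section \<open>One-forms\<close>

locale noncommutative_forms =
  fixes A :: "'a::real_vector algebra_data" and T :: "('a, 'w::real_vector) bimodule_data"
    and \<tau> :: "'a \<Rightarrow> 'a \<Rightarrow> 'w" and \<Omega> :: "nat \<Rightarrow> ('a, 'w) bimodule_data"
    and \<theta> :: "nat \<Rightarrow> 'w \<Rightarrow> 'w \<Rightarrow> 'w"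
  assumes algebra: "convenient_algebra A" and forms: "differential_forms A T \<tau> \<Omega> \<theta>"
begin

declare One_nat_def [simp del]

abbreviation E :: "'a topology" where "E \<equiv> alg_space A"
abbreviation one :: 'a where "one \<equiv> alg_one A"
abbreviation mult :: "'a \<Rightarrow> 'a \<Rightarrow> 'a" (infixl "\<cdot>" 70) where "a \<cdot> b \<equiv> alg_mult A a b"
abbreviation \<mu> :: "'w \<Rightarrow> 'a" where "\<mu> \<equiv> mult_on_tensor A T \<tau>"
abbreviation d :: "'a \<Rightarrow> 'w" where "d \<equiv> d_one A \<tau>"
abbreviation W :: "nat \<Rightarrow> 'w topology" where "W n \<equiv> mod_space (\<Omega> n)"

lemmas E = convenient_algebraD(1)[OF algebra]
lemmas lE = convenient_spaceD(1)[OF E] and subspace_E = convenient_spaceD(2)[OF E]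
lemmas mult_bilinear = convenient_algebraD(2)[OF algebra]
lemmas mult_closed = bounded_bilinear_mapD(1)[OF mult_bilinear]
lemmas one = convenient_algebraD(3-5)[OF algebra]
lemmas mult_assoc = convenient_algebraD(6)[OF algebra]

lemma tensor_square: "bimodule_tensor_square A T \<tau>"
  using forms by (simp add: differential_forms_def)

lemma universal_T: "universal_bilinear E E {} (mod_space T) \<tau>"
  using tensor_square by (simp add: bimodule_tensor_square_def tensor_product_def)

lemma bimodule_T: "convenient_bimodule A T"
  using tensor_square by (simp add: bimodule_tensor_square_def)

lemma act_\<tau>:
  assumes "a \<in> topspace E" "b \<in> topspace E" "c \<in> topspace E"
  shows "lact T a (\<tau> b c) = \<tau> (a \<cdot> b) c" "ract T (\<tau> b c) a = \<tau> b (c \<cdot> a)"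
  using tensor_square assms by (auto simp: bimodule_tensor_square_def)

lemma \<tau>_bilinear: "bounded_bilinear_map E E (mod_space T) \<tau>"
  using universal_T by (simp add: universal_bilinear_def)

lemmas \<tau>_closed = bounded_bilinear_mapD(1)[OF \<tau>_bilinear]
lemmas T = convenient_bimoduleD(1)[OF bimodule_T]
lemmas lT = convenient_spaceD(1)[OF T] and subspace_T = convenient_spaceD(2)[OF T]
lemmas lact_T = bounded_bilinear_map_right[OF lE convenient_bimoduleD(2)[OF bimodule_T]]
lemmas ract_T = bounded_bilinear_map_left[OF lE convenient_bimoduleD(3)[OF bimodule_T]]

lemma \<mu>_maps: "\<mu> \<in> bounded_linear_maps (mod_space T) E"
  and \<mu>_\<tau>: "a \<in> topspace E \<Longrightarrow> b \<in> topspace E \<Longrightarrow> \<mu> (\<tau> a b) = a \<cdot> b"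
  using theI'[OF universal_bilinear_factorization[OF universal_T E mult_bilinear]]
  by (auto simp: congruent_def mult_on_tensor_def)

lemma \<mu>: "bounded_linear_on (mod_space T) E \<mu>"
  using \<mu>_maps by (simp add: bounded_linear_maps_iff subspace_T)

text \<open>On \<open>\<tau> b c\<close> both identities are associativity of the product, and
  bounded linear maps agreeing there are equal.\<close>

lemma \<mu>_act:
  assumes a: "a \<in> topspace E" and t: "t \<in> topspace (mod_space T)"
  shows "\<mu> (lact T a t) = a \<cdot> \<mu> t" "\<mu> (ract T t a) = \<mu> t \<cdot> a"
proof -
  show "\<mu> (lact T a t) = a \<cdot> \<mu> t"
    by (rule universal_bilinear_ext[OF universal_T E bounded_linear_on_comp[OF lact_T[OF a] \<mu>]
          bounded_linear_on_comp[OF \<mu> bounded_bilinear_map_right[OF lE mult_bilinear a]] _ t])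
      (simp add: act_\<tau> \<mu>_\<tau> a mult_closed mult_assoc)
  show "\<mu> (ract T t a) = \<mu> t \<cdot> a"
    by (rule universal_bilinear_ext[OF universal_T E bounded_linear_on_comp[OF ract_T[OF a] \<mu>]
          bounded_linear_on_comp[OF \<mu> bounded_bilinear_map_left[OF lE mult_bilinear a]] _ t])
      (simp add: act_\<tau> \<mu>_\<tau> a mult_closed mult_assoc)
qed

lemma subspace_kernel: "subspace (topspace (mod_space T) \<inter> {t. \<mu> t = 0})"
  using subspace_T bounded_linear_on_zero[OF \<mu> subspace_T]
  by (auto simp: subspace_def bounded_linear_onD(2,3)[OF \<mu>])

lemma one_forms_eq: "\<Omega> 1 = one_forms A T \<tau>"
  using forms by (simp add: differential_forms_def)

lemma act_one_forms: "lact (\<Omega> 1) = lact T" "ract (\<Omega> 1) = ract T"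
  by (simp_all add: one_forms_eq one_forms_def)

text \<open>Bounded linear maps between convenient spaces are continuous, so \<mu> preserves
  limits.\<close>

lemma kernel_closed:
  assumes y: "range y \<subseteq> topspace (mod_space T) \<inter> {t. \<mu> t = 0}" and l: "limitin (mod_space T) y l sequentially"
  shows "l \<in> {t. \<mu> t = 0}"
proof -
  have "limitin E (\<mu> \<circ> y) (\<mu> l) sequentially"
    by (rule continuous_map_limit[OF bounded_linear_maps_continuous[OF T E \<mu>_maps] l])
  moreover have "\<mu> \<circ> y = (\<lambda>n. 0)" using y by (auto simp: fun_eq_iff)
  ultimately have "limitin E (\<lambda>n. 0) (\<mu> l) sequentially" by simp
  moreover have "limitin E (\<lambda>n. 0) 0 sequentially" using subspace_0[OF subspace_E] by simp
  ultimately have "\<mu> l = 0"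
    using convenient_spaceD(3)[OF E] by (metis limitin_Hausdorff_unique trivial_limit_sequentially)
  then show ?thesis by simp
qed

lemmas W1 = convenient_closed_subspace[OF T subspace_kernel kernel_closed]

lemma convenient_W1: "convenient_space (W 1)"
  unfolding one_forms_eq one_forms_def using W1(1) by simp

lemma topspace_W1: "topspace (W 1) = {t \<in> topspace (mod_space T). \<mu> t = 0}"
  unfolding one_forms_eq one_forms_def using W1(2) by auto

lemma bounded_in_W1: "bounded_in (W 1) B \<longleftrightarrow> bounded_in (mod_space T) B \<and> B \<subseteq> {t. \<mu> t = 0}"
  unfolding one_forms_eq one_forms_def using W1(3) by simp

lemma bounded_linear_on_W1:
  assumes "bounded_linear_on F (mod_space T) f" "\<And>x. x \<in> topspace F \<Longrightarrow> \<mu> (f x) = 0"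
  shows "bounded_linear_on F (W 1) f"
  unfolding bounded_linear_on_def bounded_in_W1
proof (intro conjI allI impI)
  show "f ` B \<subseteq> {t. \<mu> t = 0}" if "bounded_in F B" for B
    using bounded_in_topspace[OF that] assms(2) by blast
qed (use assms in \<open>auto simp: bounded_linear_on_def topspace_W1\<close>)

lemma inclusion_W1: "bounded_linear_on (W 1) (mod_space T) (\<lambda>t. t)"
  by (auto simp: bounded_linear_on_def linear_on_set_def topspace_W1 bounded_in_W1)

text \<open>The kernel of \<mu> is stable under both actions by \<open>\<mu>_act\<close>, and its
  bounded sets are those of the tensor square, so everything else restricts.\<close>

lemma bimodule_W1: "convenient_bimodule A (\<Omega> 1)"
proof -
  note D = bounded_bilinear_mapD[OF convenient_bimoduleD(2)[OF bimodule_T]]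
    bounded_bilinear_mapD[OF convenient_bimoduleD(3)[OF bimodule_T]]
  have l0: "a \<in> topspace E \<Longrightarrow> a \<cdot> 0 = 0" and r0: "a \<in> topspace E \<Longrightarrow> 0 \<cdot> a = 0" for a
    using bounded_linear_on_zero[OF bounded_bilinear_map_right[OF lE mult_bilinear, of a] subspace_E]
      bounded_linear_on_zero[OF bounded_bilinear_map_left[OF lE mult_bilinear, of a] subspace_E] by auto
  have bd: "bounded_in (W 1) ((\<lambda>(a, t). lact T a t) ` (B \<times> C))" "bounded_in (W 1) ((\<lambda>(t, a). ract T t a) ` (C \<times> B))"
    if "bounded_in E B" "bounded_in (W 1) C" for B C
  proof -
    have C: "bounded_in (mod_space T) C" "C \<subseteq> topspace (W 1)" and B: "B \<subseteq> topspace E"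
      using that bounded_in_topspace[OF that(1)] bounded_in_topspace[OF that(2)] by (simp_all add: bounded_in_W1)
    show "bounded_in (W 1) ((\<lambda>(a, t). lact T a t) ` (B \<times> C))"
      unfolding bounded_in_W1
      using D(6)[OF that(1) C(1)] C(2) B by (auto simp: image_prod_setcompr topspace_W1 \<mu>_act l0 subset_iff)
    show "bounded_in (W 1) ((\<lambda>(t, a). ract T t a) ` (C \<times> B))"
      unfolding bounded_in_W1
      using D(12)[OF C(1) that(1)] C(2) B by (auto simp: image_prod_setcompr topspace_W1 \<mu>_act r0 subset_iff)
  qed
  have "bounded_bilinear_map E (W 1) (W 1) (lact T)"
    unfolding bounded_bilinear_map_def
  proof (intro conjI ballI allI impI)
    fix B C assume "bounded_in E B \<and> bounded_in (W 1) C"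
    then show "bounded_in (W 1) ((\<lambda>(x, y). lact T x y) ` (B \<times> C))" using bd by blast
  qed (use D in \<open>auto simp: topspace_W1 \<mu>_act l0\<close>)
  moreover have "bounded_bilinear_map (W 1) E (W 1) (ract T)"
    unfolding bounded_bilinear_map_def
  proof (intro conjI ballI allI impI)
    fix B C assume "bounded_in (W 1) B \<and> bounded_in E C"
    then show "bounded_in (W 1) ((\<lambda>(x, y). ract T x y) ` (B \<times> C))" using bd by blast
  qed (use D in \<open>auto simp: topspace_W1 \<mu>_act r0\<close>)
  ultimately show ?thesis
    using bimodule_T convenient_W1
    unfolding convenient_bimodule_def act_one_forms by (auto simp: topspace_W1)
qed

section \<open>The derivation and the retraction onto one-forms\<close>

lemma d_bounded_linear: "bounded_linear_on E (W 1) d"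
proof (rule bounded_linear_on_W1)
  show "bounded_linear_on E (mod_space T) d"
    unfolding d_one_def
    by (intro bounded_linear_on_diff_maps lT bounded_bilinear_map_right[OF lE \<tau>_bilinear]
        bounded_bilinear_map_left[OF lE \<tau>_bilinear] one)
  show "\<mu> (d a) = 0" if "a \<in> topspace E" for a
    using that one by (simp add: d_one_def bounded_linear_on_diff[OF \<mu> subspace_T] \<tau>_closed \<mu>_\<tau>)
qed

lemmas d_closed = bounded_linear_onD(1)[OF d_bounded_linear]

lemma d_one: "d one = 0"
  by (simp add: d_one_def)

text \<open>The Leibniz rule: expanding the right side, the two occurrences of
  \<open>\<tau> a b\<close> cancel.\<close>

lemma d_mult:
  assumes "a \<in> topspace E" "b \<in> topspace E"
  shows "d (a \<cdot> b) = lact (\<Omega> 1) a (d b) + ract (\<Omega> 1) (d a) b"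
  using assms one
  by (simp add: act_one_forms d_one_def bounded_linear_on_diff[OF lact_T subspace_T]
      bounded_linear_on_diff[OF ract_T subspace_T] \<tau>_closed act_\<tau>)

text \<open>Since \<open>a \<mapsto> \<tau> a one\<close> is a section of \<mu>, subtracting it at
  \<open>\<mu> t\<close> projects the tensor square onto the kernel of \<mu> along
  \<open>A \<otimes> 1\<close>.\<close>

definition \<pi> :: "'w \<Rightarrow> 'w" where "\<pi> t = t - \<tau> (\<mu> t) one"

lemma \<pi>_bounded_linear: "bounded_linear_on (mod_space T) (W 1) \<pi>"
proof (rule bounded_linear_on_W1)
  show "bounded_linear_on (mod_space T) (mod_space T) \<pi>"
    unfolding \<pi>_def
    by (intro bounded_linear_on_diff_maps lT bounded_linear_on_id
        bounded_linear_on_comp[OF \<mu> bounded_bilinear_map_left[OF lE \<tau>_bilinear one(1)]])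
  show "\<mu> (\<pi> t) = 0" if "t \<in> topspace (mod_space T)" for t
    using that one by (simp add: \<pi>_def bounded_linear_on_diff[OF \<mu> subspace_T] \<tau>_closed \<mu>_\<tau> bounded_linear_onD(1)[OF \<mu>])
qed

lemma \<pi>_\<tau>:
  assumes "a \<in> topspace E" "b \<in> topspace E"
  shows "\<pi> (\<tau> a b) = lact (\<Omega> 1) a (d b)"
  using assms one
  by (simp add: \<pi>_def act_one_forms d_one_def bounded_linear_on_diff[OF lact_T subspace_T] \<tau>_closed act_\<tau> \<mu>_\<tau>)

lemma \<pi>_W1: "t \<in> topspace (W 1) \<Longrightarrow> \<pi> t = t"
  using bounded_linear_on_zero[OF bounded_bilinear_map_left[OF lE \<tau>_bilinear one(1)] subspace_E]
  by (simp add: \<pi>_def topspace_W1)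

end

section \<open>Tuples\<close>

text \<open>Lists are taken apart at the end throughout, as the forms are bracketed to the left and
  \<open>d_power\<close> splits off the last argument.\<close>

lemma tuples_snoc [simp]:
  "xs @ [b] \<in> tuples E (Suc n) \<longleftrightarrow> xs \<in> tuples E n \<and> b \<in> topspace E"
  by (auto simp: tuples_def)

lemma tuples_SucE:
  assumes "xs \<in> tuples E (Suc n)"
  obtains ys b where "xs = ys @ [b]" "ys \<in> tuples E n" "b \<in> topspace E"
  using assms by (cases xs rule: rev_cases) (auto simp: tuples_def)

lemma tuples_update:
  "xs \<in> tuples E n \<Longrightarrow> x \<in> topspace E \<Longrightarrow> xs[i := x] \<in> tuples E n"
  by (auto simp: tuples_def dest: set_update_subset_insert[THEN subsetD])

lemma bounded_tuples_SucD:
  assumes "bounded_tuples E (Suc n) S"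
  shows "bounded_tuples E n (butlast ` S)" "bounded_in E (last ` S)"
proof -
  have S: "xs \<in> tuples E (Suc n)" if "xs \<in> S" for xs using assms that by (auto simp: bounded_tuples_def)
  have "(\<lambda>xs. xs ! i) ` butlast ` S = (\<lambda>xs. xs ! i) ` S" if "i < n" for i
    unfolding image_image using S that by (intro image_cong) (auto simp: tuples_def nth_butlast)
  moreover have "butlast ` S \<subseteq> tuples E n"
    using S by (auto simp: tuples_def dest: in_set_butlastD)
  ultimately show "bounded_tuples E n (butlast ` S)"
    using assms by (auto simp: bounded_tuples_def)
  have "last ` S = (\<lambda>xs. xs ! n) ` S"
    using S by (intro image_cong) (auto simp: tuples_def last_conv_nth simp flip: length_greater_0_conv)
  then show "bounded_in E (last ` S)" using assms by (auto simp: bounded_tuples_def)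
qed

lemma bounded_tuples_snoc:
  assumes S: "bounded_tuples E n S" and B: "bounded_in E B"
  shows "bounded_tuples E (Suc n) ((\<lambda>(xs, b). xs @ [b]) ` (S \<times> B))"
  unfolding bounded_tuples_def
proof (intro conjI allI impI)
  have ST: "S \<subseteq> tuples E n" using S by (simp add: bounded_tuples_def)
  show "(\<lambda>(xs, b). xs @ [b]) ` (S \<times> B) \<subseteq> tuples E (Suc n)"
    using ST bounded_in_topspace[OF B] by auto
  fix i assume "i < Suc n"
  show "bounded_in E ((\<lambda>xs. xs ! i) ` (\<lambda>(xs, b). xs @ [b]) ` (S \<times> B))"
  proof (cases "i = n")
    case True
    show ?thesis by (rule bounded_in_subset[OF B]) (use True ST in \<open>auto simp: tuples_def nth_append\<close>)
  next
    case False
    then have i: "i < n" using \<open>i < Suc n\<close> by simp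
    then have "bounded_in E ((\<lambda>xs. xs ! i) ` S)" using S by (simp add: bounded_tuples_def)
    then show ?thesis
      by (rule bounded_in_subset) (use i ST in \<open>auto simp: tuples_def nth_append\<close>)
  qed
qed

lemma bounded_tuples_single:
  assumes "bounded_in E B"
  shows "bounded_tuples E 1 ((\<lambda>b. [b]) ` B)"
  using assms bounded_in_topspace[OF assms] by (auto simp: bounded_tuples_def tuples_def image_image)

lemma bounded_linear_on_sum:
  assumes f: "bounded_linear_on E F f" and E: "subspace (topspace E)"
    and v: "\<And>i. i \<in> I \<Longrightarrow> v i \<in> topspace E"
  shows "f (\<Sum>i\<in>I. c i *\<^sub>R v i) = (\<Sum>i\<in>I. c i *\<^sub>R f (v i))"
  using v
proof (induction I rule: infinite_finite_induct)
  case (insert i I)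
  then have "(\<Sum>i\<in>I. c i *\<^sub>R v i) \<in> topspace E" using E by (auto intro: subspace_sum subspace_scale)
  then show ?case
    using insert E by (simp add: bounded_linear_onD(2,3)[OF f] subspace_scale)
qed (simp_all add: bounded_linear_on_zero[OF f E])


section \<open>Higher forms\<close>

context noncommutative_forms
begin

abbreviation d_tensor :: "nat \<Rightarrow> 'a list \<Rightarrow> 'w" where "d_tensor \<equiv> d_power A \<tau> \<theta>"

context
  fixes n :: nat
  assumes n: "n \<ge> 1"
begin

lemma tensor_over: "bimodule_tensor_over A (\<Omega> n) (\<Omega> 1) (\<Omega> (Suc n)) (\<theta> n)"
  using forms n unfolding differential_forms_def by blast

lemma universal_\<theta>:
  "universal_bilinear (W n) (W 1) (balanced_pairs A (\<Omega> n) (\<Omega> 1)) (W (Suc n)) (\<theta> n)"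
  using tensor_over by (simp add: bimodule_tensor_over_def tensor_product_over_def)

lemma \<theta>_bilinear: "bounded_bilinear_map (W n) (W 1) (W (Suc n)) (\<theta> n)"
  using universal_\<theta> by (simp add: universal_bilinear_def)

lemma \<theta>_balanced:
  assumes "m \<in> topspace (W n)" "a \<in> topspace E" "t \<in> topspace (W 1)"
  shows "\<theta> n (ract (\<Omega> n) m a) t = \<theta> n m (lact (\<Omega> 1) a t)"
  using universal_\<theta> assms by (simp add: universal_bilinear_def respects_balanced_pairs)

lemma act_\<theta>:
  assumes "a \<in> topspace E" "m \<in> topspace (W n)" "t \<in> topspace (W 1)"
  shows "lact (\<Omega> (Suc n)) a (\<theta> n m t) = \<theta> n (lact (\<Omega> n) a m) t"
    and "ract (\<Omega> (Suc n)) (\<theta> n m t) a = \<theta> n m (ract (\<Omega> 1) t a)"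
  using tensor_over assms by (auto simp: bimodule_tensor_over_def)

lemma bimodule_W: "convenient_bimodule A (\<Omega> n)"
proof (cases "n = 1")
  case False
  then obtain k where k: "n = Suc k" "k \<ge> 1" using n by (cases n) auto
  then have "bimodule_tensor_over A (\<Omega> k) (\<Omega> 1) (\<Omega> (Suc k)) (\<theta> k)"
    using forms unfolding differential_forms_def by blast
  then show ?thesis using k by (simp add: bimodule_tensor_over_def)
qed (simp add: bimodule_W1)

lemma convenient_W: "convenient_space (W n)"
  by (rule convenient_bimoduleD(1)[OF bimodule_W])

lemma lW: "locally_convex_space (W n)"
  and subspace_W: "subspace (topspace (W n))"
  by (rule convenient_spaceD[OF convenient_W])+

lemma lact_W: "a \<in> topspace E \<Longrightarrow> bounded_linear_on (W n) (W n) (lact (\<Omega> n) a)"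
  by (rule bounded_bilinear_map_right[OF lE convenient_bimoduleD(2)[OF bimodule_W]])

lemma ract_W: "a \<in> topspace E \<Longrightarrow> bounded_linear_on (W n) (W n) (\<lambda>m. ract (\<Omega> n) m a)"
  by (rule bounded_bilinear_map_left[OF lE convenient_bimoduleD(3)[OF bimodule_W]])

lemma \<theta>_left: "t \<in> topspace (W 1) \<Longrightarrow> bounded_linear_on (W n) (W (Suc n)) (\<lambda>m. \<theta> n m t)"
  by (rule bounded_bilinear_map_left[OF convenient_spaceD(1)[OF convenient_W1] \<theta>_bilinear])

lemma \<theta>_right: "m \<in> topspace (W n) \<Longrightarrow> bounded_linear_on (W 1) (W (Suc n)) (\<theta> n m)"
  by (rule bounded_bilinear_map_right[OF lW \<theta>_bilinear])

lemma d_tensor_snoc: "d_tensor (Suc n) (xs @ [b]) = \<theta> n (d_tensor n xs) (d b)"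
  using n by (cases n) simp_all

end

section \<open>Multilinearity, boundedness and normalization of \<open>d\<^sup>n\<close>\<close>

lemma d_tensor_single: "d_tensor 1 [a] = d a"
  by (simp add: One_nat_def)

lemma tuples_oneE:
  assumes "xs \<in> tuples E 1"
  obtains a where "xs = [a]" "a \<in> topspace E"
  using assms by (auto simp: One_nat_def tuples_def length_Suc_conv)

lemma d_tensor_closed:
  assumes "n \<ge> 1" "xs \<in> tuples E n"
  shows "d_tensor n xs \<in> topspace (W n)"
  using assms
proof (induction n arbitrary: xs rule: nat_induct_at_least)
  case base
  then show ?case by (auto elim!: tuples_oneE simp: d_tensor_single d_closed)
next
  case (Suc n)
  then show ?case
    by (auto elim!: tuples_SucE simp: d_tensor_snoc d_closed bounded_bilinear_mapD(1)[OF \<theta>_bilinear])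
qed

text \<open>In the induction, the last slot is linear because d and the second argument of
  \<open>\<theta> n\<close> are; the other slots use the first argument.\<close>

lemma d_tensor_update:
  assumes "n \<ge> 1" "xs \<in> tuples E n" "i < n" "x \<in> topspace E" "y \<in> topspace E"
  shows "d_tensor n (xs[i := x + y]) = d_tensor n (xs[i := x]) + d_tensor n (xs[i := y])" (is "?P n xs")
    and "d_tensor n (xs[i := r *\<^sub>R x]) = r *\<^sub>R d_tensor n (xs[i := x])" (is "?Q n xs")
proof -
  from assms(1-3) have "?P n xs \<and> ?Q n xs"
  proof (induction n arbitrary: xs rule: nat_induct_at_least)
    case base
    then show ?case
      using assms(4,5)
      by (auto elim!: tuples_oneE simp: d_tensor_single bounded_linear_onD(2,3)[OF d_bounded_linear])
  next
    case (Suc n)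
    obtain ys b where ys: "xs = ys @ [b]" "ys \<in> tuples E n" "b \<in> topspace E"
      using Suc.prems(1) by (rule tuples_SucE)
    have len: "length ys = n" using ys(2) by (simp add: tuples_def)
    note D = bounded_bilinear_mapD[OF \<theta>_bilinear[OF Suc.hyps]]
    show ?case
    proof (cases "i = n")
      case True
      then show ?thesis
        using ys len assms(4,5) Suc.hyps
        by (simp add: list_update_append d_tensor_snoc bounded_linear_onD(2,3)[OF d_bounded_linear]
            D d_tensor_closed d_closed)
    next
      case False
      then have i: "i < n" using Suc.prems(2) by simp
      have "ys[i := z] \<in> tuples E n" if "z \<in> topspace E" for z using ys(2) that by (rule tuples_update)
      then show ?thesis
        using ys len assms(4,5) Suc.hyps i Suc.IH[OF ys(2) i]
        by (simp add: list_update_append d_tensor_snoc D d_tensor_closed d_closed)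
    qed
  qed
  then show "?P n xs" "?Q n xs" by simp_all
qed

lemma d_tensor_bounded:
  assumes "n \<ge> 1" "bounded_tuples E n S"
  shows "bounded_in (W n) (d_tensor n ` S)"
  using assms
proof (induction n arbitrary: S rule: nat_induct_at_least)
  case base
  then have "bounded_in E ((\<lambda>xs. xs ! 0) ` S)" "S \<subseteq> tuples E 1" by (simp_all add: bounded_tuples_def One_nat_def)
  moreover from this have "d_tensor 1 ` S = d ` (\<lambda>xs. xs ! 0) ` S"
    unfolding image_image by (intro image_cong) (auto elim!: tuples_oneE simp: d_tensor_single)
  ultimately show ?case using bounded_linear_onD(4)[OF d_bounded_linear] by simp
next
  case (Suc n)
  note S = bounded_tuples_SucD[OF Suc.prems]
  have "S \<subseteq> tuples E (Suc n)" using Suc.prems by (simp add: bounded_tuples_def)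
  then have eq: "d_tensor (Suc n) xs = \<theta> n (d_tensor n (butlast xs)) (d (last xs))" if "xs \<in> S" for xs
    using that Suc.hyps by (auto elim!: tuples_SucE simp: d_tensor_snoc)
  have "bounded_in (W (Suc n)) {\<theta> n x y |x y. x \<in> d_tensor n ` butlast ` S \<and> y \<in> d ` last ` S}"
    by (rule bounded_bilinear_mapD(6)[OF \<theta>_bilinear[OF Suc.hyps] Suc.IH[OF S(1)]
        bounded_linear_onD(4)[OF d_bounded_linear S(2)]])
  then show ?case by (rule bounded_in_subset) (use eq in fastforce)
qed

lemma d_tensor_normalized:
  assumes "n \<ge> 1" "xs \<in> tuples E n" "i < n" "xs ! i = r *\<^sub>R one"
  shows "d_tensor n xs = 0"
  using assms
proof (induction n arbitrary: xs rule: nat_induct_at_least)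
  case base
  then show ?case
    using one(1) by (auto elim!: tuples_oneE simp: d_tensor_single bounded_linear_onD(3)[OF d_bounded_linear] d_one)
next
  case (Suc n)
  obtain ys b where ys: "xs = ys @ [b]" "ys \<in> tuples E n" "b \<in> topspace E"
    using Suc.prems(1) by (rule tuples_SucE)
  have len: "length ys = n" using ys(2) by (simp add: tuples_def)
  show ?case
  proof (cases "i = n")
    case True
    then have "d b = 0"
      using ys len Suc.prems one(1) by (simp add: nth_append bounded_linear_onD(3)[OF d_bounded_linear] d_one)
    then show ?thesis
      using ys Suc.hyps bounded_linear_on_zero[OF \<theta>_right convenient_spaceD(2)[OF convenient_W1]]
      by (simp add: d_tensor_snoc d_tensor_closed)
  next
    case False
    then have "d_tensor n ys = 0" using Suc ys len by (auto simp: nth_append)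
    then show ?thesis
      using ys Suc.hyps bounded_linear_on_zero[OF \<theta>_left subspace_W] by (simp add: d_tensor_snoc d_closed)
  qed
qed

section \<open>The coboundary of \<open>d\<^sup>n\<close>\<close>

abbreviation contract :: "nat \<Rightarrow> 'a list \<Rightarrow> 'a list" where
  "contract i xs \<equiv> take (i - 1) xs @ [xs ! (i - 1) \<cdot> xs ! i] @ drop (i + 1) xs"

lemma contract_tuples:
  assumes "xs \<in> tuples E (Suc n)" "i \<in> {1..n}"
  shows "contract i xs \<in> tuples E n"
proof -
  have "length xs = Suc n" "set xs \<subseteq> topspace E" using assms(1) by (auto simp: tuples_def)
  moreover from this have "xs ! (i - 1) \<in> topspace E" "xs ! i \<in> topspace E"
    using assms(2) by (auto intro!: nth_mem[THEN subsetD[rotated]] simp: One_nat_def)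
  ultimately show ?thesis
    using assms(2) by (auto simp: tuples_def mult_closed dest: in_set_takeD in_set_dropD)
qed

lemma tl_tuples: "xs \<in> tuples E (Suc n) \<Longrightarrow> tl xs \<in> tuples E n"
  by (auto simp: tuples_def dest: list.set_sel(2)[rotated])

lemma hd_tuples: "xs \<in> tuples E (Suc n) \<Longrightarrow> hd xs \<in> topspace E"
  by (cases xs) (auto simp: tuples_def)

text \<open>
  By the induction hypothesis all but the last two terms add up to
  \<open>(-1)\<^sup>n da\<^sub>1 \<otimes> \<cdots> \<otimes> da\<^sub>n a\<^sub>n\<^sub>+\<^sub>1 \<otimes> da\<^sub>n\<^sub>+\<^sub>2\<close>, and \<open>a\<^sub>n\<^sub>+\<^sub>1\<close> moves across the tensor product.
\<close>

lemma hochschild_coboundary_d_tensor: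
  assumes "n \<ge> 1" "xs \<in> tuples E (Suc n)"
  shows "hochschild_coboundary A (\<Omega> n) n (d_tensor n) xs = 0"
  using assms
proof (induction n arbitrary: xs rule: nat_induct_at_least)
  case base
  then obtain ys b where "xs = ys @ [b]" "ys \<in> tuples E 1" "b \<in> topspace E" by (rule tuples_SucE)
  then obtain a where "xs = [a, b]" "a \<in> topspace E" "b \<in> topspace E" by (auto elim: tuples_oneE)
  \<comment> \<open>In degree one the claim is the Leibniz rule.\<close>
  then show ?case
    by (simp add: hochschild_coboundary_def d_tensor_single d_mult)
next
  case (Suc n)
  obtain ys b where ys: "xs = ys @ [b]" "ys \<in> tuples E (Suc n)" "b \<in> topspace E"
    using Suc.prems by (rule tuples_SucE)
  obtain zs a where zs: "ys = zs @ [a]" "zs \<in> tuples E n" "a \<in> topspace E"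
    using ys(2) by (rule tuples_SucE)
  have len: "length ys = Suc n" "length zs = n" using ys(2) zs(2) by (auto simp: tuples_def)
  note n = Suc.hyps
  note closed = d_closed[OF ys(3)] d_tensor_closed[OF n zs(2)]
  let ?\<theta> = "\<lambda>m. \<theta> n m (d b)"
  note lin = \<theta>_left[OF n closed(1)]
  have mem: "lact (\<Omega> n) (hd ys) (d_tensor n (tl ys)) \<in> topspace (W n)"
    "(\<Sum>i = 1..n. (-1) ^ i *\<^sub>R d_tensor n (contract i ys)) \<in> topspace (W n)"
    "ract (\<Omega> n) (d_tensor n zs) a \<in> topspace (W n)"
    using bounded_linear_onD(1)[OF lact_W[OF n]] bounded_linear_onD(1)[OF ract_W[OF n]] zs(3) closed(2)
      d_tensor_closed[OF n] tl_tuples[OF ys(2)] hd_tuples[OF ys(2)] contract_tuples[OF ys(2)] subspace_W[OF n]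
    by (auto intro!: subspace_sum subspace_scale)
  have sum: "?\<theta> (\<Sum>i = 1..n. (-1) ^ i *\<^sub>R d_tensor n (contract i ys)) =
      (\<Sum>i = 1..n. (-1) ^ i *\<^sub>R ?\<theta> (d_tensor n (contract i ys)))"
    by (rule bounded_linear_on_sum[OF lin subspace_W[OF n]])
      (rule d_tensor_closed[OF n contract_tuples[OF ys(2)]])
  have "lact (\<Omega> n) (hd ys) (d_tensor n (tl ys)) + (\<Sum>i = 1..n. (-1) ^ i *\<^sub>R d_tensor n (contract i ys))
      + (-1) ^ (n + 1) *\<^sub>R ract (\<Omega> n) (d_tensor n zs) a = 0"
    using Suc.IH[OF ys(2)] zs(1) by (simp add: hochschild_coboundary_def)
  \<comment> \<open>The identity of degree n is tensored with db on the right.\<close>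
  then have "?\<theta> (lact (\<Omega> n) (hd ys) (d_tensor n (tl ys)) + (\<Sum>i = 1..n. (-1) ^ i *\<^sub>R d_tensor n (contract i ys))
      + (-1) ^ (n + 1) *\<^sub>R ract (\<Omega> n) (d_tensor n zs) a) = 0"
    using bounded_linear_on_zero[OF lin subspace_W[OF n]] by simp
  then have "?\<theta> (lact (\<Omega> n) (hd ys) (d_tensor n (tl ys))) + (\<Sum>i = 1..n. (-1) ^ i *\<^sub>R ?\<theta> (d_tensor n (contract i ys)))
      + (-1) ^ (n + 1) *\<^sub>R ?\<theta> (ract (\<Omega> n) (d_tensor n zs) a) = 0"
    using mem subspace_W[OF n] sum
    by (simp add: bounded_linear_onD(2,3)[OF lin] subspace_add subspace_scale)
  moreover have "d_tensor (Suc n) (tl ys @ [b]) = ?\<theta> (d_tensor n (tl ys))"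
    by (rule d_tensor_snoc[OF n])
  then have "lact (\<Omega> (Suc n)) (hd xs) (d_tensor (Suc n) (tl xs)) = ?\<theta> (lact (\<Omega> n) (hd ys) (d_tensor n (tl ys)))"
    using ys(1) len(1) hd_tuples[OF ys(2)] d_tensor_closed[OF n tl_tuples[OF ys(2)]] closed(1)
    by (cases ys) (auto simp: act_\<theta>[OF n])
  moreover have "d_tensor (Suc n) (contract i xs) = ?\<theta> (d_tensor n (contract i ys))" if "i \<in> {1..n}" for i
  proof -
    have "contract i xs = contract i ys @ [b]" using that len by (auto simp: ys(1) nth_append)
    then show ?thesis by (simp only: d_tensor_snoc[OF n])
  qed
  then have "(\<Sum>i = 1..n. (-1) ^ i *\<^sub>R d_tensor (Suc n) (contract i xs)) =
      (\<Sum>i = 1..n. (-1) ^ i *\<^sub>R ?\<theta> (d_tensor n (contract i ys)))" by (intro sum.cong) auto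
  \<comment> \<open>By the Leibniz rule for d (a \<cdot> b) this new term splits in two. One part,
    after balancing, is the last term of the identity of degree n tensored with db; the other
    cancels the right action of b, which has the opposite sign.\<close>
  moreover have "contract (Suc n) xs = zs @ [a \<cdot> b]"
    using len by (simp add: ys(1) zs(1) nth_append)
  then have "d_tensor (Suc n) (contract (Suc n) xs) =
      ?\<theta> (ract (\<Omega> n) (d_tensor n zs) a) + ract (\<Omega> (Suc n)) (d_tensor (Suc n) (butlast xs)) (last xs)"
    using ys zs closed n d_closed[OF zs(3)] bounded_linear_onD(1)[OF lact_W[OF order_refl]]
      bounded_linear_onD(1)[OF ract_W[OF order_refl]]
    by (simp only: d_tensor_snoc d_mult \<theta>_balanced act_\<theta> bounded_linear_onD(2)[OF \<theta>_right] butlast_snoc last_snoc)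
  ultimately show ?case
    by (simp add: hochschild_coboundary_def power_add algebra_simps)
qed

end

section \<open>Left linear maps on forms and normalized cochains\<close>

definition bounded_left_linear ::
  "'a::real_vector algebra_data \<Rightarrow> ('a, 'm::real_vector) bimodule_data \<Rightarrow>
     ('a, 'n::real_vector) bimodule_data \<Rightarrow> ('m \<Rightarrow> 'n) \<Rightarrow> bool" where
  "bounded_left_linear A M N \<phi> \<longleftrightarrow>
     bounded_linear_on (mod_space M) (mod_space N) \<phi> \<and>
     (\<forall>a\<in>topspace (alg_space A). \<forall>m\<in>topspace (mod_space M). \<phi> (lact M a m) = lact N a (\<phi> m))"

lemma bounded_left_linearD:
  assumes "bounded_left_linear A M N \<phi>"
  shows "bounded_linear_on (mod_space M) (mod_space N) \<phi>"
    and "a \<in> topspace (alg_space A) \<Longrightarrow> m \<in> topspace (mod_space M) \<Longrightarrow> \<phi> (lact M a m) = lact N a (\<phi> m)"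
  using assms by (auto simp: bounded_left_linear_def)

lemma bounded_left_linear_lincomb:
  assumes N: "convenient_bimodule A N"
    and \<phi>: "bounded_left_linear A M N \<phi>" and \<psi>: "bounded_left_linear A M N \<psi>"
  shows "bounded_left_linear A M N (\<lambda>m. \<phi> m + c *\<^sub>R \<psi> m)"
proof -
  note lN = convenient_spaceD[OF convenient_bimoduleD(1)[OF N]]
  note D = bounded_bilinear_mapD[OF convenient_bimoduleD(2)[OF N]]
  show ?thesis
    unfolding bounded_left_linear_def
    using bounded_linear_on_lincomb[OF lN(1) bounded_left_linearD(1)[OF \<phi>] bounded_left_linearD(1)[OF \<psi>]]
      bounded_linear_onD(1)[OF bounded_left_linearD(1)[OF \<phi>]] bounded_linear_onD(1)[OF bounded_left_linearD(1)[OF \<psi>]]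
      bounded_left_linearD(2)[OF \<phi>] bounded_left_linearD(2)[OF \<psi>] lN(2)
    by (simp add: D subspace_scale)
qed

definition normalized_cochains ::
  "'a::real_vector algebra_data \<Rightarrow> ('a, 'm::real_vector) bimodule_data \<Rightarrow> nat \<Rightarrow> ('a list \<Rightarrow> 'm) set" where
  "normalized_cochains A M n =
     {c \<in> bounded_multilinear_maps (alg_space A) n (mod_space M). normalized_cochain A n c}"

lemma normalized_cochainsD:
  assumes "c \<in> normalized_cochains A M n"
  shows "xs \<in> tuples (alg_space A) n \<Longrightarrow> c xs \<in> topspace (mod_space M)"
    and "xs \<in> tuples (alg_space A) n \<Longrightarrow> i < n \<Longrightarrow> x \<in> topspace (alg_space A) \<Longrightarrow> y \<in> topspace (alg_space A) \<Longrightarrow>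
      c (xs[i := x + y]) = c (xs[i := x]) + c (xs[i := y])"
    and "xs \<in> tuples (alg_space A) n \<Longrightarrow> i < n \<Longrightarrow> x \<in> topspace (alg_space A) \<Longrightarrow>
      c (xs[i := r *\<^sub>R x]) = r *\<^sub>R c (xs[i := x])"
    and "bounded_tuples (alg_space A) n S \<Longrightarrow> bounded_in (mod_space M) (c ` S)"
    and "xs \<in> tuples (alg_space A) n \<Longrightarrow> i < n \<Longrightarrow> xs ! i = r *\<^sub>R alg_one A \<Longrightarrow> c xs = 0"
  using assms by (auto simp: normalized_cochains_def bounded_multilinear_maps_def normalized_cochain_def)

lemma normalized_cochains_last:
  assumes c: "c \<in> normalized_cochains A M (Suc n)" and xs: "xs \<in> tuples (alg_space A) n"
    and x: "x \<in> topspace (alg_space A)" and y: "y \<in> topspace (alg_space A)"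
  shows "c (xs @ [x + y]) = c (xs @ [x]) + c (xs @ [y])"
    and "c (xs @ [r *\<^sub>R x]) = r *\<^sub>R c (xs @ [x])"
proof -
  have "length xs = n" "xs @ [x] \<in> tuples (alg_space A) (Suc n)"
    using xs x by (auto simp: tuples_def)
  then show "c (xs @ [x + y]) = c (xs @ [x]) + c (xs @ [y])" "c (xs @ [r *\<^sub>R x]) = r *\<^sub>R c (xs @ [x])"
    using normalized_cochainsD(2)[OF c, of "xs @ [x]" n x y] normalized_cochainsD(3)[OF c, of "xs @ [x]" n x r] x y
    by (auto simp: list_update_append)
qed

lemma normalized_cochains_slice:
  assumes c: "c \<in> normalized_cochains A M (Suc n)" and b: "b \<in> topspace (alg_space A)"
    and E: "locally_convex_space (alg_space A)"
  shows "restrict (\<lambda>xs. c (xs @ [b])) (tuples (alg_space A) n) \<in> normalized_cochains A M n" (is "?c \<in> _")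
proof -
  let ?E = "alg_space A"
  have upd: "xs[i := x] @ [b] = (xs @ [b])[i := x]" if "xs \<in> tuples ?E n" "i < n" for xs i x
    using that by (simp add: tuples_def list_update_append)
  have "?c \<in> bounded_multilinear_maps ?E n (mod_space M)"
    unfolding bounded_multilinear_maps_def
  proof (intro CollectI conjI ballI allI impI)
    show "?c \<in> tuples ?E n \<rightarrow>\<^sub>E topspace (mod_space M)"
      using normalized_cochainsD(1)[OF c] b by auto
  next
    fix xs i x y assume *: "xs \<in> tuples ?E n" "i < n" "x \<in> topspace ?E" "y \<in> topspace ?E"
    moreover from * have "x + y \<in> topspace ?E" using E by (auto simp: locally_convex_space_def subspace_add)
    ultimately show "?c (xs[i := x + y]) = ?c (xs[i := x]) + ?c (xs[i := y])"
      using normalized_cochainsD(2)[OF c, of "xs @ [b]" i x y] b by (simp add: tuples_update upd)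
  next
    fix xs i r x assume *: "xs \<in> tuples ?E n" "i < n" "x \<in> topspace ?E"
    moreover from * have "r *\<^sub>R x \<in> topspace ?E" using E by (auto simp: locally_convex_space_def subspace_scale)
    ultimately show "?c (xs[i := r *\<^sub>R x]) = r *\<^sub>R ?c (xs[i := x])"
      using normalized_cochainsD(3)[OF c, of "xs @ [b]" i x r] b by (simp add: tuples_update upd)
  next
    fix S assume S: "bounded_tuples ?E n S"
    from normalized_cochainsD(4)[OF c bounded_tuples_snoc[OF S bounded_in_singleton[OF E b]]]
    show "bounded_in (mod_space M) (?c ` S)"
      by (rule bounded_in_subset) (use S in \<open>force simp: bounded_tuples_def\<close>)
  qed
  moreover have "normalized_cochain A n ?c"
    unfolding normalized_cochain_def
  proof (intro ballI impI)
    fix xs assume xs: "xs \<in> tuples ?E n" and "\<exists>i<n. \<exists>r. xs ! i = r *\<^sub>R alg_one A"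
    then obtain i r where "i < n" "xs ! i = r *\<^sub>R alg_one A" by blast
    then have "c (xs @ [b]) = 0"
      using normalized_cochainsD(5)[OF c, of "xs @ [b]" i r] xs b by (auto simp: tuples_def nth_append)
    then show "?c xs = 0" using xs by simp
  qed
  ultimately show ?thesis by (simp add: normalized_cochains_def)
qed

context noncommutative_forms
begin

lemmas T_ext = universal_bilinear_ext[OF universal_T]
lemmas T_equibounded = universal_bilinear_equibounded[OF universal_T _ _ _ lE lE]

context
  fixes M :: "('a, 'm::real_vector) bimodule_data"
  assumes M: "convenient_bimodule A M"
begin


private lemmas cM = convenient_bimoduleD(1)[OF M]
private lemmas lM = convenient_spaceD(1)[OF cM]
private lemmas subspace_M = convenient_spaceD(2)[OF cM]
private lemmas lact_M = bounded_bilinear_mapD[OF convenient_bimoduleD(2)[OF M]]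
private lemmas lact_M_linear = bounded_bilinear_map_right[OF lE convenient_bimoduleD(2)[OF M]]

text \<open>
  Precomposing with the projection \<open>\<pi>\<close> turns maps on \<open>\<Omega> 1\<close> into maps on the tensor square, where
  equiboundedness can be tested on the elements \<open>\<tau> a b\<close>, which \<open>\<pi>\<close> sends to \<open>a db\<close>.
\<close>

lemma left_linear_equibounded:
  assumes "n \<ge> 1" and "\<And>\<phi>. \<phi> \<in> H \<Longrightarrow> bounded_left_linear A (\<Omega> n) M \<phi>"
    and "\<And>S. bounded_tuples E n S \<Longrightarrow> bounded_in (mod_space M) (\<Union>\<phi>\<in>H. (\<lambda>xs. \<phi> (d_tensor n xs)) ` S)"
  shows "equibounded (W n) (mod_space M) H"
  using assms
proof (induction n arbitrary: H rule: nat_induct_at_least)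
  case base
  note lin = bounded_left_linearD[OF base(1)]
  have "equibounded (mod_space T) (mod_space M) ((\<lambda>\<phi> t. \<phi> (\<pi> t)) ` H)"
  proof (rule T_equibounded[OF cM])
    show "bounded_linear_on (mod_space T) (mod_space M) h" if "h \<in> (\<lambda>\<phi> t. \<phi> (\<pi> t)) ` H" for h
      using that lin(1) by (auto intro: bounded_linear_on_comp[OF \<pi>_bounded_linear])
    fix B C assume B: "bounded_in E B" and C: "bounded_in E C"
    let ?Y = "\<Union>\<phi>\<in>H. (\<lambda>xs. \<phi> (d_tensor 1 xs)) ` (\<lambda>b. [b]) ` C"
    \<comment> \<open>The value on \<open>\<tau> a b\<close> is a acting on \<phi> (d b), and the
      hypothesis for tuples of length one bounds the second factor over the whole family.\<close>
    from lact_M(6)[OF B base(2)[OF bounded_tuples_single[OF C]]]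
    show "bounded_in (mod_space M) {h (\<tau> x y) |h x y. h \<in> (\<lambda>\<phi> t. \<phi> (\<pi> t)) ` H \<and> x \<in> B \<and> y \<in> C}"
    proof (rule bounded_in_subset, clarify)
      fix \<phi> a b assume *: "\<phi> \<in> H" "a \<in> B" "b \<in> C"
      then have "a \<in> topspace E" "b \<in> topspace E" using B C bounded_in_topspace by blast+
      then have "\<phi> (\<pi> (\<tau> a b)) = lact M a (\<phi> (d b))"
        using lin(2)[OF *(1)] by (simp add: \<pi>_\<tau> d_closed)
      moreover have "\<phi> (d_tensor 1 [b]) \<in> ?Y" using *(1,3) by blast
      then have "\<phi> (d b) \<in> ?Y" by (simp only: d_tensor_single)
      ultimately show "\<exists>x y. \<phi> (\<pi> (\<tau> a b)) = lact M x y \<and> x \<in> B \<and> y \<in> ?Y" using *(2) by (intro exI conjI)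
    qed
  qed
  \<comment> \<open>A bounded set of one-forms is bounded in the tensor square and fixed pointwise
    by \<pi>, so the bound obtained there is the desired one.\<close>
  then have "bounded_in (mod_space M) (\<Union>h\<in>(\<lambda>\<phi> t. \<phi> (\<pi> t)) ` H. h ` D)" if "bounded_in (W 1) D" for D
    using that by (simp add: equibounded_def bounded_in_W1)
  moreover have "(\<Union>h\<in>(\<lambda>\<phi> t. \<phi> (\<pi> t)) ` H. h ` D) = (\<Union>\<phi>\<in>H. \<phi> ` D)" if "bounded_in (W 1) D" for D
  proof -
    have "\<pi> t = t" if "t \<in> D" for t using \<pi>_W1 that bounded_in_topspace[OF \<open>bounded_in (W 1) D\<close>] by blast
    then show ?thesis by simp
  qed
  ultimately show ?case by (simp add: equibounded_def)
next
  case (Suc n)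
  note n = Suc.hyps
  note lin = bounded_left_linearD[OF Suc.prems(1)]
  show ?case
  proof (rule universal_bilinear_equibounded[OF universal_\<theta>[OF n] cM lin(1) _ lW[OF n]
        convenient_spaceD(1)[OF convenient_W1]])
    fix B C assume B: "bounded_in (W n) B" and C: "bounded_in (W 1) C"
    have BW: "\<omega> \<in> topspace (W n)" if "\<omega> \<in> B" for \<omega> using B that bounded_in_topspace by blast
    \<comment> \<open>Here a form \<omega> from B is frozen and the second tensor factor varies,
      extended to the tensor square by \<pi>.\<close>
    define K where "K = {\<lambda>t. \<phi> (\<theta> n \<omega> (\<pi> t)) |\<phi> \<omega>. \<phi> \<in> H \<and> \<omega> \<in> B}"
    have "equibounded (mod_space T) (mod_space M) K"
    proof (rule T_equibounded[OF cM])
      show "bounded_linear_on (mod_space T) (mod_space M) k" if "k \<in> K" for k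
        using that lin(1) BW unfolding K_def
        by (auto intro: bounded_linear_on_comp bounded_linear_on_comp[OF bounded_linear_on_comp[OF \<pi>_bounded_linear \<theta>_right[OF n]]])
      fix A' B' assume A': "bounded_in E A'" and B': "bounded_in E B'"
      have A'E: "a \<in> topspace E" if "a \<in> A'" for a using A' that bounded_in_topspace by blast
      have B'E: "b \<in> topspace E" if "b \<in> B'" for b using B' that bounded_in_topspace by blast
      \<comment> \<open>Now db is frozen and the first factor varies. The left action concerns the
        first factor only, so these maps are left linear and the induction hypothesis applies to
        them.\<close>
      define L where "L = {\<lambda>\<omega>. \<phi> (\<theta> n \<omega> (d b)) |\<phi> b. \<phi> \<in> H \<and> b \<in> B'}"
      have "equibounded (W n) (mod_space M) L"
      proof (rule Suc.IH)
        fix l assume "l \<in> L"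
        then obtain \<phi> b where l: "l = (\<lambda>\<omega>. \<phi> (\<theta> n \<omega> (d b)))" "\<phi> \<in> H" "b \<in> B'" by (auto simp: L_def)
        show "bounded_left_linear A (\<Omega> n) M l"
          unfolding bounded_left_linear_def l(1)
          using bounded_linear_on_comp[OF \<theta>_left[OF n d_closed[OF B'E[OF l(3)]]] lin(1)[OF l(2)]]
            lin(2)[OF l(2)] act_\<theta>(1)[OF n] d_closed[OF B'E[OF l(3)]] bounded_bilinear_mapD(1)[OF \<theta>_bilinear[OF n]]
          by metis
      next
        fix S assume S: "bounded_tuples E n S"
        from Suc.prems(2)[OF bounded_tuples_snoc[OF S B']]
        show "bounded_in (mod_space M) (\<Union>l\<in>L. (\<lambda>xs. l (d_tensor n xs)) ` S)"
        proof (rule bounded_in_subset, clarify)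
          fix l xs assume l: "l \<in> L" and xs: "xs \<in> S"
          obtain \<phi> b where \<phi>: "l = (\<lambda>\<omega>. \<phi> (\<theta> n \<omega> (d b)))" "\<phi> \<in> H" "b \<in> B'"
            using l unfolding L_def by blast
          then have "l (d_tensor n xs) = \<phi> (d_tensor (Suc n) (xs @ [b]))" by (simp add: d_tensor_snoc[OF n])
          moreover have "xs @ [b] \<in> (\<lambda>(xs, b). xs @ [b]) ` (S \<times> B')" using xs \<phi>(3) by auto
          ultimately show "l (d_tensor n xs) \<in> (\<Union>\<phi>\<in>H. (\<lambda>xs. \<phi> (d_tensor (Suc n) xs)) ` (\<lambda>(xs, b). xs @ [b]) ` (S \<times> B'))"
            using \<phi>(2) by (intro UN_I[OF \<phi>(2)]) (rule image_eqI)
        qed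
      qed
      moreover have "bounded_in (W n) {ract (\<Omega> n) \<omega> a |\<omega> a. \<omega> \<in> B \<and> a \<in> A'}"
        by (rule bounded_bilinear_mapD(6)[OF convenient_bimoduleD(3)[OF bimodule_W[OF n]] B A'])
      ultimately have "bounded_in (mod_space M) (\<Union>l\<in>L. l ` {ract (\<Omega> n) \<omega> a |\<omega> a. \<omega> \<in> B \<and> a \<in> A'})"
        by (simp add: equibounded_def)
      then show "bounded_in (mod_space M) {h (\<tau> x y) |h x y. h \<in> K \<and> x \<in> A' \<and> y \<in> B'}"
      proof (rule bounded_in_subset, clarify)
        fix k a b assume *: "k \<in> K" "a \<in> A'" "b \<in> B'"
        then obtain \<phi> \<omega> where k: "k = (\<lambda>t. \<phi> (\<theta> n \<omega> (\<pi> t)))" "\<phi> \<in> H" "\<omega> \<in> B" by (auto simp: K_def)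
        \<comment> \<open>Balancing moves a from a db to \<omega>; a value of a member of K becomes
          a value of a member of L at \<omega>a, and these forms make up a bounded set.\<close>
        have "k (\<tau> a b) = \<phi> (\<theta> n (ract (\<Omega> n) \<omega> a) (d b))"
          using * k(3) A'E B'E BW by (simp add: k(1) \<pi>_\<tau> \<theta>_balanced[OF n] d_closed)
        moreover have "(\<lambda>\<omega>. \<phi> (\<theta> n \<omega> (d b))) \<in> L" using k(2) *(3) by (auto simp: L_def)
        ultimately show "k (\<tau> a b) \<in> (\<Union>l\<in>L. l ` {ract (\<Omega> n) \<omega> a |\<omega> a. \<omega> \<in> B \<and> a \<in> A'})"
          using k(3) *(2) by (intro UN_I[of "\<lambda>\<omega>. \<phi> (\<theta> n \<omega> (d b))"]) auto
      qed
    qed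
    then have "bounded_in (mod_space M) (\<Union>k\<in>K. k ` C)" using C by (simp add: equibounded_def bounded_in_W1)
    then show "bounded_in (mod_space M) {h (\<theta> n x y) |h x y. h \<in> H \<and> x \<in> B \<and> y \<in> C}"
    proof (rule bounded_in_subset, clarify)
      fix \<phi> \<omega> t assume *: "\<phi> \<in> H" "\<omega> \<in> B" "t \<in> C"
      then have "\<pi> t = t" using \<pi>_W1 bounded_in_topspace[OF C] by blast
      then have "\<phi> (\<theta> n \<omega> t) \<in> (\<lambda>t. \<phi> (\<theta> n \<omega> (\<pi> t))) ` C" using *(3) by (metis imageI)
      moreover have "(\<lambda>t. \<phi> (\<theta> n \<omega> (\<pi> t))) \<in> K" using * by (auto simp: K_def)
      ultimately show "\<phi> (\<theta> n \<omega> t) \<in> (\<Union>k\<in>K. k ` C)" by blast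
    qed
  qed
qed

text \<open>The multiples of a map that vanishes on all \<open>da\<^sub>1 \<otimes> \<cdots> \<otimes> da\<^sub>n\<close> are equibounded.\<close>

lemma left_linear_ext:
  assumes n: "n \<ge> 1" and \<phi>: "bounded_left_linear A (\<Omega> n) M \<phi>" and \<psi>: "bounded_left_linear A (\<Omega> n) M \<psi>"
    and eq: "\<And>xs. xs \<in> tuples E n \<Longrightarrow> \<phi> (d_tensor n xs) = \<psi> (d_tensor n xs)"
    and \<omega>: "\<omega> \<in> topspace (W n)"
  shows "\<phi> \<omega> = \<psi> \<omega>"
proof -
  let ?\<chi> = "\<lambda>\<omega>. \<phi> \<omega> + (-1) *\<^sub>R \<psi> \<omega>"
  note comb = bounded_left_linear_lincomb[OF M]
  \<comment> \<open>These are the multiples (1 + r) \<chi>, written in the form that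
    \<open>bounded_left_linear_lincomb\<close> covers. On \<open>d_tensor\<close> they vanish, so
    {0} is a bound there.\<close>
  define H where "H = range (\<lambda>r \<omega>. ?\<chi> \<omega> + r *\<^sub>R ?\<chi> \<omega>)"
  have "equibounded (W n) (mod_space M) H"
  proof (rule left_linear_equibounded[OF n])
    show "bounded_left_linear A (\<Omega> n) M h" if "h \<in> H" for h
      using that comb[OF comb[OF \<phi> \<psi>] comb[OF \<phi> \<psi>]] unfolding H_def by blast
    fix S assume "bounded_tuples E n S"
    then have "xs \<in> tuples E n" if "xs \<in> S" for xs using that by (auto simp: bounded_tuples_def)
    moreover have "bounded_in (mod_space M) {0}" by (rule bounded_in_singleton[OF lM subspace_0[OF subspace_M]])
    ultimately show "bounded_in (mod_space M) (\<Union>h\<in>H. (\<lambda>xs. h (d_tensor n xs)) ` S)"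
      by (elim bounded_in_subset) (auto simp: H_def eq)
  qed
  then have *: "bounded_in (mod_space M) (\<Union>h\<in>H. h ` {\<omega>})"
    using bounded_in_singleton[OF lW[OF n] \<omega>] unfolding equibounded_def by blast
  have "r *\<^sub>R ?\<chi> \<omega> \<in> (\<Union>h\<in>H. h ` {\<omega>})" for r
  proof -
    have "r *\<^sub>R ?\<chi> \<omega> = ?\<chi> \<omega> + (r - 1) *\<^sub>R ?\<chi> \<omega>" by (simp only: scaleR_diff_left) simp
    then show ?thesis unfolding H_def by blast
  qed
  then have "bounded_in (mod_space M) (range (\<lambda>r. r *\<^sub>R ?\<chi> \<omega>))" by (intro bounded_in_subset[OF *]) blast
  then have "?\<chi> \<omega> = 0"
    by (rule bounded_line_zero[OF convenient_spaceD(3)[OF cM] subspace_0[OF subspace_M]])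
  then show ?thesis by simp
qed

text \<open>In degree one, \<open>a \<otimes> b \<mapsto> a c(b)\<close> extends to the tensor
  square and is restricted to one-forms. In the step, the map is extended in two stages: first in
  the one-form, for each fixed \<omega>, through the tensor square; then in both factors through the
  tensor product over A.\<close>

lemma left_linear_extension:
  assumes "n \<ge> 1" "c \<in> normalized_cochains A M n"
  shows "\<exists>\<phi>. bounded_left_linear A (\<Omega> n) M \<phi> \<and> (\<forall>xs\<in>tuples E n. \<phi> (d_tensor n xs) = c xs)"
  using assms
proof (induction n arbitrary: c rule: nat_induct_at_least)
  case base
  have nil: "[] \<in> tuples E 0" by (simp add: tuples_def)
  have single: "[b] \<in> tuples E 1" if "b \<in> topspace E" for b using that by (simp add: tuples_def One_nat_def)
  note c = normalized_cochainsD[OF base]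
  have cb: "c [b] \<in> topspace (mod_space M)" if "b \<in> topspace E" for b using c(1)[OF single[OF that]] .
  have c_lin: "c [x + y] = c [x] + c [y]" "c [r *\<^sub>R x] = r *\<^sub>R c [x]"
    if "x \<in> topspace E" "y \<in> topspace E" for x y r
    using normalized_cochains_last[OF base[unfolded One_nat_def] nil that] by simp_all
  have bil: "bounded_bilinear_map E E (mod_space M) (\<lambda>a b. lact M a (c [b]))"
    unfolding bounded_bilinear_map_def
  proof (intro conjI ballI allI impI)
    fix B C assume *: "bounded_in E B \<and> bounded_in E C"
    then have "bounded_in (mod_space M) (c ` (\<lambda>b. [b]) ` C)" by (intro c(4) bounded_tuples_single) auto
    from lact_M(6)[OF conjunct1[OF *] this]
    show "bounded_in (mod_space M) ((\<lambda>(a, b). lact M a (c [b])) ` (B \<times> C))" by (rule bounded_in_subset) auto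
  qed (simp_all add: lact_M cb c_lin)
  then obtain h where h: "bounded_linear_on (mod_space T) (mod_space M) h"
    "\<And>a b. a \<in> topspace E \<Longrightarrow> b \<in> topspace E \<Longrightarrow> h (\<tau> a b) = lact M a (c [b])"
    by (rule universal_bilinear_factor[OF universal_T cM]) (simp_all add: congruent_def)
  have "h (lact T a t) = lact M a (h t)" if a: "a \<in> topspace E" and t: "t \<in> topspace (mod_space T)" for a t
    by (rule T_ext[OF cM bounded_linear_on_comp[OF lact_T[OF a] h(1)] bounded_linear_on_comp[OF h(1) lact_M_linear[OF a]] _ t])
      (simp add: a act_\<tau> h(2) mult_closed cb convenient_bimoduleD(6)[OF M])
  then have "bounded_left_linear A (\<Omega> 1) M h"
    unfolding bounded_left_linear_def act_one_forms
    using bounded_linear_on_comp[OF inclusion_W1 h(1)] by (simp add: topspace_W1)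
  moreover have "h (d b) = c [b]" if b: "b \<in> topspace E" for b
  proof -
    \<comment> \<open>Normalization removes the second term of h (d b), which is b acting on c
      [one].\<close>
    have "c [one] = 0" using c(5)[OF single[OF one(1)], of 0 1] by simp
    then show ?thesis
      using b one(1) bounded_linear_on_zero[OF lact_M_linear[OF b] subspace_M]
      by (simp add: d_one_def bounded_linear_on_diff[OF h(1) subspace_T] \<tau>_closed h(2) cb convenient_bimoduleD(4)[OF M])
  qed
  ultimately show ?case by (intro exI[of _ h]) (auto elim!: tuples_oneE simp: d_tensor_single)
next
  case (Suc n)
  note n = Suc.hyps
  note c = normalized_cochainsD[OF Suc.prems] and c_last = normalized_cochains_last[OF Suc.prems]
  note W = bimodule_W[OF n]
  have "\<exists>\<phi>. bounded_left_linear A (\<Omega> n) M \<phi> \<and> (\<forall>xs\<in>tuples E n. \<phi> (d_tensor n xs) = c (xs @ [b]))"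
    if "b \<in> topspace E" for b
    using Suc.IH[OF normalized_cochains_slice[OF Suc.prems that lE]] by simp
  then obtain g where g: "\<And>b. b \<in> topspace E \<Longrightarrow> bounded_left_linear A (\<Omega> n) M (g b)"
    and g_d: "\<And>b xs. b \<in> topspace E \<Longrightarrow> xs \<in> tuples E n \<Longrightarrow> g b (d_tensor n xs) = c (xs @ [b])"
    by metis
  note g_lin = bounded_left_linearD(1)[OF g]
  note g_act = bounded_left_linearD(2)[OF g]
  \<comment> \<open>The maps g b were chosen separately for each b. Linearity in b follows from
    uniqueness, since the values c (xs @ [b]) are linear in b.\<close>
  have g_add: "g (x + y) \<omega> = g x \<omega> + g y \<omega>"
    if "x \<in> topspace E" "y \<in> topspace E" "\<omega> \<in> topspace (W n)" for x y \<omega>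
  proof -
    have "g (x + y) \<omega> = g x \<omega> + 1 *\<^sub>R g y \<omega>"
      by (rule left_linear_ext[OF n g bounded_left_linear_lincomb[OF M g g] _ that(3)])
        (use that subspace_E in \<open>simp_all add: g_d c_last subspace_add\<close>)
    then show ?thesis by simp
  qed
  have g_scale: "g (r *\<^sub>R x) \<omega> = r *\<^sub>R g x \<omega>" if "x \<in> topspace E" "\<omega> \<in> topspace (W n)" for r x \<omega>
  proof -
    have "g (r *\<^sub>R x) \<omega> = g x \<omega> + (r - 1) *\<^sub>R g x \<omega>"
      by (rule left_linear_ext[OF n g bounded_left_linear_lincomb[OF M g g] _ that(2)])
        (use that subspace_E in \<open>simp_all add: g_d c_last(2)[OF _ that(1) that(1)] subspace_scale scaleR_diff_left\<close>)
    then show ?thesis by (simp add: scaleR_diff_left)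
  qed
  have g_one: "g one \<omega> = 0" if "\<omega> \<in> topspace (W n)" for \<omega>
  proof -
    have "c (xs @ [one]) = 0" if "xs \<in> tuples E n" for xs
      using c(5)[of "xs @ [one]" n 1] that one(1) by (auto simp: tuples_def nth_append)
    \<comment> \<open>Both g one and its double vanish on \<open>d_tensor\<close>, so they coincide
      by uniqueness, and g one is zero.\<close>
    then have "g one \<omega> = g one \<omega> + 1 *\<^sub>R g one \<omega>"
      by (intro left_linear_ext[OF n g bounded_left_linear_lincomb[OF M g g] _ that] one(1))
        (simp add: g_d one(1))
    then show ?thesis by simp
  qed
  \<comment> \<open>Boundedness in b jointly with the form does not follow from the choice of g; it
    comes from the boundedness of c on tuples with varying last entry.\<close>
  have g_equi: "equibounded (W n) (mod_space M) (g ` B)" if B: "bounded_in E B" for B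
  proof (rule left_linear_equibounded[OF n])
    have BE: "b \<in> topspace E" if "b \<in> B" for b using that bounded_in_topspace[OF B] by blast
    then show "bounded_left_linear A (\<Omega> n) M \<phi>" if "\<phi> \<in> g ` B" for \<phi> using that g by blast
    fix S assume S: "bounded_tuples E n S"
    then have "g b (d_tensor n xs) = c (xs @ [b])" if "b \<in> B" "xs \<in> S" for b xs
      using that BE g_d by (auto simp: bounded_tuples_def)
    then show "bounded_in (mod_space M) (\<Union>\<phi>\<in>g ` B. (\<lambda>xs. \<phi> (d_tensor n xs)) ` S)"
      by (intro bounded_in_subset[OF c(4)[OF bounded_tuples_snoc[OF S B]]]) force
  qed
  note ract = bounded_bilinear_mapD[OF convenient_bimoduleD(3)[OF W]]
  have g_bd: "bounded_in (mod_space M) {g b (ract (\<Omega> n) \<omega> a) |\<omega> a b. \<omega> \<in> B \<and> a \<in> B1 \<and> b \<in> B2}"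
    if "bounded_in (W n) B" "bounded_in E B1" "bounded_in E B2" for B B1 B2
  proof -
    have "bounded_in (mod_space M) (\<Union>\<phi>\<in>g ` B2. \<phi> ` {ract (\<Omega> n) \<omega> a |\<omega> a. \<omega> \<in> B \<and> a \<in> B1})"
      using g_equi[OF that(3)] ract(6)[OF that(1,2)] by (simp add: equibounded_def)
    then show ?thesis by (rule bounded_in_subset) blast
  qed
  \<comment> \<open>The value on \<open>\<tau> a b\<close> is dictated by
    \<open>\<omega> \<otimes> a db = \<omega>a \<otimes> db\<close>. Elements
    \<open>\<tau> a one\<close> are sent to zero by \<open>g_one\<close>, which is consistent with a
    db differing from \<open>\<tau> a b\<close> by such an element.\<close>
  have "\<exists>h. bounded_linear_on (mod_space T) (mod_space M) h \<and>
      (\<forall>a\<in>topspace E. \<forall>b\<in>topspace E. h (\<tau> a b) = g b (ract (\<Omega> n) \<omega> a))" if \<omega>: "\<omega> \<in> topspace (W n)" for \<omega>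
  proof -
    have "bounded_bilinear_map E E (mod_space M) (\<lambda>a b. g b (ract (\<Omega> n) \<omega> a))"
      unfolding bounded_bilinear_map_def
    proof (intro conjI ballI allI impI)
      fix B C assume *: "bounded_in E B \<and> bounded_in E C"
      from g_bd[OF bounded_in_singleton[OF lW[OF n] \<omega>] conjunct1[OF *] conjunct2[OF *]]
      show "bounded_in (mod_space M) ((\<lambda>(a, b). g b (ract (\<Omega> n) \<omega> a)) ` (B \<times> C))" by (rule bounded_in_subset) auto
    qed (simp_all add: \<omega> ract bounded_linear_onD(1-3)[OF g_lin] g_add g_scale)
    then obtain h where "bounded_linear_on (mod_space T) (mod_space M) h"
      "\<And>a b. a \<in> topspace E \<Longrightarrow> b \<in> topspace E \<Longrightarrow> h (\<tau> a b) = g b (ract (\<Omega> n) \<omega> a)"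
      by (rule universal_bilinear_factor[OF universal_T cM]) (simp_all add: congruent_def)
    then show ?thesis by blast
  qed
  then obtain h where h: "\<And>\<omega>. \<omega> \<in> topspace (W n) \<Longrightarrow> bounded_linear_on (mod_space T) (mod_space M) (h \<omega>)"
    and h_\<tau>: "\<And>\<omega> a b. \<omega> \<in> topspace (W n) \<Longrightarrow> a \<in> topspace E \<Longrightarrow> b \<in> topspace E \<Longrightarrow>
      h \<omega> (\<tau> a b) = g b (ract (\<Omega> n) \<omega> a)"
    by metis
  \<comment> \<open>Each h \<omega> is bounded by construction; a bilinear map needs the bound for
    all \<omega> of a bounded set at once.\<close>
  have h_equi: "equibounded (mod_space T) (mod_space M) (h ` B)" if B: "bounded_in (W n) B" for B
  proof (rule T_equibounded[OF cM])
    have BW: "\<omega> \<in> topspace (W n)" if "\<omega> \<in> B" for \<omega> using that bounded_in_topspace[OF B] by blast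
    then show "bounded_linear_on (mod_space T) (mod_space M) k" if "k \<in> h ` B" for k using that h by blast
    fix B1 B2 assume *: "bounded_in E B1" "bounded_in E B2"
    then have "h \<omega> (\<tau> a b) = g b (ract (\<Omega> n) \<omega> a)" if "\<omega> \<in> B" "a \<in> B1" "b \<in> B2" for \<omega> a b
      using that BW h_\<tau> bounded_in_topspace by blast
    then show "bounded_in (mod_space M) {k (\<tau> x y) |k x y. k \<in> h ` B \<and> x \<in> B1 \<and> y \<in> B2}"
      by (intro bounded_in_subset[OF g_bd[OF B *]]) blast
  qed
  have h_add: "h (\<omega> + \<omega>') t = h \<omega> t + h \<omega>' t"
    if "\<omega> \<in> topspace (W n)" "\<omega>' \<in> topspace (W n)" "t \<in> topspace (mod_space T)" for \<omega> \<omega>' t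
  proof -
    have "h (\<omega> + \<omega>') t = h \<omega> t + 1 *\<^sub>R h \<omega>' t"
      by (rule T_ext[OF cM h bounded_linear_on_lincomb[OF lM h h] _ that(3)])
        (use that subspace_W[OF n] in \<open>simp_all add: subspace_add h_\<tau> ract bounded_linear_onD(2)[OF g_lin]\<close>)
    then show ?thesis by simp
  qed
  have h_scale: "h (r *\<^sub>R \<omega>) t = r *\<^sub>R h \<omega> t"
    if "\<omega> \<in> topspace (W n)" "t \<in> topspace (mod_space T)" for r \<omega> t
    by (rule T_ext[OF cM h bounded_linear_on_scaleR[OF lM h] _ that(2)])
      (use that subspace_W[OF n] in \<open>simp_all add: subspace_scale h_\<tau> ract bounded_linear_onD(3)[OF g_lin]\<close>)
  have h_lact: "h (lact (\<Omega> n) x \<omega>) t = lact M x (h \<omega> t)"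
    if "x \<in> topspace E" "\<omega> \<in> topspace (W n)" "t \<in> topspace (mod_space T)" for x \<omega> t
    by (rule T_ext[OF cM h bounded_linear_on_comp[OF h lact_M_linear] _ that(3)])
      (use that bounded_linear_onD(1)[OF lact_W[OF n]] in
        \<open>simp_all add: h_\<tau> ract(1) convenient_bimoduleD(8)[OF W] g_act\<close>)
  \<comment> \<open>From (\<omega>x)a = \<omega>(xa) on generators. This is the balancing condition
    that lets h pass to the tensor product over A.\<close>
  have h_ract: "h (ract (\<Omega> n) \<omega> x) t = h \<omega> (lact T x t)"
    if "x \<in> topspace E" "\<omega> \<in> topspace (W n)" "t \<in> topspace (mod_space T)" for x \<omega> t
    by (rule T_ext[OF cM h bounded_linear_on_comp[OF lact_T h] _ that(3)])
      (use that in \<open>simp_all add: h_\<tau> ract(1) act_\<tau> mult_closed convenient_bimoduleD(7)[OF W]\<close>)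
  have WT: "t \<in> topspace (mod_space T)" if "t \<in> topspace (W 1)" for t using that by (simp add: topspace_W1)
  have "bounded_bilinear_map (W n) (W 1) (mod_space M) h"
    unfolding bounded_bilinear_map_def
  proof (intro conjI ballI allI impI)
    fix B C assume *: "bounded_in (W n) B \<and> bounded_in (W 1) C"
    then have "bounded_in (mod_space M) (\<Union>k\<in>h ` B. k ` C)" using h_equi by (simp add: equibounded_def bounded_in_W1)
    then show "bounded_in (mod_space M) ((\<lambda>(\<omega>, t). h \<omega> t) ` (B \<times> C))" by (rule bounded_in_subset) auto
  qed (simp_all add: WT bounded_linear_onD(1-3)[OF h] h_add h_scale)
  moreover have "(\<lambda>(\<omega>, t). h \<omega> t) respects balanced_pairs A (\<Omega> n) (\<Omega> 1)"
    unfolding respects_balanced_pairs act_one_forms by (simp add: h_ract WT)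
  ultimately obtain \<phi> where \<phi>: "bounded_linear_on (W (Suc n)) (mod_space M) \<phi>"
    and \<phi>_\<theta>: "\<And>\<omega> t. \<omega> \<in> topspace (W n) \<Longrightarrow> t \<in> topspace (W 1) \<Longrightarrow> \<phi> (\<theta> n \<omega> t) = h \<omega> t"
    by (rule universal_bilinear_factor[OF universal_\<theta>[OF n] cM]) blast
  have "\<phi> (lact (\<Omega> (Suc n)) x \<eta>) = lact M x (\<phi> \<eta>)"
    if x: "x \<in> topspace E" and \<eta>: "\<eta> \<in> topspace (W (Suc n))" for x \<eta>
    by (rule universal_bilinear_ext[OF universal_\<theta>[OF n] cM bounded_linear_on_comp[OF lact_W \<phi>]
          bounded_linear_on_comp[OF \<phi> lact_M_linear] _ \<eta>])
      (use x bounded_linear_onD(1)[OF lact_W[OF n]] in \<open>simp_all add: act_\<theta>[OF n] \<phi>_\<theta> h_lact WT\<close>)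
  then have "bounded_left_linear A (\<Omega> (Suc n)) M \<phi>" using \<phi> by (simp add: bounded_left_linear_def)
  moreover have "\<phi> (d_tensor (Suc n) (xs @ [b])) = c (xs @ [b])"
    if xs: "xs \<in> tuples E n" and b: "b \<in> topspace E" for xs b
  proof -
    note D = d_tensor_closed[OF n xs]
    have "\<phi> (d_tensor (Suc n) (xs @ [b])) = h (d_tensor n xs) (d b)"
      by (simp add: d_tensor_snoc[OF n] \<phi>_\<theta> D d_closed b)
    \<comment> \<open>The two terms of \<open>db = 1 \<otimes> b - b \<otimes> 1\<close>; the second
      is a value of g one and vanishes.\<close>
    also have "\<dots> = g b (ract (\<Omega> n) (d_tensor n xs) one) - g one (ract (\<Omega> n) (d_tensor n xs) b)"
      using b one(1) D by (simp add: d_one_def bounded_linear_on_diff[OF h subspace_T] \<tau>_closed h_\<tau>)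
    also have "\<dots> = c (xs @ [b])"
      using b D by (simp add: convenient_bimoduleD(5)[OF W] g_one ract(1) g_d xs)
    finally show ?thesis .
  qed
  ultimately show ?case by (auto elim!: tuples_SucE)
qed

end

end

section \<open>Bimodule homomorphisms and cocycles\<close>

context noncommutative_forms
begin

context
  fixes M :: "('a, 'm::real_vector) bimodule_data" and n :: nat
  assumes M: "convenient_bimodule A M" and n: "n \<ge> 1"
begin

private abbreviation "pullback \<equiv> (\<lambda>\<Phi>. \<lambda>xs\<in>tuples E n. \<Phi> (d_tensor n xs))"

private lemmas lact_W_closed = bounded_bilinear_mapD(1)[OF convenient_bimoduleD(2)[OF bimodule_W[OF n]]]
private lemmas ract_W_closed = bounded_bilinear_mapD(1)[OF convenient_bimoduleD(3)[OF bimodule_W[OF n]]]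

lemma bimodule_homs_iff:
  "\<Phi> \<in> bimodule_homs A (\<Omega> n) M \<longleftrightarrow>
     bounded_left_linear A (\<Omega> n) M \<Phi> \<and>
     (\<forall>a\<in>topspace E. \<forall>\<omega>\<in>topspace (W n). \<Phi> (ract (\<Omega> n) \<omega> a) = ract M (\<Phi> \<omega>) a) \<and>
     \<Phi> \<in> extensional (topspace (W n))"
  by (auto simp: bimodule_homs_def bounded_linear_maps_iff[OF subspace_W[OF n]] bounded_left_linear_def)

text \<open>Applying \<phi> to the vanishing coboundary of \<open>d\<^sup>n\<close> reproduces every
  term of the coboundary of the pullback except the one with the right action. What remains is the
  defect of right linearity at \<open>d_tensor n xs\<close>.\<close>

lemma hochschild_coboundary_left_linear:
  assumes \<phi>: "bounded_left_linear A (\<Omega> n) M \<phi>" and xs: "xs \<in> tuples E n" and a: "a \<in> topspace E"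
  shows "hochschild_coboundary A M n (pullback \<phi>) (xs @ [a]) =
    (-1) ^ (n + 1) *\<^sub>R (ract M (\<phi> (d_tensor n xs)) a - \<phi> (ract (\<Omega> n) (d_tensor n xs) a))"
proof -
  let ?xs = "xs @ [a]"
  have xs': "?xs \<in> tuples E (Suc n)" using xs a by simp
  note lin = bounded_left_linearD(1)[OF \<phi>]
  note tl = tl_tuples[OF xs'] and hd = hd_tuples[OF xs']
  let ?l = "lact (\<Omega> n) (hd ?xs) (d_tensor n (tl ?xs))" and ?r = "ract (\<Omega> n) (d_tensor n xs) a"
  let ?s = "\<Sum>i = 1..n. (-1) ^ i *\<^sub>R d_tensor n (contract i ?xs)"
  have mem: "?l \<in> topspace (W n)" "?r \<in> topspace (W n)" "?s \<in> topspace (W n)"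
    using lact_W_closed hd ract_W_closed a d_tensor_closed[OF n] tl xs contract_tuples[OF xs'] subspace_W[OF n]
    by (auto intro!: subspace_sum subspace_scale)
  have "?l + ?s + (-1) ^ (n + 1) *\<^sub>R ?r = 0"
    using hochschild_coboundary_d_tensor[OF n xs'] by (simp add: hochschild_coboundary_def)
  then have "\<phi> (?l + ?s + (-1) ^ (n + 1) *\<^sub>R ?r) = 0"
    using bounded_linear_on_zero[OF lin subspace_W[OF n]] by (simp only:)
  then have "\<phi> ?l + \<phi> ?s + (-1) ^ (n + 1) *\<^sub>R \<phi> ?r = 0"
    using mem subspace_W[OF n] by (simp only: bounded_linear_onD(2,3)[OF lin] subspace_add subspace_scale)
  moreover have "\<phi> ?l = lact M (hd ?xs) (pullback \<phi> (tl ?xs))"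
    using bounded_left_linearD(2)[OF \<phi> hd d_tensor_closed[OF n tl]] tl by (simp only: restrict_apply' )
  moreover have "\<phi> ?s = (\<Sum>i = 1..n. (-1) ^ i *\<^sub>R \<phi> (d_tensor n (contract i ?xs)))"
    by (rule bounded_linear_on_sum[OF lin subspace_W[OF n]]) (rule d_tensor_closed[OF n contract_tuples[OF xs']])
  moreover have "\<dots> = (\<Sum>i = 1..n. (-1) ^ i *\<^sub>R pullback \<phi> (contract i ?xs))"
    by (intro sum.cong refl) (simp only: restrict_apply'[OF contract_tuples[OF xs']])
  ultimately have "lact M (hd ?xs) (pullback \<phi> (tl ?xs)) + (\<Sum>i = 1..n. (-1) ^ i *\<^sub>R pullback \<phi> (contract i ?xs)) =
      - ((-1) ^ (n + 1) *\<^sub>R \<phi> ?r)"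
    by (simp only: eq_neg_iff_add_eq_0)
  then have "hochschild_coboundary A M n (pullback \<phi>) ?xs =
      - ((-1) ^ (n + 1) *\<^sub>R \<phi> ?r) + (-1) ^ (n + 1) *\<^sub>R ract M (pullback \<phi> (butlast ?xs)) (last ?xs)"
    by (simp only: hochschild_coboundary_def)
  then show ?thesis using xs by (simp add: scaleR_diff_right)
qed

text \<open>The last argument is split off because it is the one by which right linearity is
  tested.\<close>

lemma normalized_cocycles_eq:
  "normalized_cocycles A M n = {c \<in> normalized_cochains A M n.
     \<forall>xs\<in>tuples E n. \<forall>a\<in>topspace E. hochschild_coboundary A M n c (xs @ [a]) = 0}"
proof -
  have "(\<forall>xs\<in>tuples E (n + 1). P xs) \<longleftrightarrow> (\<forall>xs\<in>tuples E n. \<forall>a\<in>topspace E. P (xs @ [a]))" for P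
    using tuples_SucE[of _ E n] tuples_snoc[of _ _ E n] by (metis Suc_eq_plus1)
  then show ?thesis by (auto simp: normalized_cocycles_def normalized_cochains_def)
qed

lemma pullback_cochain:
  assumes \<phi>: "bounded_left_linear A (\<Omega> n) M \<phi>"
  shows "pullback \<phi> \<in> normalized_cochains A M n"
proof -
  note lin = bounded_left_linearD(1)[OF \<phi>]
  have "pullback \<phi> \<in> bounded_multilinear_maps E n (mod_space M)"
    unfolding bounded_multilinear_maps_def
  proof (intro CollectI conjI ballI allI impI)
    show "pullback \<phi> \<in> tuples E n \<rightarrow>\<^sub>E topspace (mod_space M)"
      using bounded_linear_onD(1)[OF lin] d_tensor_closed[OF n] by auto
  next
    fix xs i x y assume *: "xs \<in> tuples E n" "i < n" "x \<in> topspace E" "y \<in> topspace E"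
    then have "x + y \<in> topspace E" using subspace_E by (simp add: subspace_add)
    then show "pullback \<phi> (xs[i := x + y]) = pullback \<phi> (xs[i := x]) + pullback \<phi> (xs[i := y])"
      using * by (simp add: tuples_update d_tensor_update(1)[OF n] bounded_linear_onD(2)[OF lin] d_tensor_closed[OF n])
  next
    fix xs i r x assume *: "xs \<in> tuples E n" "i < n" "x \<in> topspace E"
    then have "r *\<^sub>R x \<in> topspace E" using subspace_E by (simp add: subspace_scale)
    then show "pullback \<phi> (xs[i := r *\<^sub>R x]) = r *\<^sub>R pullback \<phi> (xs[i := x])"
      using * by (simp add: tuples_update d_tensor_update(2)[OF n _ _ _ *(3)] bounded_linear_onD(3)[OF lin] d_tensor_closed[OF n])
  next
    fix S assume S: "bounded_tuples E n S"
    then have "pullback \<phi> ` S = \<phi> ` d_tensor n ` S"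
      unfolding image_image by (intro image_cong) (auto simp: bounded_tuples_def)
    then show "bounded_in (mod_space M) (pullback \<phi> ` S)"
      using bounded_linear_onD(4)[OF lin d_tensor_bounded[OF n S]] by simp
  qed
  moreover have "normalized_cochain A n (pullback \<phi>)"
    unfolding normalized_cochain_def
  proof (intro ballI impI)
    fix xs assume xs: "xs \<in> tuples E n" and "\<exists>i<n. \<exists>r. xs ! i = r *\<^sub>R one"
    then have "d_tensor n xs = 0" using d_tensor_normalized[OF n xs] by blast
    then show "pullback \<phi> xs = 0" using xs bounded_linear_on_zero[OF lin subspace_W[OF n]] by simp
  qed
  ultimately show ?thesis by (simp add: normalized_cochains_def)
qed

lemma pullback_cocycle:
  assumes \<Phi>: "\<Phi> \<in> bimodule_homs A (\<Omega> n) M"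
  shows "pullback \<Phi> \<in> normalized_cocycles A M n"
  using \<Phi> d_tensor_closed[OF n] unfolding bimodule_homs_iff normalized_cocycles_eq
  by (simp add: pullback_cochain hochschild_coboundary_left_linear del: power_Suc)

lemma cocycle_pullback:
  assumes c: "c \<in> normalized_cocycles A M n"
  shows "\<exists>\<Phi>\<in>bimodule_homs A (\<Omega> n) M. pullback \<Phi> = c"
proof -
  have c': "c \<in> normalized_cochains A M n" using c by (simp add: normalized_cocycles_eq)
  then obtain \<phi> where \<phi>: "bounded_left_linear A (\<Omega> n) M \<phi>"
    and \<phi>_c: "\<And>xs. xs \<in> tuples E n \<Longrightarrow> \<phi> (d_tensor n xs) = c xs"
    using left_linear_extension[OF M n] by blast
  note lin = bounded_left_linearD(1)[OF \<phi>]
  have ext: "c \<in> extensional (tuples E n)"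
    using c' by (auto simp: normalized_cochains_def bounded_multilinear_maps_def PiE_def)
  have eq: "pullback \<phi> = c"
    by (rule extensionalityI[OF _ ext]) (simp_all add: \<phi>_c)
  \<comment> \<open>As the two actions commute, both sides are left linear in \<omega>. The cocycle
    condition makes them agree on \<open>d_tensor\<close>, so uniqueness applies.\<close>
  have right: "\<phi> (ract (\<Omega> n) \<omega> a) = ract M (\<phi> \<omega>) a" if a: "a \<in> topspace E" and \<omega>: "\<omega> \<in> topspace (W n)" for a \<omega>
  proof (rule left_linear_ext[OF M n _ _ _ \<omega>])
    note W = bimodule_W[OF n]
    show "bounded_left_linear A (\<Omega> n) M (\<lambda>\<omega>. \<phi> (ract (\<Omega> n) \<omega> a))"
      unfolding bounded_left_linear_def
      using bounded_linear_on_comp[OF ract_W[OF n a] lin]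
      by (simp add: convenient_bimoduleD(8)[OF W] a bounded_left_linearD(2)[OF \<phi>] ract_W_closed)
    show "bounded_left_linear A (\<Omega> n) M (\<lambda>\<omega>. ract M (\<phi> \<omega>) a)"
      unfolding bounded_left_linear_def
      using bounded_linear_on_comp[OF lin bounded_bilinear_map_left[OF lE convenient_bimoduleD(3)[OF M] a]]
      by (simp add: convenient_bimoduleD(8)[OF M] a bounded_left_linearD(2)[OF \<phi>] bounded_linear_onD(1)[OF lin])
    fix xs assume xs: "xs \<in> tuples E n"
    then have "hochschild_coboundary A M n (pullback \<phi>) (xs @ [a]) = 0"
      using c a unfolding eq by (simp add: normalized_cocycles_eq)
    then show "\<phi> (ract (\<Omega> n) (d_tensor n xs) a) = ract M (\<phi> (d_tensor n xs)) a"
      unfolding hochschild_coboundary_left_linear[OF \<phi> xs a] by simp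
  qed
  \<comment> \<open>Homomorphisms are extensional here; restricting \<phi> leaves the pullback
    alone, since \<open>d_tensor\<close> takes values in the carrier.\<close>
  let ?\<Phi> = "restrict \<phi> (topspace (W n))"
  have "?\<Phi> \<in> bimodule_homs A (\<Omega> n) M"
    unfolding bimodule_homs_iff bounded_left_linear_def
    using restrict_bounded_linear_maps[OF subspace_W[OF n] lin] bounded_linear_maps_iff[OF subspace_W[OF n]]
    by (auto simp: bounded_left_linearD(2)[OF \<phi>] right lact_W_closed ract_W_closed)
  moreover have "pullback ?\<Phi> = c"
    unfolding eq[symmetric] by (auto simp: d_tensor_closed[OF n])
  ultimately show ?thesis by blast
qed

lemma pullback_isomorphism:
  "bornological_isomorphism (topspace (W n)) (bimodule_homs A (\<Omega> n) M) (bounded_homs A (\<Omega> n) M)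
     (tuples E n) (normalized_cocycles A M n) (bounded_cocycles A M n) pullback"
proof -
  let ?H = "bimodule_homs A (\<Omega> n) M" and ?Z = "normalized_cocycles A M n"
  note closed = d_tensor_closed[OF n]
  have inj: "inj_on pullback ?H"
  proof (rule inj_onI)
    fix \<Phi> \<Psi> assume *: "\<Phi> \<in> ?H" "\<Psi> \<in> ?H" and eq: "pullback \<Phi> = pullback \<Psi>"
    show "\<Phi> = \<Psi>"
    proof (rule extensionalityI[of _ "topspace (W n)"])
      fix \<omega> assume \<omega>: "\<omega> \<in> topspace (W n)"
      show "\<Phi> \<omega> = \<Psi> \<omega>"
      proof (rule left_linear_ext[OF M n _ _ _ \<omega>])
        show "\<Phi> (d_tensor n xs) = \<Psi> (d_tensor n xs)" if "xs \<in> tuples E n" for xs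
          using fun_cong[OF eq, of xs] that by simp
      qed (use * in \<open>auto simp: bimodule_homs_iff\<close>)
    qed (use * in \<open>auto simp: bimodule_homs_iff\<close>)
  qed
  have bij: "bij_betw pullback ?H ?Z"
    unfolding bij_betw_def using inj pullback_cocycle cocycle_pullback by blast
  show ?thesis
    unfolding bornological_isomorphism_def
  proof (intro conjI ballI allI impI bij)
    fix C assume C: "C \<subseteq> ?H" "bounded_homs A (\<Omega> n) M C"
    show "bounded_cocycles A M n (pullback ` C)"
      unfolding bounded_cocycles_def
    proof (intro conjI allI impI)
      show "pullback ` C \<subseteq> ?Z" using C(1) pullback_cocycle by blast
      fix S assume S: "bounded_tuples E n S"
      have "bounded_in (mod_space M) (\<Union>\<Phi>\<in>C. \<Phi> ` d_tensor n ` S)"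
        using C(2) d_tensor_bounded[OF n S] unfolding bounded_homs_def by blast
      then show "bounded_in (mod_space M) (\<Union>c\<in>pullback ` C. c ` S)"
        by (rule bounded_in_subset) (use S in \<open>auto simp: bounded_tuples_def\<close>)
    qed
  next
    fix C assume C: "C \<subseteq> ?Z" "bounded_cocycles A M n C"
    have inv: "inv_into ?H pullback c \<in> ?H" "pullback (inv_into ?H pullback c) = c" if "c \<in> C" for c
      using that C(1) bij_betwE[OF bij_betw_inv_into[OF bij]] bij_betw_inv_into_right[OF bij, of c] by blast+
    \<comment> \<open>The preimages are known only through their values c xs on
      \<open>d_tensor n xs\<close>, which is all that \<open>left_linear_equibounded\<close> asks
      for.\<close>
    have "equibounded (W n) (mod_space M) (inv_into ?H pullback ` C)"
    proof (rule left_linear_equibounded[OF M n])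
      show "bounded_left_linear A (\<Omega> n) M \<phi>" if "\<phi> \<in> inv_into ?H pullback ` C" for \<phi>
        using that inv(1) bimodule_homs_iff by blast
      fix S assume S: "bounded_tuples E n S"
      have "inv_into ?H pullback c (d_tensor n xs) = c xs" if "c \<in> C" "xs \<in> S" for c xs
        using fun_cong[OF inv(2)[OF that(1)], of xs] that(2) S by (auto simp: bounded_tuples_def)
      moreover have "bounded_in (mod_space M) (\<Union>c\<in>C. c ` S)" using C(2) S by (simp add: bounded_cocycles_def)
      ultimately show "bounded_in (mod_space M) (\<Union>\<phi>\<in>inv_into ?H pullback ` C. (\<lambda>xs. \<phi> (d_tensor n xs)) ` S)" by simp
    qed
    then show "bounded_homs A (\<Omega> n) M (inv_into ?H pullback ` C)"
      using inv(1) by (auto simp: bounded_homs_def equibounded_def)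
  qed (auto simp: closed fun_eq_iff)
qed

end

end

theorem proposition3p3:
  fixes A :: "'a::real_vector algebra_data"
    and M :: "('a, 'm::real_vector) bimodule_data"
    and T :: "('a, 'w::real_vector) bimodule_data"
    and \<tau> :: "'a \<Rightarrow> 'a \<Rightarrow> 'w"
    and \<Omega> :: "nat \<Rightarrow> ('a, 'w) bimodule_data"
    and \<theta> :: "nat \<Rightarrow> 'w \<Rightarrow> 'w \<Rightarrow> 'w"
    and n :: nat
  assumes "convenient_algebra A"
    and "convenient_bimodule A M"
    and "differential_forms A T \<tau> \<Omega> \<theta>"
    and "n \<ge> 1"
  shows "bornological_isomorphism
           (topspace (mod_space (\<Omega> n))) (bimodule_homs A (\<Omega> n) M) (bounded_homs A (\<Omega> n) M)
           (tuples (alg_space A) n) (normalized_cocycles A M n) (bounded_cocycles A M n)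
           (\<lambda>\<Phi>. \<lambda>xs\<in>tuples (alg_space A) n. \<Phi> (d_power A \<tau> \<theta> n xs))"
proof -
  interpret noncommutative_forms A T \<tau> \<Omega> \<theta>
    using assms(1,3) by unfold_locales
  show ?thesis by (rule pullback_isomorphism[OF assms(2,4)])
qed

end
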